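(* Let $G$ be a properly connected $m$-uniform hypergraph. If $j(I(G))\neq0$, then $$j(I(G))=m\cdot e(\Bbbk[G]).$$
   Context: A hypergraph $G$ has a finite non-empty node set $V(G)=\{x_1,\dots,x_n\}$ and an edge set $E(G)$ consisting of subsets of $V(G)$; it is $m$-uniform ($m\ge1$) if every edge has exactly $m$ elements. It is properly connected if for any two edges $u,v$ there is a sequence of edges starting with $u$ and ending with $v$ such that consecutive edges intersect in exactly $m-1$ nodes. Hypergraphs are assumed to have no isolated nodes (nodes lying in no edge); this is automatic when $j(I(G))\ne0$. Fix a field $\Bbbk$ and view nodes as indeterminates. The edge ideal is $I(G)=(x_{i_1}\cdots x_{i_m}:\{x_{i_1},\dots,x_{i_m}\}\in E(G))\subset R=\Bbbk[x_1,\dots,x_n]_{(x_1,\dots,x_n)}$. The edge subring $\Bbbk[G]$ is the $\Bbbk$-subalgebra generated by the monomials $x_{i_1}\cdots x_{i_m}$ with $\{x_{i_1},\dots,x_{i_m}\}\in E(G)$, regarded as a standard graded algebra by giving these generators degree $1$; $e(\Bbbk[G])$ is its Hilbert–Samuel multiplicity with respect to this grading. For an ideal $I$ in a Noetherian local ring $(R,\mathfrak m)$ of dimension $n\ge1$, the $j$-multiplicity is $j(I)=(n-1)!\lim_{t\to\infty}\lambda_R(\Gamma_{\mathfrak m}(I^t/I^{t+1}))/t^{n-1}$, where $\lambda_R$ is length and $\Gamma_{\mathfrak m}$ is the zeroth local cohomology. *)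

theory Defs
  imports
    "HOL-Algebra.Algebra"
    "HOL-Algebra.Algebraic_Closure_Type"
    "HOL-Computational_Algebra.Fraction_Field"
    "HOL-Library.Poly_Mapping"
    "HOL-Library.Extended_Real"
begin

definition hypergraph :: "'v set \<Rightarrow> 'v set set \<Rightarrow> bool" where
  "hypergraph V E \<longleftrightarrow> finite V \<and> V \<noteq> {} \<and> E \<subseteq> Pow V"

definition isolated_node :: "'v set set \<Rightarrow> 'v \<Rightarrow> bool" where
  "isolated_node E v \<longleftrightarrow> (\<forall>e\<in>E. v \<notin> e)"

definition uniform_hypergraph :: "nat \<Rightarrow> 'v set set \<Rightarrow> bool" where
  "uniform_hypergraph m E \<longleftrightarrow> (\<forall>e\<in>E. card e = m)"

definition properly_connected :: "nat \<Rightarrow> 'v set set \<Rightarrow> bool" where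
  "properly_connected m E \<longleftrightarrow>
     (\<forall>u\<in>E. \<forall>v\<in>E. \<exists>p. p \<noteq> [] \<and> set p \<subseteq> E \<and> hd p = u \<and> last p = v \<and>
        successively (\<lambda>a b. card (a \<inter> b) = m - 1) p)"

definition krull_dim :: "('a, 'b) ring_scheme \<Rightarrow> enat" where
  "krull_dim R = Sup {enat n | n. \<exists>P. (\<forall>i\<le>n. primeideal (P i) R) \<and> (\<forall>i<n. P i \<subset> P (Suc i))}"

definition module_length :: "('a, 'b) ring_scheme \<Rightarrow> ('a, 'c, 'd) module_scheme \<Rightarrow> enat" where
  "module_length R M =
     Sup {enat n | n. \<exists>N. (\<forall>i\<le>n. submodule (N i) R M) \<and> (\<forall>i<n. N i \<subset> N (Suc i))}"

definition ideal_module :: "('a, 'b) ring_scheme \<Rightarrow> 'a set \<Rightarrow> ('a, 'a) module" where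
  "ideal_module R I =
     \<lparr>carrier = I, monoid.mult = monoid.mult R, one = \<one>\<^bsub>R\<^esub>, ring.zero = \<zero>\<^bsub>R\<^esub>, add = add R,
      module.smult = monoid.mult R\<rparr>"

text \<open>The fields \<open>mult\<close> and \<open>one\<close> of a module record play no role in the module structure.\<close>

definition quotient_module :: "('a, 'c) module \<Rightarrow> 'c set \<Rightarrow> ('a, 'c set) module" where
  "quotient_module M N =
     \<lparr>carrier = a_rcosets\<^bsub>M\<^esub> N, monoid.mult = undefined, one = undefined,
      ring.zero = N, add = set_add M,
      module.smult = (\<lambda>r C. \<Union>x\<in>C. N +>\<^bsub>M\<^esub> (r \<odot>\<^bsub>M\<^esub> x))\<rparr>"

text \<open>Powers of ideals are taken in the library's multiplicative monoid of ideals, whose unit is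
  the whole ring.\<close>

abbreviation ideal_power :: "('a, 'b) ring_scheme \<Rightarrow> 'a set \<Rightarrow> nat \<Rightarrow> 'a set" where
  "ideal_power R I t \<equiv> I [^]\<^bsub>ideals_set R\<^esub> t"

definition local_cohomology0 ::
  "('a, 'b) ring_scheme \<Rightarrow> 'a set \<Rightarrow> ('a, 'c) module \<Rightarrow> ('a, 'c) module" where
  "local_cohomology0 R I M =
     M\<lparr>carrier := {x \<in> carrier M. \<exists>k. \<forall>a\<in>ideal_power R I k. a \<odot>\<^bsub>M\<^esub> x = \<zero>\<^bsub>M\<^esub>}\<rparr>"

text \<open>\<open>\<mm>\<close> is the maximal ideal of the Noetherian local ring \<open>R\<close>, which has positive finite
  dimension.\<close>

definition j_multiplicity :: "('a, 'b) ring_scheme \<Rightarrow> 'a set \<Rightarrow> 'a set \<Rightarrow> ereal" where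
  "j_multiplicity R \<mm> I =
     (let n = the_enat (krull_dim R) in
      ereal (fact (n - 1)) *
      lim (\<lambda>t. ereal_of_enat
                 (module_length R
                    (local_cohomology0 R \<mm>
                       (quotient_module (ideal_module R (ideal_power R I t))
                          (ideal_power R I (t + 1)))))
               / ereal (real t ^ (n - 1))))"

text \<open>Exponent vectors are finitely supported maps into \<open>nat\<close>. Fraction fields require the
  polynomials to form an integral domain, which the library provides for linearly ordered
  indeterminates; the order is not used otherwise.\<close>

type_synonym ('v, 'k) mpoly = "('v \<Rightarrow>\<^sub>0 nat) \<Rightarrow>\<^sub>0 'k"

definition mconst :: "'k::field \<Rightarrow> ('v, 'k) mpoly" where
  "mconst c = Poly_Mapping.single 0 c"

definition mvar :: "'v \<Rightarrow> ('v, 'k::field) mpoly" where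
  "mvar v = Poly_Mapping.single (Poly_Mapping.single v 1) 1"

global_interpretation mpoly: vector_space "\<lambda>c (p :: ('v, 'k::field) mpoly). mconst c * p"
  defines mpoly_span = mpoly.span and mpoly_dim = mpoly.dim
  by unfold_locales
    (simp_all add: mconst_def algebra_simps single_add mult_single flip: mult.assoc)

definition mpoly_ring :: "'v set \<Rightarrow> ('v, 'k::field) mpoly ring" where
  "mpoly_ring V = ring_of_type_algebra\<lparr>carrier := {p. \<forall>a\<in>Poly_Mapping.keys p. Poly_Mapping.keys a \<subseteq> V}\<rparr>"

text \<open>The localization at the prime ideal \<open>P\<close> of a subring \<open>A\<close> of an integral domain, inside the
  fraction field.\<close>

definition localization :: "'a::idom ring \<Rightarrow> 'a set \<Rightarrow> 'a fract ring" where
  "localization A P =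
     ring_of_type_algebra\<lparr>carrier := {Fract f g | f g. f \<in> carrier A \<and> g \<in> carrier A - P}\<rparr>"

definition local_poly_ring :: "'v::linorder set \<Rightarrow> ('v, 'k::field) mpoly fract ring" where
  "local_poly_ring V = localization (mpoly_ring V) (genideal (mpoly_ring V) (mvar ` V))"

definition local_max_ideal :: "'v::linorder set \<Rightarrow> ('v, 'k::field) mpoly fract set" where
  "local_max_ideal V = genideal (local_poly_ring V) ((\<lambda>v. Fract (mvar v) 1) ` V)"

definition edge_monomial :: "'v set \<Rightarrow> ('v, 'k::field) mpoly" where
  "edge_monomial e = (\<Prod>v\<in>e. mvar v)"

definition edge_ideal :: "'v::linorder set \<Rightarrow> 'v set set \<Rightarrow> ('v, 'k::field) mpoly fract set" where
  "edge_ideal V E = genideal (local_poly_ring V) ((\<lambda>e. Fract (edge_monomial e) 1) ` E)"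

definition edge_subring :: "'v set \<Rightarrow> 'v set set \<Rightarrow> ('v, 'k::field) mpoly ring" where
  "edge_subring V E =
     (mpoly_ring V)\<lparr>carrier := generate_ring (mpoly_ring V) (range mconst \<union> edge_monomial ` E)\<rparr>"

text \<open>The degree \<open>t\<close> component when every edge monomial is given degree 1.\<close>

definition edge_subring_component :: "'v set set \<Rightarrow> nat \<Rightarrow> ('v, 'k::field) mpoly set" where
  "edge_subring_component E t =
     mpoly_span {prod_list (map edge_monomial es) | es. set es \<subseteq> E \<and> length es = t}"

text \<open>The Hilbert--Samuel multiplicity of a standard graded \<open>'k\<close>-algebra \<open>A\<close> with graded
  components \<open>G t\<close>: for \<open>d = dim A > 0\<close> it is \<open>(d - 1)!\<close> times the coefficient of \<open>t ^ (d - 1)\<close> in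
  the Hilbert polynomial, and for \<open>d = 0\<close> the length of \<open>A\<close>.\<close>

definition graded_multiplicity ::
  "('v, 'k::field) mpoly ring \<Rightarrow> (nat \<Rightarrow> ('v, 'k) mpoly set) \<Rightarrow> ereal" where
  "graded_multiplicity A G =
     (let d = the_enat (krull_dim A) in
      if d = 0 then suminf (\<lambda>t. ereal (real (mpoly_dim (G t))))
      else ereal (fact (d - 1)) *
           lim (\<lambda>t. ereal (real (mpoly_dim (G t)) / real t ^ (d - 1))))"

definition edge_subring_multiplicity :: "'k::field itself \<Rightarrow> 'v set \<Rightarrow> 'v set set \<Rightarrow> ereal" where
  "edge_subring_multiplicity _ V E =
     graded_multiplicity (edge_subring V E :: ('v, 'k) mpoly ring) (edge_subring_component E)"

definition edge_ideal_j_multiplicity ::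
  "'k::field itself \<Rightarrow> 'v::linorder set \<Rightarrow> 'v set set \<Rightarrow> ereal" where
  "edge_ideal_j_multiplicity _ V E =
     j_multiplicity (local_poly_ring V :: ('v, 'k) mpoly fract ring) (local_max_ideal V)
       (edge_ideal V E)"

end

theory Submission
  imports Defs "HOL-Library.Multiset_Order"
begin

text \<open>Write \<open>S\<^sub>t\<close> for the set of sums of \<open>t\<close> edge vectors and \<open>n\<close> for the number of nodes. Then
  \<open>|S\<^sub>t|\<close> is the Hilbert function of the edge subring, and the length in the definition of the
  \<open>j\<close>-multiplicity counts the exponents \<open>a\<close> of monomials in \<open>I\<^sup>t\<close> but not in \<open>I\<^bsup>t+1\<^esup>\<close> that are killed
  by a power of the maximal ideal. By Dickson's lemma every such \<open>a\<close> is an element of \<open>S\<^sub>t\<close> plus a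
  bounded vector.

  Proper connectedness implies that either the edges generate the lattice of all vectors whose
  coordinate sum is divisible by \<open>m\<close>, or the nodes split into two parts meeting every edge in a
  constant number of nodes. In the second case \<open>|S\<^sub>t|\<close> grows at most like \<open>t\<^bsup>n-2\<^esup>\<close>, so the
  \<open>j\<close>-multiplicity vanishes. In the first case translations by fixed elements of the semigroup show
  that each of the degrees \<open>m t, \<dots>, m t + m - 1\<close> contributes asymptotically \<open>|S\<^sub>t|\<close> exponents, and
  that all higher degrees together contribute a negligible number; hence the factor \<open>m\<close>.\<close>

subsection \<open>Growth of sumsets\<close>

text \<open>Both multiplicities are defined through \<open>lim\<close>, so convergence has to be
  proved and not only an equality of values. It rests on \<open>card (S t)\<close> being eventually
  polynomial in \<open>t\<close> and at most \<open>(m * t + 1) ^ (n - 1)\<close>: after division by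
  \<open>t ^ (n - 1)\<close> it converges, and the limit is insensitive to replacing
  \<open>t\<close> by \<open>t + l\<close> or \<open>t - l\<close>. This insensitivity is what makes
  estimates up to translation by a fixed sum of edges sharp enough. In the first case some fixed
  \<open>w\<close> in \<open>S l\<close> absorbs every exponent of degree \<open>m\<close>, that is,
  \<open>w\<close> plus the exponent is a sum of \<open>l + 1\<close> edges. A sum in
  \<open>w + S (t - l)\<close> can therefore carry no remainder of degree \<open>m\<close> or more
  outside the next power, and the sums not of this form number
  \<open>card (S t) - card (S (t - l))\<close>, whose quotient by \<open>t ^ (n - 1)\<close> tends
  to 0. This is why the higher degrees are negligible. The normalizations also have to agree: the
  local ring has dimension \<open>n\<close>, and so has the edge subring in the first case, because
  \<open>m\<close> times each unit vector is a difference of two of its exponents.\<close>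

lemma finite_antitone_basis:
  fixes F :: "'a \<Rightarrow> 'i \<Rightarrow> nat"
  assumes "finite I"
  shows "\<exists>B\<subseteq>A. finite B \<and> (\<forall>a\<in>A. \<exists>b\<in>B. \<forall>i\<in>I. F b i \<le> F a i)"
  using assms
proof (induction I arbitrary: A rule: finite_induct)
  case empty
  show ?case
  proof (cases "A = {}")
    case False
    then obtain x where "x \<in> A" by blast
    then show ?thesis by (intro exI[of _ "{x}"]) auto
  qed auto
next
  case (insert i I)
  obtain B0 where B0: "B0 \<subseteq> A" "finite B0" "\<forall>a\<in>A. \<exists>b\<in>B0. \<forall>i\<in>I. F b i \<le> F a i"
    using insert.IH by blast
  \<comment> \<open>An element with \<open>F a i\<close> at least \<open>N\<close> is dominated in
    coordinate \<open>i\<close> by any member of \<open>B0\<close>, so \<open>B0\<close> takes care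
    of it. The others fall into the finitely many slices \<open>F a i = j\<close> with
    \<open>j < N\<close>, and the induction hypothesis covers each slice by a finite
    \<open>C j\<close>.\<close>
  define N where "N = Max (insert 0 ((\<lambda>b. F b i) ` B0))"
  have N: "F b i \<le> N" if "b \<in> B0" for b
    unfolding N_def using that B0(2) by (intro Max_ge) auto
  have "\<forall>j. \<exists>B. B \<subseteq> {a\<in>A. F a i = j} \<and> finite B \<and>
      (\<forall>a\<in>{a\<in>A. F a i = j}. \<exists>b\<in>B. \<forall>i\<in>I. F b i \<le> F a i)"
    using insert.IH by blast
  from choice[OF this] obtain C where "\<forall>j. C j \<subseteq> {a\<in>A. F a i = j} \<and> finite (C j) \<and>
      (\<forall>a\<in>{a\<in>A. F a i = j}. \<exists>b\<in>C j. \<forall>i\<in>I. F b i \<le> F a i)" ..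
  then have C: "\<And>j. C j \<subseteq> {a\<in>A. F a i = j}" "\<And>j. finite (C j)"
     "\<And>j a. a \<in> A \<Longrightarrow> F a i = j \<Longrightarrow> \<exists>b\<in>C j. \<forall>i\<in>I. F b i \<le> F a i"
    by simp_all
  show ?case
  proof (intro exI[of _ "B0 \<union> (\<Union>j<N. C j)"] conjI ballI)
    show "B0 \<union> (\<Union>j<N. C j) \<subseteq> A" using B0(1) C(1) by blast
    show "finite (B0 \<union> (\<Union>j<N. C j))" using B0 C by auto
    fix a assume a: "a \<in> A"
    show "\<exists>b\<in>B0 \<union> (\<Union>j<N. C j). \<forall>i\<in>insert i I. F b i \<le> F a i"
    proof (cases "F a i < N")
      case True
      have "\<exists>b\<in>C (F a i). \<forall>i\<in>I. F b i \<le> F a i" using C(3)[OF a refl] .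
      then obtain b where b: "b \<in> C (F a i)" "\<forall>i\<in>I. F b i \<le> F a i" by blast
      moreover have "F b i = F a i" using C(1) b(1) by blast
      ultimately show ?thesis using True by (intro bexI[of _ b]) auto
    next
      case False
      obtain b where b: "b \<in> B0" "\<forall>i\<in>I. F b i \<le> F a i" using B0(3) a by blast
      with N[OF b(1)] False show ?thesis by (intro bexI[of _ b]) auto
    qed
  qed
qed

text \<open>The difference of \<open>x ^ (k + 1)\<close> is \<open>(k + 1) * x ^ k\<close> plus
  lower powers. By induction the lower powers have antidifferences, which are subtracted before
  dividing by \<open>k + 1\<close>.\<close>

lemma ex_poly_antidifference_power:
  "\<exists>q :: real poly. \<forall>x. poly q (x + 1) - poly q x = x ^ k"
proof (induction k rule: less_induct)
  case (less k)
  then have "\<forall>i. \<exists>q :: real poly. i < k \<longrightarrow> (\<forall>x. poly q (x + 1) - poly q x = x ^ i)"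
    by blast
  from choice[OF this] obtain Q :: "nat \<Rightarrow> real poly"
    where Q: "\<And>i x. i < k \<Longrightarrow> poly (Q i) (x + 1) - poly (Q i) x = x ^ i"
    by blast
  define q where "q = smult (1 / real (k + 1))
      (monom 1 (k + 1) - (\<Sum>i<k. smult (real (Suc k choose i)) (Q i)))"
  have "poly q (x + 1) - poly q x = x ^ k" for x
  proof -
    have "(x + 1) ^ (k + 1) = (\<Sum>i\<le>Suc k. real (Suc k choose i) * x ^ i)"
      using binomial_ring[of x 1 "k + 1"] by simp
    also have "\<dots> = (\<Sum>i<k. real (Suc k choose i) * x ^ i) + real (k + 1) * x ^ k + x ^ (k + 1)"
      by (simp add: lessThan_Suc_atMost[symmetric])
    finally have 1: "(x + 1) ^ (k + 1) - x ^ (k + 1) - (\<Sum>i<k. real (Suc k choose i) * x ^ i)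
        = real (k + 1) * x ^ k" by simp
    have "(\<Sum>i<k. real (Suc k choose i) * poly (Q i) (x + 1))
       - (\<Sum>i<k. real (Suc k choose i) * poly (Q i) x) = (\<Sum>i<k. real (Suc k choose i) * x ^ i)"
      by (simp add: sum_subtractf[symmetric] right_diff_distrib[symmetric] Q)
    moreover have q: "real (k + 1) * poly q y = y ^ (k + 1) - (\<Sum>i<k. real (Suc k choose i) * poly (Q i) y)" for y
      unfolding q_def by (simp add: poly_monom poly_sum del: of_nat_Suc power_Suc binomial_Suc_Suc)
    ultimately have "real (k + 1) * (poly q (x + 1) - poly q x) = real (k + 1) * x ^ k"
      unfolding 1[symmetric] right_diff_distrib q by linarith
    then show ?thesis by (simp del: of_nat_Suc)
  qed
  then show ?case by blast
qed

lemma ex_poly_antidifference: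
  fixes p :: "real poly"
  shows "\<exists>q. \<forall>x. poly q (x + 1) - poly q x = poly p x"
proof -
  obtain Q :: "nat \<Rightarrow> real poly" where Q: "\<And>k x. poly (Q k) (x + 1) - poly (Q k) x = x ^ k"
    using ex_poly_antidifference_power by metis
  have "poly (\<Sum>i\<le>degree p. smult (coeff p i) (Q i)) (x + 1)
      - poly (\<Sum>i\<le>degree p. smult (coeff p i) (Q i)) x = poly p x" for x
    unfolding poly_altdef[of p x]
    by (simp add: poly_sum sum_subtractf[symmetric] right_diff_distrib[symmetric] Q)
  then show ?thesis by blast
qed

definition eventually_poly :: "(nat \<Rightarrow> nat) \<Rightarrow> bool" where
  "eventually_poly f \<longleftrightarrow> (\<exists>p :: real poly. \<forall>\<^sub>F t in sequentially. real (f t) = poly p (real t))"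

lemma eventually_poly_add:
  assumes "eventually_poly f" "eventually_poly g"
  shows "eventually_poly (\<lambda>t. f t + g t)"
proof -
  obtain p q where
    p: "\<forall>\<^sub>F t in sequentially. real (f t) = poly p (real t)" and
    q: "\<forall>\<^sub>F t in sequentially. real (g t) = poly q (real t)"
    using assms unfolding eventually_poly_def by blast
  from p q have "\<forall>\<^sub>F t in sequentially. real (f t + g t) = poly (p + q) (real t)"
    by eventually_elim simp
  then show ?thesis unfolding eventually_poly_def by blast
qed

lemma eventually_poly_sum:
  assumes "finite A" "\<And>i. i \<in> A \<Longrightarrow> eventually_poly (f i)"
  shows "eventually_poly (\<lambda>t. \<Sum>i\<in>A. f i t)"
  using assms
proof (induction A rule: finite_induct)
  case empty
  show ?case unfolding eventually_poly_def by (auto intro!: exI[of _ 0])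
next
  case (insert x F)
  then show ?case by (simp add: eventually_poly_add)
qed

lemma eventually_poly_shift:
  assumes "eventually_poly f"
  shows "eventually_poly (\<lambda>t. f (t - j))"
proof -
  obtain p where p: "\<forall>\<^sub>F t in sequentially. real (f t) = poly p (real t)"
    using assms unfolding eventually_poly_def by blast
  then obtain T where T: "\<And>t. t \<ge> T \<Longrightarrow> real (f t) = poly p (real t)"
    unfolding eventually_sequentially by blast
  have "real (f (t - j)) = poly (pcompose p [:- real j, 1:]) (real t)" if "t \<ge> T + j" for t
    using T[of "t - j"] that by (simp add: poly_pcompose of_nat_diff)
  then show ?thesis unfolding eventually_poly_def eventually_sequentially by blast
qed

lemma eventually_poly_prefix_sum:
  assumes "eventually_poly f"
  shows "eventually_poly (\<lambda>t. \<Sum>i\<le>t. f i)"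
proof -
  obtain p where p: "\<forall>\<^sub>F t in sequentially. real (f t) = poly p (real t)"
    using assms unfolding eventually_poly_def by blast
  then obtain T where T: "\<And>t. t \<ge> T \<Longrightarrow> real (f t) = poly p (real t)"
    unfolding eventually_sequentially by blast
  obtain q where q: "\<And>x. poly q (x + 1) - poly q x = poly p x"
    using ex_poly_antidifference by blast
  \<comment> \<open>The sum includes the term at \<open>t\<close>, so it telescopes to
    \<open>q\<close> at \<open>t + 1\<close>. The constant matches both sides at \<open>T\<close>,
    beyond which their increments agree.\<close>
  define c where "c = real (\<Sum>i\<le>T. f i) - poly q (real T + 1)"
  have "real (\<Sum>i\<le>t. f i) = poly q (real t + 1) + c" if "t \<ge> T" for t
    using that
  proof (induction t rule: dec_induct)
    case base
    show ?case unfolding c_def by simp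
  next
    case (step t)
    have "real (f (Suc t)) = poly p (real t + 1)" using T[of "Suc t"] step by (simp add: add.commute)
    with step q[of "real t + 1"] show ?case by (simp add: algebra_simps)
  qed
  then have "real (\<Sum>i\<le>t. f i) = poly (pcompose q [:1, 1:] + [:c:]) (real t)" if "t \<ge> T" for t
    using that by (simp add: poly_pcompose add.commute)
  then show ?thesis unfolding eventually_poly_def eventually_sequentially by blast
qed

section \<open>Counting down-closed families of multisets\<close>

definition multisets_of_size :: "'a set \<Rightarrow> nat \<Rightarrow> 'a multiset set" where
  "multisets_of_size I t = {M. set_mset M \<subseteq> I \<and> size M = t}"

lemma finite_multisets_of_size:
  assumes "finite I"
  shows "finite (multisets_of_size I t)"
proof -
  have "multisets_of_size I t \<subseteq> mset ` {xs. set xs \<subseteq> I \<and> length xs = t}"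
    unfolding multisets_of_size_def by (auto simp: image_iff) (metis ex_mset set_mset_mset size_mset)
  moreover have "finite {xs. set xs \<subseteq> I \<and> length xs = t}"
    using finite_lists_length_eq[OF assms] by blast
  ultimately show ?thesis by (meson finite_imageI finite_subset)
qed

text \<open>A multiset over \<open>insert x I\<close> amounts to the multiplicity \<open>j\<close>
  of \<open>x\<close> together with its part over \<open>I\<close>.\<close>

lemma multisets_of_size_insert_count:
  assumes "finite I" "x \<notin> I"
  shows "card {M \<in> multisets_of_size (insert x I) t. P M}
       = (\<Sum>j\<le>t. card {M \<in> multisets_of_size I (t - j). P (M + replicate_mset j x)})"
proof -
  define A where "A j = {M \<in> multisets_of_size I (t - j). P (M + replicate_mset j x)}" for j
  have "bij_betw (\<lambda>(j, M). M + replicate_mset j x) (SIGMA j:{..t}. A j)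
      {M \<in> multisets_of_size (insert x I) t. P M}"
  proof (rule bij_betw_byWitness[where f' = "\<lambda>M. (count M x, filter_mset (\<lambda>y. y \<noteq> x) M)"])
    show "\<forall>a\<in>SIGMA j:{..t}. A j.
       (count (case a of (j, M) \<Rightarrow> M + replicate_mset j x) x,
        filter_mset (\<lambda>y. y \<noteq> x) (case a of (j, M) \<Rightarrow> M + replicate_mset j x)) = a"
    proof safe
      fix j M assume "M \<in> A j"
      then have "x \<notin># M" using assms unfolding A_def multisets_of_size_def by auto
      then have "count M x = 0" by (simp add: not_in_iff)
      then show "count (M + replicate_mset j x) x = j" "filter_mset (\<lambda>y. y \<noteq> x) (M + replicate_mset j x) = M"
        using \<open>x \<notin># M\<close> by (auto simp: filter_mset_eq_conv intro!: multiset_eqI)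
    qed
    have *: "filter_mset (\<lambda>y. y \<noteq> x) M + replicate_mset (count M x) x = M" for M
      by (rule multiset_eqI) auto
    then show "\<forall>a'\<in>{M \<in> multisets_of_size (insert x I) t. P M}.
       (case (count a' x, filter_mset (\<lambda>y. y \<noteq> x) a') of (j, M) \<Rightarrow> M + replicate_mset j x) = a'"
      by simp
    show "(\<lambda>(j, M). M + replicate_mset j x) ` (SIGMA j:{..t}. A j) \<subseteq> {M \<in> multisets_of_size (insert x I) t. P M}"
      unfolding A_def multisets_of_size_def by (auto split: if_splits)
    show "(\<lambda>M. (count M x, filter_mset (\<lambda>y. y \<noteq> x) M)) ` {M \<in> multisets_of_size (insert x I) t. P M}
        \<subseteq> (SIGMA j:{..t}. A j)"
    proof safe
      fix M assume M: "M \<in> multisets_of_size (insert x I) t" "P M"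
      have "size (filter_mset (\<lambda>y. y \<noteq> x) M) + count M x = size M"
        by (subst (3) *[symmetric]) (simp del: *)
      moreover have "size M = t" using M(1) unfolding multisets_of_size_def by blast
      ultimately have "size (filter_mset (\<lambda>y. y \<noteq> x) M) = t - count M x" "count M x \<le> t"
        by linarith+
      moreover have "set_mset (filter_mset (\<lambda>y. y \<noteq> x) M) \<subseteq> I"
        using M(1) unfolding multisets_of_size_def by auto
      moreover have "P (filter_mset (\<lambda>y. y \<noteq> x) M + replicate_mset (count M x) x)"
        unfolding * by (rule M(2))
      ultimately show "count M x \<le> t" "filter_mset (\<lambda>y. y \<noteq> x) M \<in> A (count M x)"
        unfolding A_def multisets_of_size_def by simp_all
    qed
  qed
  from bij_betw_same_card[OF this]
  have "card {M \<in> multisets_of_size (insert x I) t. P M} = card (SIGMA j:{..t}. A j)" ..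
  also have "\<dots> = (\<Sum>j\<le>t. card (A j))"
    by (rule card_SigmaI) (auto simp: A_def finite_multisets_of_size[OF assms(1)])
  finally show ?thesis unfolding A_def .
qed

text \<open>This is the Hilbert polynomial of a quotient by a monomial ideal in combinatorial form.
  For each multiplicity \<open>j\<close> of \<open>x\<close> the remaining parts form a down-closed
  family over \<open>I\<close>, and by Dickson's lemma this family is the same for all
  \<open>j\<close> from some \<open>J\<close> on. The count is then a finite sum of shifted counts
  over \<open>I\<close> plus a prefix sum of one such count.\<close>

lemma eventually_poly_card_downset:
  assumes "finite I" "\<And>M N. M \<subseteq># N \<Longrightarrow> P N \<Longrightarrow> P M"
  shows "eventually_poly (\<lambda>t. card {M \<in> multisets_of_size I t. P M})"
  using assms
proof (induction I arbitrary: P rule: finite_induct)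
  case empty
  have "real (card {M \<in> multisets_of_size {} t. P M}) = poly 0 (real t)" if "t \<ge> 1" for t :: nat
    using that by (auto simp: multisets_of_size_def intro!: arg_cong[where f = card, of _ "{}", simplified])
  then show ?case unfolding eventually_poly_def eventually_sequentially by blast
next
  case (insert x I)
  define U where "U = {M. set_mset M \<subseteq> insert x I \<and> \<not> P M}"
  obtain B where B: "B \<subseteq> U" "finite B"
    "\<forall>M\<in>U. \<exists>N\<in>B. \<forall>i\<in>insert x I. count N i \<le> count M i"
    using finite_antitone_basis[of "insert x I" U count] insert.hyps(1) by auto
  \<comment> \<open>Every forbidden multiset lies above a member of \<open>B\<close>, and no member
    of \<open>B\<close> has more than \<open>J\<close> copies of \<open>x\<close>; hence further
    copies of \<open>x\<close> cannot turn an allowed multiset into a forbidden one.\<close>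
  define J where "J = Max (insert 0 ((\<lambda>b. count b x) ` B))"
  have J: "count b x \<le> J" if "b \<in> B" for b
    unfolding J_def using that B(2) by (intro Max_ge) auto
  define h where "h j s = card {M \<in> multisets_of_size I s. P (M + replicate_mset j x)}" for j s
  have hpoly: "eventually_poly (h j)" for j
    unfolding h_def by (rule insert.IH) (meson insert.prems mset_subset_eq_mono_add_right_cancel)
  have stab: "P (M + replicate_mset j x) \<longleftrightarrow> P (M + replicate_mset J x)"
    if "set_mset M \<subseteq> I" "j \<ge> J" for M j
  proof
    have "M + replicate_mset J x \<subseteq># M + replicate_mset j x"
      using that(2) by (auto simp: subseteq_mset_def)
    then show "P (M + replicate_mset j x) \<Longrightarrow> P (M + replicate_mset J x)"
      using insert.prems by blast
    show "P (M + replicate_mset J x) \<Longrightarrow> P (M + replicate_mset j x)"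
    proof (rule ccontr)
      assume P: "P (M + replicate_mset J x)" and nP: "\<not> P (M + replicate_mset j x)"
      then have "M + replicate_mset j x \<in> U" unfolding U_def using that by (auto split: if_splits)
      then obtain N where N: "N \<in> B" "\<forall>i\<in>insert x I. count N i \<le> count (M + replicate_mset j x) i"
        using B(3) by blast
      have "count N i \<le> count (M + replicate_mset J x) i" for i
      proof (cases "i \<in> insert x I")
        case True
        then show ?thesis using N(2) J[OF N(1)] by (cases "i = x") (auto intro: trans_le_add2)
      next
        case False
        then have "i \<notin># N" using N(1) B(1) U_def by auto
        then show ?thesis by (simp add: not_in_iff)
      qed
      then have "N \<subseteq># M + replicate_mset J x" by (simp add: subseteq_mset_def)
      then have "P N" using P insert.prems by blast
      then show False using N(1) B(1) U_def by auto
    qed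
  qed
  have hstab: "h j s = h J s" if "j \<ge> J" for j s
  proof -
    have "{M \<in> multisets_of_size I s. P (M + replicate_mset j x)}
       = {M \<in> multisets_of_size I s. P (M + replicate_mset J x)}"
      using stab that unfolding multisets_of_size_def by auto
    then show ?thesis unfolding h_def by simp
  qed
  have eq: "card {M \<in> multisets_of_size (insert x I) t. P M}
      = (\<Sum>j<J. h j (t - j)) + (\<Sum>i\<le>t - J. h J i)" if "t \<ge> J" for t
  proof -
    have "card {M \<in> multisets_of_size (insert x I) t. P M} = (\<Sum>j\<le>t. h j (t - j))"
      unfolding h_def using multisets_of_size_insert_count[OF insert.hyps] .
    also have "{..t} = {..<J} \<union> {J..t}" using that by auto
    also have "(\<Sum>j\<in>{..<J} \<union> {J..t}. h j (t - j)) = (\<Sum>j<J. h j (t - j)) + (\<Sum>j\<in>{J..t}. h J (t - j))"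
      by (subst sum.union_disjoint) (auto intro!: sum.cong hstab)
    also have "(\<Sum>j\<in>{J..t}. h J (t - j)) = (\<Sum>i\<le>t - J. h J i)"
      by (rule sum.reindex_bij_witness[of _ "\<lambda>i. t - i" "\<lambda>j. t - j"]) (use that in auto)
    finally show ?thesis .
  qed
  have "eventually_poly (\<lambda>t. (\<Sum>j<J. h j (t - j)) + (\<Sum>i\<le>t - J. h J i))"
    by (intro eventually_poly_add eventually_poly_sum eventually_poly_shift[OF hpoly]
        eventually_poly_shift[OF eventually_poly_prefix_sum[OF hpoly]]) auto
  then obtain p where p: "\<forall>\<^sub>F t in sequentially.
     real ((\<Sum>j<J. h j (t - j)) + (\<Sum>i\<le>t - J. h J i)) = poly p (real t)"
    unfolding eventually_poly_def by blast
  have "\<forall>\<^sub>F t in sequentially. real (card {M \<in> multisets_of_size (insert x I) t. P M}) = poly p (real t)"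
    using p eventually_ge_at_top[of J] by eventually_elim (simp add: eq)
  then show ?case unfolding eventually_poly_def by blast
qed

section \<open>Sumsets and their Hilbert functions\<close>

definition nfold_sums :: "('i \<Rightarrow> 'm::comm_monoid_add) \<Rightarrow> 'i set \<Rightarrow> nat \<Rightarrow> 'm set" where
  "nfold_sums g I t = (\<lambda>M. \<Sum>i\<in>#M. g i) ` multisets_of_size I t"

lemma nfold_sumsI:
  "set_mset M \<subseteq> I \<Longrightarrow> size M = t \<Longrightarrow> a = (\<Sum>i\<in>#M. g i) \<Longrightarrow> a \<in> nfold_sums g I t"
  unfolding nfold_sums_def multisets_of_size_def by blast

lemma nfold_sumsE:
  assumes "a \<in> nfold_sums g I t"
  obtains M where "set_mset M \<subseteq> I" "size M = t" "a = (\<Sum>i\<in>#M. g i)"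
  using assms unfolding nfold_sums_def multisets_of_size_def by blast

lemma finite_nfold_sums: "finite I \<Longrightarrow> finite (nfold_sums g I t)"
  unfolding nfold_sums_def by (simp add: finite_multisets_of_size)

text \<open>Sums are counted by their least representing multisets; those which are not least
  form an up-closed family because the multiset order is compatible with addition.\<close>

lemma eventually_poly_card_nfold_sums_linorder:
  fixes g :: "'i::linorder \<Rightarrow> 'm::comm_monoid_add"
  assumes "finite I"
  shows "eventually_poly (\<lambda>t. card (nfold_sums g I t))"
proof -
  define s where "s M = (\<Sum>i\<in>#M. g i)" for M
  define P where "P M \<longleftrightarrow> \<not> (\<exists>M'\<in>multisets_of_size I (size M). s M' = s M \<and> M' < M)" for M
  have down: "P M" if sub: "M \<subseteq># N" and that: "P N" "set_mset N \<subseteq> I" for M N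
  proof (rule ccontr)
    assume "\<not> P M"
    then obtain M' where M': "M' \<in> multisets_of_size I (size M)" "s M' = s M" "M' < M"
      unfolding P_def by blast
    obtain K where K: "N = M + K" using sub unfolding mset_subset_eq_exists_conv by blast
    have "M' + K \<in> multisets_of_size I (size N)" "s (M' + K) = s N" "M' + K < N"
      using M' that(2) unfolding K multisets_of_size_def s_def by auto
    with that(1) show False unfolding P_def by blast
  qed
  \<comment> \<open>Replacing a submultiset by a smaller one stays among the competitors only if the
    rest lies over \<open>I\<close>. The condition on the support makes the predicate closed under
    all submultisets, as the counting lemma demands.\<close>
  define Q where "Q M \<longleftrightarrow> set_mset M \<subseteq> I \<and> P M" for M
  have Qdown: "Q M" if "M \<subseteq># N" "Q N" for M N
    using that down[of M N] set_mset_mono[OF that(1)] unfolding Q_def by auto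
  have "card (nfold_sums g I t) = card {M \<in> multisets_of_size I t. Q M}" for t
  proof -
    let ?R = "{M \<in> multisets_of_size I t. Q M}"
    have "inj_on s ?R"
    proof (rule inj_onI)
      fix M N assume MN: "M \<in> ?R" "N \<in> ?R" "s M = s N"
      then have "\<not> M < N" "\<not> N < M"
        unfolding Q_def P_def multisets_of_size_def by auto
      then show "M = N" by simp
    qed
    moreover have "s ` ?R = nfold_sums g I t"
    proof
      show "s ` ?R \<subseteq> nfold_sums g I t" unfolding nfold_sums_def s_def by blast
      show "nfold_sums g I t \<subseteq> s ` ?R"
      proof
        fix a assume "a \<in> nfold_sums g I t"
        then obtain M where M: "M \<in> multisets_of_size I t" "a = s M" unfolding nfold_sums_def s_def by blast
        define L where "L = {M \<in> multisets_of_size I t. s M = a}"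
        have L: "finite L" "L \<noteq> {}"
          unfolding L_def using M finite_multisets_of_size[OF assms] by auto
        then have "Min L \<in> L" by simp
        then have "Min L \<in> multisets_of_size I t" "s (Min L) = a" unfolding L_def by auto
        moreover have "Q (Min L)" unfolding Q_def P_def
        proof (intro conjI notI)
          show "set_mset (Min L) \<subseteq> I" using calculation unfolding multisets_of_size_def by auto
          assume "\<exists>M'\<in>multisets_of_size I (size (Min L)). s M' = s (Min L) \<and> M' < Min L"
          then obtain M' where "M' \<in> multisets_of_size I (size (Min L))" "s M' = s (Min L)" "M' < Min L"
            by blast
          with calculation have "M' \<in> L" "M' < Min L" unfolding L_def multisets_of_size_def by auto
          with L show False by (metis Min_le leD)
        qed
        ultimately show "a \<in> s ` ?R" by blast
      qed
    qed
    ultimately show ?thesis by (metis card_image)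
  qed
  then show ?thesis using eventually_poly_card_downset[OF assms Qdown] by simp
qed

text \<open>Lets an arbitrary finite index set be replaced by an initial segment of the natural
  numbers, whose linear order is what the choice of least representatives needs.\<close>

lemma nfold_sums_reindex:
  "nfold_sums (g \<circ> f) I t = nfold_sums g (f ` I) t"
proof
  show "nfold_sums (g \<circ> f) I t \<subseteq> nfold_sums g (f ` I) t"
  proof
    fix a assume "a \<in> nfold_sums (g \<circ> f) I t"
    then obtain M where "set_mset M \<subseteq> I" "size M = t" "a = (\<Sum>i\<in>#M. (g \<circ> f) i)"
      by (rule nfold_sumsE)
    then show "a \<in> nfold_sums g (f ` I) t"
      by (intro nfold_sumsI[of "image_mset f M"]) (auto simp: multiset.map_comp o_def)
  qed
  show "nfold_sums g (f ` I) t \<subseteq> nfold_sums (g \<circ> f) I t"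
  proof
    fix a assume "a \<in> nfold_sums g (f ` I) t"
    then obtain M where M: "set_mset M \<subseteq> f ` I" "size M = t" "a = (\<Sum>i\<in>#M. g i)"
      by (rule nfold_sumsE)
    define M' where "M' = image_mset (inv_into I f) M"
    have "image_mset f M' = M" unfolding M'_def multiset.map_comp
      using M(1)
      by (intro multiset.map_ident_strong) (auto simp: f_inv_into_f subset_iff)
    moreover have "set_mset M' \<subseteq> I" "size M' = t"
      using M(1,2) unfolding M'_def by (auto simp: inv_into_into)
    ultimately show "a \<in> nfold_sums (g \<circ> f) I t"
      using M(3) by (intro nfold_sumsI[of M']) (auto simp: multiset.map_comp o_def)
  qed
qed

lemma eventually_poly_card_nfold_sums:
  fixes g :: "'i \<Rightarrow> 'm::comm_monoid_add"
  assumes "finite I"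
  shows "eventually_poly (\<lambda>t. card (nfold_sums g I t))"
proof -
  obtain f :: "nat \<Rightarrow> 'i" and n where f: "I = f ` {..<n}"
    using finite_imp_nat_seg_image_inj_on[OF assms] by (metis lessThan_def)
  show ?thesis
    unfolding f using eventually_poly_card_nfold_sums_linorder[of "{..<n}" "g \<circ> f"]
    by (simp add: nfold_sums_reindex)
qed

lemma nfold_sums_add:
  "a \<in> nfold_sums g I s \<Longrightarrow> b \<in> nfold_sums g I t \<Longrightarrow> a + b \<in> nfold_sums g I (s + t)"
proof (elim nfold_sumsE)
  fix M N
  assume "set_mset M \<subseteq> I" "size M = s" "a = (\<Sum>i\<in>#M. g i)"
    and "set_mset N \<subseteq> I" "size N = t" "b = (\<Sum>i\<in>#N. g i)"
  then show "a + b \<in> nfold_sums g I (s + t)"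
    by (intro nfold_sumsI[of "M + N"]) auto
qed

subsection \<open>Exponent vectors\<close>

abbreviation "lookup \<equiv> Poly_Mapping.lookup"
abbreviation "keys \<equiv> Poly_Mapping.keys"
abbreviation "single \<equiv> Poly_Mapping.single"

definition exponents :: "'v set \<Rightarrow> ('v \<Rightarrow>\<^sub>0 nat) set" where
  "exponents V = {a. keys a \<subseteq> V}"

definition total_degree :: "'v set \<Rightarrow> ('v \<Rightarrow>\<^sub>0 nat) \<Rightarrow> nat" where
  "total_degree V a = (\<Sum>v\<in>V. lookup a v)"

lemma keys_plus_nat: "keys (a + b) = keys a \<union> keys b"
  for a b :: "'v \<Rightarrow>\<^sub>0 nat"
  by (auto simp: in_keys_iff lookup_add)

lemma zero_in_exponents [simp]: "0 \<in> exponents V"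
  unfolding exponents_def by simp

lemma lookup_outside: "a \<in> exponents V \<Longrightarrow> v \<notin> V \<Longrightarrow> lookup a v = 0"
  unfolding exponents_def by (metis in_keys_iff mem_Collect_eq subsetD)

lemma add_in_exponents_iff [simp]: "a + b \<in> exponents V \<longleftrightarrow> a \<in> exponents V \<and> b \<in> exponents V"
  unfolding exponents_def by (auto simp: keys_plus_nat)

lemma single_in_exponents [simp]: "v \<in> V \<Longrightarrow> single v n \<in> exponents V"
  unfolding exponents_def by auto

lemma total_degree_add [simp]: "total_degree V (a + b) = total_degree V a + total_degree V b"
  unfolding total_degree_def by (simp add: lookup_add sum.distrib)

lemma total_degree_0 [simp]: "total_degree V 0 = 0"
  unfolding total_degree_def by simp

lemma total_degree_single: "finite V \<Longrightarrow> total_degree V (single v n) = (if v \<in> V then n else 0)"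
  unfolding total_degree_def by (simp add: lookup_single when_def)

lemma total_degree_eq_0_iff:
  assumes "finite V" "a \<in> exponents V"
  shows "total_degree V a = 0 \<longleftrightarrow> a = 0"
proof
  assume "total_degree V a = 0"
  then have "\<forall>v\<in>V. lookup a v = 0" unfolding total_degree_def using assms(1) by simp
  then show "a = 0" using assms(2) unfolding exponents_def
    by (intro poly_mapping_eqI) (metis in_keys_iff lookup_zero mem_Collect_eq subsetD)
qed simp

lemma lookup_le_total_degree:
  assumes "finite V" "a \<in> exponents V"
  shows "lookup a v \<le> total_degree V a"
proof (cases "v \<in> V")
  case True
  then show ?thesis unfolding total_degree_def using assms(1) by (intro member_le_sum) auto
next
  case False
  then have "lookup a v = 0" using assms(2) unfolding exponents_def
    by (metis in_keys_iff mem_Collect_eq subsetD)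
  then show ?thesis by simp
qed

lemma exponents_split_single:
  assumes "finite V" "a \<in> exponents V" "total_degree V a > 0"
  obtains v b where "v \<in> V" "b \<in> exponents V" "a = b + single v 1"
    "total_degree V a = total_degree V b + 1"
proof -
  obtain v where v: "v \<in> V" "lookup a v \<noteq> 0"
    using assms(3) unfolding total_degree_def by (metis less_irrefl sum.neutral)
  define b where "b = a - single v 1"
  have "a = b + single v 1"
    unfolding b_def using v(2) by (intro poly_mapping_eqI) (auto simp: lookup_add lookup_minus lookup_single when_def)
  then show ?thesis using that[of v b] v(1) assms(1,2)
    by (metis add_in_exponents_iff total_degree_add total_degree_single)
qed

lemma exponents_split_degree:
  assumes "finite V" "a \<in> exponents V" "k \<le> total_degree V a"
  obtains b c where "b \<in> exponents V" "c \<in> exponents V" "a = b + c" "total_degree V b = k"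
  using assms
proof (induction "total_degree V a - k" arbitrary: a thesis)
  case 0
  then show ?case by (intro "0.prems"(1)[of a 0]) auto
next
  case (Suc n)
  then obtain v b where b: "v \<in> V" "b \<in> exponents V" "a = b + single v 1"
      "total_degree V a = total_degree V b + 1"
    using exponents_split_single[of V a] by (metis Suc.prems(2,3) diff_0_eq_0 gr0I nat.distinct(2))
  have 1: "n = total_degree V b - k" "k \<le> total_degree V b" using Suc.hyps(2) b(4) by linarith+
  obtain b' c where "b' \<in> exponents V" "c \<in> exponents V" "b = b' + c" "total_degree V b' = k"
    using Suc.hyps(1)[OF 1(1) _ assms(1) b(2) 1(2)] by blast
  then show ?case
    using b Suc.prems(1)[of b' "c + single v 1"] by (simp add: add.assoc)
qed

text \<open>The coordinates in \<open>W\<close> have to determine the elements of \<open>A\<close>,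
  but \<open>W\<close> may omit coordinates of the support. Each linear relation valid on
  \<open>A\<close> thus saves one coordinate and lowers the order of growth by one.\<close>

lemma card_bounded_exponents:
  assumes "finite W" "\<And>a v. a \<in> A \<Longrightarrow> v \<in> W \<Longrightarrow> lookup a v \<le> B"
    and "\<And>a b. a \<in> A \<Longrightarrow> b \<in> A \<Longrightarrow> \<forall>v\<in>W. lookup a v = lookup b v \<Longrightarrow> a = b"
  shows "finite A" "card A \<le> (B + 1) ^ card W"
proof -
  define r where "r a = restrict (lookup a) W" for a :: "'a \<Rightarrow>\<^sub>0 nat"
  have inj: "inj_on r A"
    unfolding r_def by (intro inj_onI assms(3)) (auto, metis restrict_apply')
  have sub: "r ` A \<subseteq> W \<rightarrow>\<^sub>E {..B}" unfolding r_def using assms(2) by auto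
  have fin: "finite (W \<rightarrow>\<^sub>E {..B})" using assms(1) by (intro finite_PiE) auto
  show "finite A" using finite_subset[OF sub fin] inj by (rule finite_imageD)
  have "card A = card (r ` A)" using inj by (simp add: card_image)
  also have "\<dots> \<le> card (W \<rightarrow>\<^sub>E {..B})" using fin sub by (rule card_mono)
  also have "\<dots> = (B + 1) ^ card W" using assms(1) by (simp add: card_PiE)
  finally show "card A \<le> (B + 1) ^ card W" .
qed

lemma exponents_eqI:
  assumes "a \<in> exponents V" "b \<in> exponents V" "\<And>v. v \<in> V \<Longrightarrow> lookup a v = lookup b v"
  shows "a = b"
proof (rule poly_mapping_eqI)
  fix v show "lookup a v = lookup b v"
    using assms by (cases "v \<in> V") (simp_all add: lookup_outside)
qed

lemma
  assumes "finite V"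
  shows finite_exponents_degree_le: "finite {a \<in> exponents V. total_degree V a \<le> t}"
    and card_exponents_degree_le: "card {a \<in> exponents V. total_degree V a \<le> t} \<le> (t + 1) ^ card V"
proof -
  have *: "lookup a v \<le> t" if "a \<in> {a \<in> exponents V. total_degree V a \<le> t}" for a v
    using that lookup_le_total_degree[OF assms, of a v] by simp
  show "finite {a \<in> exponents V. total_degree V a \<le> t}"
    "card {a \<in> exponents V. total_degree V a \<le> t} \<le> (t + 1) ^ card V"
    using card_bounded_exponents[OF assms, of "{a \<in> exponents V. total_degree V a \<le> t}" t] * exponents_eqI
    by blast+
qed

subsection \<open>The semigroup of an edge ideal\<close>

definition edge_exponent :: "'v set \<Rightarrow> 'v \<Rightarrow>\<^sub>0 nat" where
  "edge_exponent e = (\<Sum>v\<in>e. single v 1)"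

definition sumset :: "'v set set \<Rightarrow> nat \<Rightarrow> ('v \<Rightarrow>\<^sub>0 nat) set" where
  "sumset E t = nfold_sums edge_exponent E t"

text \<open>The exponents of the monomials in the \<open>t\<close>-th power of the edge ideal.\<close>

definition power_exponents :: "'v set \<Rightarrow> 'v set set \<Rightarrow> nat \<Rightarrow> ('v \<Rightarrow>\<^sub>0 nat) set" where
  "power_exponents V E t = {s + c | s c. s \<in> sumset E t \<and> c \<in> exponents V}"

text \<open>These are the exponents of the preimage in \<open>I^t\<close> of the zeroth local
  cohomology of \<open>I^t / I^(t+1)\<close>. For edges contained in \<open>V\<close> they include
  all exponents of \<open>I^(t+1)\<close>, which is why \<open>torsion_count\<close> takes a
  difference.\<close>

definition torsion_exponents :: "'v set \<Rightarrow> 'v set set \<Rightarrow> nat \<Rightarrow> ('v \<Rightarrow>\<^sub>0 nat) set" where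
  "torsion_exponents V E t = {a \<in> power_exponents V E t.
     \<exists>k. \<forall>b\<in>exponents V. k \<le> total_degree V b \<longrightarrow> a + b \<in> power_exponents V E (t + 1)}"

definition torsion_count :: "'v set \<Rightarrow> 'v set set \<Rightarrow> nat \<Rightarrow> nat" where
  "torsion_count V E t = card (torsion_exponents V E t - power_exponents V E (t + 1))"

lemma lookup_edge_exponent:
  "finite e \<Longrightarrow> lookup (edge_exponent e) v = (if v \<in> e then 1 else 0)"
  unfolding edge_exponent_def by (simp add: lookup_sum lookup_single when_def)

lemma zero_in_sumset: "0 \<in> sumset E 0"
  unfolding sumset_def by (rule nfold_sumsI[of "{#}"]) auto

lemma edge_exponent_in_exponents:
  assumes "finite V" "e \<subseteq> V"
  shows "edge_exponent e \<in> exponents V"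
proof -
  have "finite e" using assms finite_subset by blast
  have "keys (edge_exponent e) \<subseteq> e"
  proof
    fix v assume "v \<in> keys (edge_exponent e)"
    then show "v \<in> e" unfolding in_keys_iff lookup_edge_exponent[OF \<open>finite e\<close>] by argo
  qed
  with assms(2) show ?thesis unfolding exponents_def by blast
qed

lemma sumset_0: "sumset E 0 = {0}"
  unfolding sumset_def by (auto elim!: nfold_sumsE intro: nfold_sumsI[of "{#}"])

lemma sumset_add: "a \<in> sumset E s \<Longrightarrow> b \<in> sumset E t \<Longrightarrow> a + b \<in> sumset E (s + t)"
  unfolding sumset_def by (rule nfold_sums_add)

lemma edge_exponent_in_sumset: "e \<in> E \<Longrightarrow> edge_exponent e \<in> sumset E 1"
  unfolding sumset_def by (rule nfold_sumsI[of "{#e#}"]) auto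

lemma sumset_SucE:
  assumes "a \<in> sumset E (Suc t)"
  obtains b e where "b \<in> sumset E t" "e \<in> E" "a = b + edge_exponent e"
proof -
  obtain M where M: "set_mset M \<subseteq> E" "size M = Suc t" "a = (\<Sum>i\<in>#M. edge_exponent i)"
    using assms unfolding sumset_def by (rule nfold_sumsE)
  obtain e N where N: "M = add_mset e N" using M(2) by (metis size_eq_Suc_imp_eq_union)
  show ?thesis
  proof (rule that[of "\<Sum>i\<in>#N. edge_exponent i" e])
    show "(\<Sum>i\<in>#N. edge_exponent i) \<in> sumset E t"
      unfolding sumset_def using M N by (intro nfold_sumsI[of N]) auto
  qed (use M N in \<open>auto simp: add.commute\<close>)
qed

lemma power_exponentsI: "s \<in> sumset E t \<Longrightarrow> c \<in> exponents V \<Longrightarrow> s + c \<in> power_exponents V E t"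
  unfolding power_exponents_def by blast

lemma power_exponents_add_exponent:
  "a \<in> power_exponents V E t \<Longrightarrow> b \<in> exponents V \<Longrightarrow> a + b \<in> power_exponents V E t"
  unfolding power_exponents_def by (auto simp: add.assoc) (metis add_in_exponents_iff)

lemma power_exponents_add_sumset:
  assumes "a \<in> power_exponents V E t" "s \<in> sumset E u"
  shows "a + s \<in> power_exponents V E (t + u)"
proof -
  obtain s' c where *: "s' \<in> sumset E t" "c \<in> exponents V" "a = s' + c"
    using assms(1) unfolding power_exponents_def by blast
  have "(s' + s) + c \<in> power_exponents V E (t + u)"
    by (intro power_exponentsI sumset_add * assms)
  then show ?thesis using * by (simp add: ac_simps)
qed

locale edge_system =
  fixes V :: "'v set" and E :: "'v set set" and m :: nat
  assumes finite_V: "finite V" and V_ne: "V \<noteq> {}"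
    and E_sub: "E \<subseteq> Pow V" and no_isolated: "\<And>v. v \<in> V \<Longrightarrow> \<exists>e\<in>E. v \<in> e"
    and m_pos: "m \<ge> 1" and unif: "\<And>e. e \<in> E \<Longrightarrow> card e = m"
    and conn: "properly_connected m E"
begin

abbreviation "tdeg \<equiv> total_degree V"
abbreviation "\<delta> v \<equiv> single v (1::nat)"
abbreviation "S \<equiv> sumset E"
abbreviation "U \<equiv> power_exponents V E"
abbreviation "n \<equiv> card V"

lemma finite_E: "finite E" using E_sub finite_V by (simp add: finite_subset)

lemma E_ne: "E \<noteq> {}" using V_ne no_isolated by blast

lemma finite_edge: "e \<in> E \<Longrightarrow> finite e" using E_sub finite_V by (meson PowD finite_subset subsetD)

lemma finite_S: "finite (S t)" unfolding sumset_def by (rule finite_nfold_sums[OF finite_E])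

lemma edge_in_exponents: "e \<in> E \<Longrightarrow> edge_exponent e \<in> exponents V"
  using E_sub by (intro edge_exponent_in_exponents finite_V) blast

lemma weight_edge: "e \<in> E \<Longrightarrow> C \<subseteq> V \<Longrightarrow> total_degree C (edge_exponent e) = card (e \<inter> C)"
proof -
  assume e: "e \<in> E" "C \<subseteq> V"
  have "finite C" using e(2) finite_V by (rule finite_subset)
  then have "(\<Sum>v\<in>C. if v \<in> e then 1 else 0) = card (e \<inter> C)"
    by (simp add: sum.If_cases Int_commute)
  then show ?thesis unfolding total_degree_def using finite_edge[OF e(1)] by (simp add: lookup_edge_exponent)
qed

lemma deg_edge: "e \<in> E \<Longrightarrow> tdeg (edge_exponent e) = m"
  using weight_edge[of e V] unif E_sub by (metis Int_absorb2 PowD order_refl subsetD)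

lemma S_exponents: "s \<in> S t \<Longrightarrow> s \<in> exponents V"
  by (induction t arbitrary: s) (auto simp: sumset_0 edge_in_exponents elim!: sumset_SucE)

lemma weight_S:
  assumes "C \<subseteq> V" "\<And>e. e \<in> E \<Longrightarrow> card (e \<inter> C) = c"
  shows "s \<in> S t \<Longrightarrow> total_degree C s = c * t"
  by (induction t arbitrary: s) (auto simp: sumset_0 weight_edge assms elim!: sumset_SucE)

lemma deg_S: "s \<in> S t \<Longrightarrow> tdeg s = m * t"
  by (induction t arbitrary: s) (auto simp: sumset_0 deg_edge elim!: sumset_SucE)

lemma S_ne: "S t \<noteq> {}"
proof (induction t)
  case 0 then show ?case by (simp add: sumset_0)
next
  case (Suc t)
  then show ?case using sumset_add[of _ E t _ 1] edge_exponent_in_sumset E_ne by force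
qed

lemma inj_add_card_le:
  assumes "\<And>a. a \<in> A \<Longrightarrow> a + w \<in> B" "finite B"
  shows "card A \<le> card (B :: ('v \<Rightarrow>\<^sub>0 nat) set)"
  using assms by (intro card_inj_on_le[of "\<lambda>a. a + w"]) (auto simp: inj_on_def)

lemma card_S_mono: "card (S t) \<le> card (S (t + l))"
proof -
  obtain w where "w \<in> S l" using S_ne by blast
  then show ?thesis by (intro inj_add_card_le[of _ w] finite_S sumset_add)
qed

text \<open>Dickson's lemma: elements of the torsion have a representation with bounded remainder,
  because a large remainder would put them into the next power.\<close>

lemma torsion_bounded_remainder:
  obtains q where "\<And>t a. a \<in> torsion_exponents V E t - U (t + 1) \<Longrightarrow>
      \<exists>s\<in>S t. \<exists>c\<in>exponents V. tdeg c \<le> q \<and> a = s + c"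
proof -
  define sm where "sm M = (\<Sum>e\<in>#M. edge_exponent e)" for M :: "'v set multiset"
  define bad where "bad c M k \<longleftrightarrow> (\<forall>b\<in>exponents V. k \<le> tdeg b \<longrightarrow> sm M + c + b \<in> U (size M + 1))" for c M k
  define A where "A = {(c, M). c \<in> exponents V \<and> set_mset M \<subseteq> E \<and> (\<exists>k. bad c M k)}"
  \<comment> \<open>Dickson's lemma is applied to the remainder and to the multiset of edges at
    once. The coordinates of a pair are indexed by the disjoint sum of nodes and edges.\<close>
  define F where "F p = case_sum (lookup (fst p)) (count (snd p))" for p :: "('v \<Rightarrow>\<^sub>0 nat) \<times> 'v set multiset"
  have "finite (Inl ` V \<union> Inr ` E)" using finite_V finite_E by auto
  from finite_antitone_basis[OF this, of A F] obtain B where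
    B: "B \<subseteq> A" "finite B" "\<forall>a\<in>A. \<exists>b\<in>B. \<forall>i\<in>Inl ` V \<union> Inr ` E. F b i \<le> F a i" by blast
  have "\<forall>p\<in>B. \<exists>k. bad (fst p) (snd p) k" using B(1) unfolding A_def by auto
  then obtain K where K: "\<And>p. p \<in> B \<Longrightarrow> bad (fst p) (snd p) (K p)" by metis
  \<comment> \<open>If \<open>(c, M)\<close> lies above \<open>p = (c0, M0)\<close>, then
    \<open>K p\<close> limits the degree of the excess \<open>c - c0\<close>: a larger excess would
    push the monomial of \<open>p\<close> into the next power, and the edges in
    \<open>M - M0\<close> preserve this.\<close>
  define q where "q = Max (insert 0 ((\<lambda>p. tdeg (fst p) + K p) ` B))"
  have q: "tdeg (fst p) + K p \<le> q" if "p \<in> B" for p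
    unfolding q_def using that B(2) by (intro Max_ge) auto
  show thesis
  proof (rule that[of q])
    fix t a assume a: "a \<in> torsion_exponents V E t - U (t + 1)"
    then obtain s c where sc: "s \<in> S t" "c \<in> exponents V" "a = s + c"
      unfolding torsion_exponents_def power_exponents_def by blast
    obtain M where M: "set_mset M \<subseteq> E" "size M = t" "s = sm M"
      using sc(1) unfolding sumset_def sm_def by (rule nfold_sumsE)
    have "(c, M) \<in> A" using a M sc unfolding A_def bad_def torsion_exponents_def by auto
    then obtain p where p: "p \<in> B" "\<forall>i\<in>Inl ` V \<union> Inr ` E. F p i \<le> F (c, M) i" using B(3) by blast
    obtain c0 M0 where p_eq: "p = (c0, M0)" by (cases p)
    have c0: "c0 \<in> exponents V" "set_mset M0 \<subseteq> E" using p(1) B(1) p_eq unfolding A_def by auto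
    have lc: "lookup c0 v \<le> lookup c v" for v
    proof (cases "v \<in> V")
      case True then show ?thesis using p(2) unfolding p_eq F_def by force
    next
      case False then show ?thesis using lookup_outside[OF c0(1)] by simp
    qed
    define c1 where "c1 = c - c0"
    have c1: "c = c0 + c1" unfolding c1_def using lc by (intro poly_mapping_eqI) (simp add: lookup_add lookup_minus)
    have "count M0 e \<le> count M e" for e
    proof (cases "e \<in> E")
      case True then show ?thesis using p(2) unfolding p_eq F_def by force
    next
      case False then have "e \<notin># M0" using c0(2) by blast
      then show ?thesis by (simp add: not_in_iff)
    qed
    then have "M0 \<subseteq># M" by (simp add: subseteq_mset_def)
    then obtain M1 where M1: "M = M0 + M1" unfolding mset_subset_eq_exists_conv by blast
    have c1E: "c1 \<in> exponents V" using sc(2) c1 by simp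
    have "tdeg c1 < K p"
    proof (rule ccontr)
      assume "\<not> tdeg c1 < K p"
      then have "sm M0 + c0 + c1 \<in> U (size M0 + 1)"
        using K[OF p(1)] c1E unfolding p_eq bad_def by auto
      moreover have "sm M1 \<in> S (size M1)"
        unfolding sumset_def sm_def using M(1) M1 by (intro nfold_sumsI[of M1]) auto
      ultimately have "sm M0 + c0 + c1 + sm M1 \<in> U (size M0 + 1 + size M1)"
        by (rule power_exponents_add_sumset)
      moreover have "sm M0 + c0 + c1 + sm M1 = a"
        unfolding sc(3) M(3) M1 c1 sm_def by (simp add: ac_simps)
      moreover have "size M0 + 1 + size M1 = t + 1" using M(2) M1 by simp
      ultimately show False using a by simp
    qed
    then have "tdeg c \<le> q" using q[OF p(1)] unfolding c1 p_eq by simp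
    with sc show "\<exists>s\<in>S t. \<exists>c\<in>exponents V. tdeg c \<le> q \<and> a = s + c" by blast
  qed
qed

lemma finite_torsion: "finite (torsion_exponents V E t - U (t + 1))"
proof -
  obtain q where q: "\<And>t a. a \<in> torsion_exponents V E t - U (t + 1) \<Longrightarrow>
      \<exists>s\<in>S t. \<exists>c\<in>exponents V. tdeg c \<le> q \<and> a = s + c"
    using torsion_bounded_remainder by blast
  have "torsion_exponents V E t - U (t + 1) \<subseteq> (\<lambda>(s, c). s + c) ` (S t \<times> {c \<in> exponents V. tdeg c \<le> q})"
    using q by fastforce
  moreover have "finite (S t \<times> {c \<in> exponents V. tdeg c \<le> q})"
    using finite_S finite_exponents_degree_le[OF finite_V] by blast
  ultimately show ?thesis by (meson finite_imageI finite_subset)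
qed

text \<open>The unit vectors of \<open>i\<close> and \<open>j\<close> are congruent modulo the lattice generated by the edges.\<close>

definition linked :: "'v \<Rightarrow> 'v \<Rightarrow> bool" where
  "linked i j \<longleftrightarrow> (\<exists>l. \<exists>s1\<in>S l. \<exists>s2\<in>S l. s1 + \<delta> i = s2 + \<delta> j)"

lemma linked_refl: "linked i i"
  unfolding linked_def using zero_in_sumset by blast

lemma linked_sym: "linked i j \<Longrightarrow> linked j i"
  unfolding linked_def by metis

lemma linked_trans:
  assumes "linked i j" "linked j k"
  shows "linked i k"
proof -
  obtain l s1 s2 where 1: "s1 \<in> S l" "s2 \<in> S l" "s1 + \<delta> i = s2 + \<delta> j" using assms(1) unfolding linked_def by blast
  obtain l' s3 s4 where 2: "s3 \<in> S l'" "s4 \<in> S l'" "s3 + \<delta> j = s4 + \<delta> k" using assms(2) unfolding linked_def by blast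
  have "(s1 + s3) + \<delta> i = s3 + (s1 + \<delta> i)" by (simp add: ac_simps)
  also have "\<dots> = s2 + (s3 + \<delta> j)" unfolding 1 by (simp add: ac_simps)
  also have "\<dots> = (s2 + s4) + \<delta> k" unfolding 2 by (simp add: ac_simps)
  finally have "(s1 + s3) + \<delta> i = (s2 + s4) + \<delta> k" .
  moreover have "s1 + s3 \<in> S (l + l')" "s2 + s4 \<in> S (l + l')" using 1 2 sumset_add by blast+
  ultimately show ?thesis unfolding linked_def by blast
qed

text \<open>Two edges that share all but one node differ by exchanging that node, so their vectors
  differ by a difference of two unit vectors. This is how proper connectedness reaches the
  lattice.\<close>

lemma adjacent_edges_linked:
  assumes "u \<in> E" "v \<in> E" "card (u \<inter> v) = m - 1"
  obtains i j where "u = insert i (u \<inter> v)" "v = insert j (u \<inter> v)" "i \<notin> v" "j \<notin> u" "linked i j"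
proof -
  have f: "finite u" "finite v" using assms finite_edge by auto
  have "card (u - v) = 1" "card (v - u) = 1"
    using assms f unif m_pos by (simp_all add: card_Diff_subset_Int Int_commute)
  then obtain i j where ij: "u - v = {i}" "v - u = {j}" by (metis card_1_singletonE)
  have *: "k \<in> u \<longleftrightarrow> k = i \<or> (k \<in> v \<and> k \<noteq> j)" "i \<notin> v" "j \<in> v" for k
    using ij by blast+
  have "edge_exponent v + \<delta> i = edge_exponent u + \<delta> j"
  proof (rule poly_mapping_eqI)
    fix k show "lookup (edge_exponent v + \<delta> i) k = lookup (edge_exponent u + \<delta> j) k"
      using f * by (cases "k = i"; cases "k = j") (simp_all add: lookup_add lookup_edge_exponent lookup_single)
  qed
  then have "linked i j" unfolding linked_def using assms edge_exponent_in_sumset by blast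
  then show ?thesis using ij by (intro that[of i j]) auto
qed

end

subsection \<open>Asymptotics\<close>

lemma poly_over_power_tendsto:
  fixes p :: "real poly"
  assumes "degree p \<le> k"
  shows "(\<lambda>t. poly p (real t) / real t ^ k) \<longlonglongrightarrow> coeff p k"
proof -
  have inv: "(\<lambda>t. (1 / real t) ^ j) \<longlonglongrightarrow> (if j = 0 then 1 else 0)" for j
  proof (cases j)
    case (Suc i)
    show ?thesis
      using tendsto_power[OF lim_1_over_n[where ?'a = real], of j]
      by (simp only: Suc power_0_Suc nat.distinct if_False)
  qed simp
  have "(\<lambda>t. \<Sum>i\<le>k. coeff p i * (1 / real t) ^ (k - i)) \<longlonglongrightarrow> (\<Sum>i\<le>k. coeff p i * (if k - i = 0 then 1 else 0))"
    by (intro tendsto_sum tendsto_mult tendsto_const inv)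
  also have "(\<Sum>i\<le>k. coeff p i * (if k - i = 0 then 1 else 0)) = (\<Sum>i\<le>k. if i = k then coeff p i else 0)"
    by (intro sum.cong) auto
  also have "\<dots> = coeff p k" by simp
  finally have 1: "(\<lambda>t. \<Sum>i\<le>k. coeff p i * (1 / real t) ^ (k - i)) \<longlonglongrightarrow> coeff p k" .
  have "poly p (real t) / real t ^ k = (\<Sum>i\<le>k. coeff p i * (1 / real t) ^ (k - i))" if "t > 0" for t
  proof -
    have "poly p (real t) = (\<Sum>i\<le>k. coeff p i * real t ^ i)"
      using poly_altdef[of p] assms by (auto intro!: sum.mono_neutral_left dest: le_degree)
    moreover have "real t ^ i / real t ^ k = (1 / real t) ^ (k - i)" if "i \<le> k" for i
    proof -
      have "real t ^ k = real t ^ i * real t ^ (k - i)" using that by (simp flip: power_add)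
      then show ?thesis using \<open>t > 0\<close> by (simp add: power_one_over)
    qed
    ultimately show ?thesis
      by (simp add: sum_divide_distrib times_divide_eq_right[symmetric] del: times_divide_eq_right)
  qed
  then have "\<forall>\<^sub>F t in sequentially. (\<Sum>i\<le>k. coeff p i * (1 / real t) ^ (k - i)) = poly p (real t) / real t ^ k"
    by (intro eventually_mono[OF eventually_gt_at_top[of 0]]) (rule sym)
  with 1 show ?thesis by (rule Lim_transform_eventually)
qed

lemma linear_power_over_power_tendsto_0:
  assumes "k < d"
  shows "(\<lambda>t. real ((a * t + 1) ^ k) / real t ^ d) \<longlonglongrightarrow> 0"
proof -
  have "degree ([:1, real a:] ^ k) \<le> k"
    by (rule order_trans[OF degree_power_le]) simp
  moreover from this have "coeff ([:1, real a:] ^ k) d = 0" using assms by (intro coeff_eq_0) simp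
  ultimately show ?thesis
    using poly_over_power_tendsto[of "[:1, real a:] ^ k" d] assms by (simp add: poly_power algebra_simps)
qed

text \<open>The bound forces the polynomial to have degree at most \<open>k\<close>: otherwise its
  leading coefficient would be the limit of a sequence squeezed to 0. The limit is then its
  coefficient of degree \<open>k\<close>.\<close>

lemma eventually_poly_over_power_tendsto:
  assumes "eventually_poly f" "\<And>t. f t \<le> (a * t + 1) ^ k"
  obtains h where "(\<lambda>t. real (f t) / real t ^ k) \<longlonglongrightarrow> h"
proof -
  obtain p where p: "\<forall>\<^sub>F t in sequentially. real (f t) = poly p (real t)"
    using assms unfolding eventually_poly_def by blast
  have lim: "(\<lambda>t. real (f t) / real t ^ d) \<longlonglongrightarrow> coeff p d" if "degree p \<le> d" for d
  proof (rule Lim_transform_eventually)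
    show "(\<lambda>t. poly p (real t) / real t ^ d) \<longlonglongrightarrow> coeff p d"
      using that by (rule poly_over_power_tendsto)
    show "\<forall>\<^sub>F t in sequentially. poly p (real t) / real t ^ d = real (f t) / real t ^ d"
      using p by eventually_elim simp
  qed
  have "degree p \<le> k"
  proof (rule ccontr)
    assume "\<not> degree p \<le> k"
    then have "k < degree p" by simp
    have "(\<lambda>t. real (f t) / real t ^ degree p) \<longlonglongrightarrow> 0"
    proof (rule tendsto_sandwich[OF _ _ tendsto_const linear_power_over_power_tendsto_0[OF \<open>k < degree p\<close>]])
      show "\<forall>\<^sub>F t in sequentially. 0 \<le> real (f t) / real t ^ degree p" by simp
      show "\<forall>\<^sub>F t in sequentially. real (f t) / real t ^ degree p \<le> real ((a * t + 1) ^ k) / real t ^ degree p"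
        using assms(2) by (intro always_eventually allI divide_right_mono) (simp_all only: of_nat_le_iff zero_le_power of_nat_0_le_iff)
    qed
    with lim[OF order_refl] have "lead_coeff p = 0" by (rule LIMSEQ_unique)
    then show False using \<open>k < degree p\<close> by simp
  qed
  then show ?thesis using lim that by blast
qed

text \<open>The quotient of \<open>t + l\<close> by \<open>t\<close> tends to 1. Together with its
  counterpart below, this makes translations by a fixed number of edges invisible in the
  limit.\<close>

lemma tendsto_shift_up:
  assumes "(\<lambda>t. real (f t) / real t ^ k) \<longlonglongrightarrow> h"
  shows "(\<lambda>t. real (f (t + l)) / real t ^ k) \<longlonglongrightarrow> h"
proof -
  have "(\<lambda>t. poly [:real l, 1:] (real t) / real t ^ 1) \<longlonglongrightarrow> coeff [:real l, 1:] 1"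
    by (intro poly_over_power_tendsto) simp
  then have "(\<lambda>t. (real (t + l) / real t) ^ k) \<longlonglongrightarrow> 1 ^ k"
    by (intro tendsto_power) (simp add: add.commute)
  from tendsto_mult[OF LIMSEQ_ignore_initial_segment[OF assms, of l] this]
  have 1: "(\<lambda>t. real (f (t + l)) / real (t + l) ^ k * (real (t + l) / real t) ^ k) \<longlonglongrightarrow> h" by simp
  show ?thesis
  proof (rule Lim_transform_eventually[OF 1])
    show "\<forall>\<^sub>F t in sequentially. real (f (t + l)) / real (t + l) ^ k * (real (t + l) / real t) ^ k = real (f (t + l)) / real t ^ k"
      using eventually_gt_at_top[of 0] by eventually_elim (simp add: power_divide)
  qed
qed

lemma tendsto_shift_down:
  assumes "(\<lambda>t. real (f t) / real t ^ k) \<longlonglongrightarrow> h"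
  shows "(\<lambda>t. real (f (t - l)) / real t ^ k) \<longlonglongrightarrow> h"
\<comment> \<open>Passing to the index \<open>t + l\<close> removes the truncated
  subtraction.\<close>
proof (rule LIMSEQ_offset[of _ l])
  have "(\<lambda>t. poly [:real l, 1:] (real t) / real t ^ 1) \<longlonglongrightarrow> coeff [:real l, 1:] 1"
    by (intro poly_over_power_tendsto) simp
  then have "(\<lambda>t. real (t + l) / real t) \<longlonglongrightarrow> 1" by (simp add: add.commute)
  then have "(\<lambda>t. (inverse (real (t + l) / real t)) ^ k) \<longlonglongrightarrow> inverse 1 ^ k"
    by (intro tendsto_power tendsto_inverse) simp_all
  from tendsto_mult[OF assms this]
  have 1: "(\<lambda>t. real (f t) / real t ^ k * (real t / real (t + l)) ^ k) \<longlonglongrightarrow> h" by simp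
  show "(\<lambda>t. real (f (t + l - l)) / real (t + l) ^ k) \<longlonglongrightarrow> h"
  proof (rule Lim_transform_eventually[OF 1])
    show "\<forall>\<^sub>F t in sequentially. real (f t) / real t ^ k * (real t / real (t + l)) ^ k = real (f (t + l - l)) / real (t + l) ^ k"
      using eventually_gt_at_top[of 0] by eventually_elim (simp add: power_divide)
  qed
qed

section \<open>The two cases for the edge lattice\<close>

context edge_system begin

text \<open>A step between adjacent edges exchanges two linked nodes, which lie both inside or both
  outside \<open>C\<close>. The number of nodes in \<open>C\<close> is therefore constant along
  every path of edges.\<close>

lemma edge_weight_const:
  assumes C: "\<And>a b. linked a b \<Longrightarrow> a \<in> C \<Longrightarrow> b \<in> C"
  obtains c where "\<And>e. e \<in> E \<Longrightarrow> card (e \<inter> C) = c"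
proof -
  have adj: "card (u \<inter> C) = card (v \<inter> C)" if uv: "u \<in> E" "v \<in> E" "card (u \<inter> v) = m - 1" for u v
  proof -
    obtain i j where ij: "u = insert i (u \<inter> v)" "v = insert j (u \<inter> v)" "i \<notin> v" "j \<notin> u" "linked i j"
      using adjacent_edges_linked[OF uv] by metis
    define w where "w = u \<inter> v"
    have w: "u = insert i w" "v = insert j w" "i \<notin> w" "j \<notin> w" "finite w"
      using ij finite_edge[OF uv(1)] unfolding w_def by auto
    have "i \<in> C \<longleftrightarrow> j \<in> C" using C ij(5) linked_sym by blast
    then show ?thesis using w by (simp add: Int_insert_left)
  qed
  have path: "p \<noteq> [] \<Longrightarrow> set p \<subseteq> E \<Longrightarrow> successively (\<lambda>a b. card (a \<inter> b) = m - 1) p \<Longrightarrow>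
     card (hd p \<inter> C) = card (last p \<inter> C)" for p
  proof (induction p rule: induct_list012)
    case (3 x y zs)
    have "card (x \<inter> C) = card (y \<inter> C)" using 3 by (intro adj) auto
    with 3 show ?case by simp
  qed simp_all
  obtain e0 where e0: "e0 \<in> E" using E_ne by blast
  show thesis
  proof (rule that)
    fix e assume "e \<in> E"
    with conn e0 have "\<exists>p. p \<noteq> [] \<and> set p \<subseteq> E \<and> hd p = e \<and> last p = e0 \<and>
      successively (\<lambda>a b. card (a \<inter> b) = m - 1) p"
      unfolding properly_connected_def by simp
    with path show "card (e \<inter> C) = card (e0 \<inter> C)" by blast
  qed
qed

lemma lookup_S_le: "s \<in> S t \<Longrightarrow> lookup s v \<le> m * t"
  using lookup_le_total_degree[OF finite_V S_exponents, of s t v] deg_S by simp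

lemma total_degree_remove:
  "finite C \<Longrightarrow> i \<in> C \<Longrightarrow> total_degree C a = lookup a i + total_degree (C - {i}) a"
  unfolding total_degree_def by (rule sum.remove)

lemma total_degree_cong:
  "(\<And>v. v \<in> C \<Longrightarrow> lookup a v = lookup b v) \<Longrightarrow> total_degree C a = total_degree C b"
  unfolding total_degree_def by (rule sum.cong) auto

text \<open>All elements of \<open>S t\<close> have total degree \<open>m * t\<close>, so one
  coordinate is determined by the others.\<close>

lemma card_S_le: "card (S t) \<le> (m * t + 1) ^ (n - 1)"
proof -
  obtain i where i: "i \<in> V" using V_ne by blast
  have "card (S t) \<le> (m * t + 1) ^ card (V - {i})"
  proof (rule card_bounded_exponents(2))
    show "lookup a v \<le> m * t" if "a \<in> S t" for a v using that by (rule lookup_S_le)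
    fix a b assume ab: "a \<in> S t" "b \<in> S t" and eq: "\<forall>v\<in>V - {i}. lookup a v = lookup b v"
    have "total_degree (V - {i}) a = total_degree (V - {i}) b" using eq by (intro total_degree_cong) auto
    then have "lookup a i = lookup b i"
      using deg_S[OF ab(1)] deg_S[OF ab(2)] total_degree_remove[OF finite_V i, of a] total_degree_remove[OF finite_V i, of b]
      by simp
    with eq show "a = b" using ab S_exponents by (intro exponents_eqI[of a V b]) auto
  qed (use finite_V in auto)
  then show ?thesis using i finite_V by simp
qed

text \<open>The linkage class of \<open>i\<close> meets all edges in the same number of nodes. The
  resulting linear relation on \<open>S t\<close> is independent of the total degree because the
  class misses \<open>j\<close>, so two coordinates become redundant.\<close>

lemma card_S_le_unlinked:
  assumes "i \<in> V" "j \<in> V" "\<not> linked i j"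
  shows "card (S t) \<le> (m * t + 1) ^ (n - 2)" "n \<ge> 2"
proof -
  define C where "C = {v \<in> V. linked i v}"
  \<comment> \<open>Closure under \<open>linked\<close> is immediate for the unrestricted class.
    Edges lie inside \<open>V\<close>, so they meet \<open>C\<close> and \<open>C'\<close> in the
    same nodes.\<close>
  define C' where "C' = {v. linked i v}"
  obtain c where c': "\<And>e. e \<in> E \<Longrightarrow> card (e \<inter> C') = c"
    using edge_weight_const[of C'] linked_trans unfolding C'_def by blast
  have c: "card (e \<inter> C) = c" if "e \<in> E" for e
  proof -
    have "e \<inter> C = e \<inter> C'" using that E_sub unfolding C_def C'_def by blast
    then show ?thesis using c'[OF that] by simp
  qed
  have C: "C \<subseteq> V" "finite C" "i \<in> C" "j \<notin> C" using assms linked_refl finite_V unfolding C_def by auto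
  have ij: "i \<noteq> j" using C by auto
  have card: "card (V - {i, j}) = n - 2" using assms(1,2) ij finite_V by (simp add: card_Diff_subset)
  show "n \<ge> 2" using card_mono[OF finite_V, of "{i, j}"] assms(1,2) ij by simp
  have "card (S t) \<le> (m * t + 1) ^ card (V - {i, j})"
  proof (rule card_bounded_exponents(2))
    show "lookup a v \<le> m * t" if "a \<in> S t" for a v using that by (rule lookup_S_le)
    fix a b assume ab: "a \<in> S t" "b \<in> S t" and eq: "\<forall>v\<in>V - {i, j}. lookup a v = lookup b v"
    \<comment> \<open>The relation on \<open>C\<close> does not involve \<open>j\<close>, so it
      determines coordinate \<open>i\<close> from the given ones; only then can the total degree
      determine coordinate \<open>j\<close>.\<close>
    have "total_degree (C - {i}) a = total_degree (C - {i}) b" using eq C by (intro total_degree_cong) auto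
    then have i: "lookup a i = lookup b i"
      using weight_S[OF C(1) c ab(1)] weight_S[OF C(1) c ab(2)] total_degree_remove[OF C(2,3), of a] total_degree_remove[OF C(2,3), of b]
      by simp
    have "total_degree (V - {j}) a = total_degree (V - {j}) b" using eq i by (intro total_degree_cong) auto
    then have "lookup a j = lookup b j"
      using deg_S[OF ab(1)] deg_S[OF ab(2)] total_degree_remove[OF finite_V assms(2), of a] total_degree_remove[OF finite_V assms(2), of b]
      by simp
    with eq i show "a = b" using ab S_exponents by (intro exponents_eqI[of a V b]) auto
  qed (use finite_V in auto)
  then show "card (S t) \<le> (m * t + 1) ^ (n - 2)" using card by simp
qed

text \<open>Each counted exponent is one of at most \<open>(m * t + 1) ^ (n - 2)\<close> sums plus
  one of \<open>K\<close> bounded remainders, which is one order of growth too small.\<close>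

lemma torsion_count_tendsto_0:
  assumes "i \<in> V" "j \<in> V" "\<not> linked i j"
  shows "(\<lambda>t. real (torsion_count V E t) / real t ^ (n - 1)) \<longlonglongrightarrow> 0"
proof -
  obtain q where q: "\<And>t a. a \<in> torsion_exponents V E t - U (t + 1) \<Longrightarrow>
      \<exists>s\<in>S t. \<exists>c\<in>exponents V. tdeg c \<le> q \<and> a = s + c"
    using torsion_bounded_remainder by blast
  define K where "K = card {c \<in> exponents V. tdeg c \<le> q}"
  have fin: "finite {c \<in> exponents V. tdeg c \<le> q}" using finite_exponents_degree_le[OF finite_V] .
  have le: "torsion_count V E t \<le> (m * t + 1) ^ (n - 2) * K" for t
  proof -
    have "torsion_exponents V E t - U (t + 1) \<subseteq> (\<lambda>(s, c). s + c) ` (S t \<times> {c \<in> exponents V. tdeg c \<le> q})"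
      using q by fastforce
    then have "torsion_count V E t \<le> card ((\<lambda>(s, c). s + c) ` (S t \<times> {c \<in> exponents V. tdeg c \<le> q}))"
      unfolding torsion_count_def using finite_S fin by (intro card_mono) auto
    also have "\<dots> \<le> card (S t \<times> {c \<in> exponents V. tdeg c \<le> q})"
      using finite_S fin by (intro card_image_le) auto
    also have "\<dots> = card (S t) * K" unfolding K_def by (rule card_cartesian_product)
    also have "\<dots> \<le> (m * t + 1) ^ (n - 2) * K" using card_S_le_unlinked(1)[OF assms] by (rule mult_le_mono1)
    finally show ?thesis .
  qed
  have "n - 2 < n - 1" using card_S_le_unlinked(2)[OF assms] by linarith
  from tendsto_mult_right[OF linear_power_over_power_tendsto_0[OF this], of m "real K"]
  have 0: "(\<lambda>t. real ((m * t + 1) ^ (n - 2)) / real t ^ (n - 1) * real K) \<longlonglongrightarrow> 0" by simp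
  show ?thesis
  proof (rule tendsto_sandwich[OF _ _ tendsto_const 0])
    show "\<forall>\<^sub>F t in sequentially. 0 \<le> real (torsion_count V E t) / real t ^ (n - 1)" by simp
    have "real (torsion_count V E t) / real t ^ (n - 1) \<le> real ((m * t + 1) ^ (n - 2) * K) / real t ^ (n - 1)" for t
      by (intro divide_right_mono of_nat_mono le zero_le_power) simp
    then show "\<forall>\<^sub>F t in sequentially. real (torsion_count V E t) / real t ^ (n - 1)
        \<le> real ((m * t + 1) ^ (n - 2)) / real t ^ (n - 1) * real K"
      by (intro always_eventually) simp
  qed
qed

text \<open>The unit vectors that make up \<open>c\<close> are moved to \<open>v0\<close> one at a
  time, and the edge sums of the individual links add up.\<close>

lemma linked_exponent:
  assumes "\<And>i j. i \<in> V \<Longrightarrow> j \<in> V \<Longrightarrow> linked i j" "v0 \<in> V" "c \<in> exponents V"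
  shows "\<exists>l. \<exists>s1\<in>S l. \<exists>s2\<in>S l. s1 + c = s2 + single v0 (tdeg c)"
  using assms(3)
proof (induction "tdeg c" arbitrary: c)
  case 0
  then have "c = 0" using total_degree_eq_0_iff[OF finite_V] by metis
  then show ?case using zero_in_sumset by (intro exI[of _ 0]) auto
next
  case (Suc k)
  obtain v b where b: "v \<in> V" "b \<in> exponents V" "c = b + \<delta> v" "tdeg c = tdeg b + 1"
    using exponents_split_single[OF finite_V Suc.prems] Suc.hyps(2) by (metis zero_less_Suc)
  obtain l s1 s2 where 1: "s1 \<in> S l" "s2 \<in> S l" "s1 + b = s2 + single v0 (tdeg b)"
    using Suc.hyps(1)[of b] b Suc.hyps(2) by auto
  obtain l' s3 s4 where 2: "s3 \<in> S l'" "s4 \<in> S l'" "s3 + \<delta> v = s4 + \<delta> v0"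
    using assms(1)[OF b(1) assms(2)] unfolding linked_def by blast
  have "(s1 + s3) + c = (s1 + b) + (s3 + \<delta> v)" unfolding b(3) by (simp add: ac_simps)
  also have "\<dots> = (s2 + s4) + (single v0 (tdeg b) + \<delta> v0)" unfolding 1 2 by (simp add: ac_simps)
  also have "single v0 (tdeg b) + \<delta> v0 = single v0 (tdeg c)"
    unfolding b(4) by (rule single_add[symmetric])
  finally have "(s1 + s3) + c = (s2 + s4) + single v0 (tdeg c)" .
  then show ?case using sumset_add[OF 1(1) 2(1)] sumset_add[OF 1(2) 2(2)] by blast
qed

text \<open>One translation serves all of \<open>C\<close>: an edge sum added on behalf of a new
  element appears on both sides of the equations for the earlier ones and does no harm
  there.\<close>

lemma linked_exponents_uniform:
  assumes "\<And>i j. i \<in> V \<Longrightarrow> j \<in> V \<Longrightarrow> linked i j" "v0 \<in> V" "C \<subseteq> exponents V" "finite C"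
  shows "\<exists>l. \<exists>w\<in>S l. \<forall>c\<in>C. \<exists>s\<in>S l. w + c = s + single v0 (tdeg c)"
  using assms(4,3)
proof (induction C rule: finite_induct)
  case empty
  show ?case using zero_in_sumset by blast
next
  case (insert c C)
  then obtain l w where w: "w \<in> S l" "\<And>c. c \<in> C \<Longrightarrow> \<exists>s\<in>S l. w + c = s + single v0 (tdeg c)" by auto
  obtain l' s1 s2 where 2: "s1 \<in> S l'" "s2 \<in> S l'" "s1 + c = s2 + single v0 (tdeg c)"
    using linked_exponent[OF assms(1,2), of c] insert.prems by auto
  have "\<exists>s\<in>S (l + l'). w + s1 + d = s + single v0 (tdeg d)" if "d \<in> insert c C" for d
  proof -
    from that consider "d = c" | "d \<in> C" by blast
    then show ?thesis
    proof cases
      case 1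
      have "w + s1 + d = w + (s1 + c)" unfolding 1 by (simp add: ac_simps)
      also have "\<dots> = (w + s2) + single v0 (tdeg d)" unfolding 2 1 by (simp add: ac_simps)
      finally show ?thesis using sumset_add[OF w(1) 2(2)] by blast
    next
      case d: 2
      obtain s where s: "s \<in> S l" "w + d = s + single v0 (tdeg d)" using w(2)[OF d] by blast
      have "w + s1 + d = (w + d) + s1" by (simp add: ac_simps)
      also have "\<dots> = (s + s1) + single v0 (tdeg d)" unfolding s by (simp add: ac_simps)
      finally show ?thesis using sumset_add[OF s(1) 2(1)] by blast
    qed
  qed
  then show ?case using sumset_add[OF w(1) 2(1)] by blast
qed

text \<open>Moving all nodes of a single edge to \<open>v\<close> expresses
  \<open>single v m\<close> as a difference of two edge sums. These differences later separate the
  primes in a chain of full length in the edge subring.\<close>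

lemma linked_multiple:
  assumes "\<And>i j. i \<in> V \<Longrightarrow> j \<in> V \<Longrightarrow> linked i j" "v \<in> V"
  shows "\<exists>l. \<exists>s1\<in>S l. \<exists>s2\<in>S (l + 1). s2 = s1 + single v m"
proof -
  obtain e where e: "e \<in> E" using E_ne by blast
  obtain l s1 s2 where "s1 \<in> S l" "s2 \<in> S l" "s1 + edge_exponent e = s2 + single v m"
    using linked_exponent[OF assms edge_in_exponents[OF e]] deg_edge[OF e] by auto
  then show ?thesis using sumset_add[of s1 E l, OF _ edge_exponent_in_sumset[OF e]] by metis
qed

text \<open>A uniform translation \<open>w\<close> takes both \<open>c\<close> and a fixed edge to
  \<open>single v0 m\<close> plus an edge sum. Reading the relation for the edge backwards trades
  \<open>s0 + single v0 m\<close> for \<open>w\<close> plus that edge, so \<open>w + s0\<close>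
  takes \<open>c\<close> to a sum of \<open>l + l + 1\<close> edges.\<close>

lemma absorbing_element:
  assumes "\<And>i j. i \<in> V \<Longrightarrow> j \<in> V \<Longrightarrow> linked i j"
  obtains l w where "w \<in> S l" "\<And>c. c \<in> exponents V \<Longrightarrow> tdeg c = m \<Longrightarrow> w + c \<in> S (l + 1)"
proof -
  obtain v0 where v0: "v0 \<in> V" using V_ne by blast
  have "finite {c \<in> exponents V. tdeg c = m}"
    by (rule finite_subset[OF _ finite_exponents_degree_le[OF finite_V, of m]]) auto
  with linked_exponents_uniform[OF assms v0, of "{c \<in> exponents V. tdeg c = m}"]
  obtain l w where w: "w \<in> S l" "\<forall>c\<in>{c \<in> exponents V. tdeg c = m}. \<exists>s\<in>S l. w + c = s + single v0 (tdeg c)"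
    by blast
  obtain e where e: "e \<in> E" using E_ne by blast
  obtain s0 where s0: "s0 \<in> S l" "w + edge_exponent e = s0 + single v0 m"
    using w(2) edge_in_exponents[OF e] deg_edge[OF e] by force
  show thesis
  proof (rule that[of "w + s0" "l + l"])
    show "w + s0 \<in> S (l + l)" using w(1) s0(1) by (rule sumset_add)
    fix c assume c: "c \<in> exponents V" "tdeg c = m"
    then obtain s where s: "s \<in> S l" "w + c = s + single v0 m" using w(2) by force
    have "w + s0 + c = (w + c) + s0" by (simp add: ac_simps)
    also have "\<dots> = s + (s0 + single v0 m)" unfolding s by (simp add: ac_simps)
    also have "\<dots> = s + w + edge_exponent e" unfolding s0(2)[symmetric] by (simp add: ac_simps)
    finally show "w + s0 + c \<in> S (l + l + 1)"
      using sumset_add[OF sumset_add[OF s(1) w(1)] edge_exponent_in_sumset[OF e]] by simp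
  qed
qed

text \<open>Adding \<open>r\<close> copies of \<open>v0\<close> with \<open>r < m\<close> to an
  element of \<open>w + S (t - l)\<close> gives degree \<open>m * t + r\<close>, too small for the
  next power, while any further exponent of degree \<open>m\<close> is absorbed by \<open>w\<close>.
  The degree recovers \<open>r\<close>, so the \<open>m\<close> families are disjoint.\<close>

lemma torsion_count_ge:
  assumes w: "w \<in> S l" "\<And>c. c \<in> exponents V \<Longrightarrow> tdeg c = m \<Longrightarrow> w + c \<in> S (l + 1)" and "l \<le> t"
  shows "m * card (S (t - l)) \<le> torsion_count V E t"
proof -
  obtain v0 where v0: "v0 \<in> V" using V_ne by blast
  let ?f = "\<lambda>(r, s). s + w + single v0 r"
  have degf: "tdeg (s + w + single v0 r) = m * t + r" if "s \<in> S (t - l)" for s r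
    using deg_S[OF sumset_add[OF that w(1)]] assms(3) v0 finite_V by (simp add: total_degree_single)
  have "inj_on ?f ({..<m} \<times> S (t - l))"
  proof (rule inj_onI, clarify)
    fix r s r' s' assume *: "s \<in> S (t - l)" "s' \<in> S (t - l)"
      "s + w + single v0 r = s' + w + single v0 r'"
    then have "m * t + r = m * t + r'" using degf by metis
    with * show "r = r' \<and> s = s'" by simp
  qed
  moreover have "?f ` ({..<m} \<times> S (t - l)) \<subseteq> torsion_exponents V E t - U (t + 1)"
  proof safe
    fix r s assume r: "r < m" and s: "s \<in> S (t - l)"
    have sw: "s + w \<in> S t" using sumset_add[OF s w(1)] assms(3) by simp
    have single: "single v0 r \<in> exponents V" using v0 by simp
    show "s + w + single v0 r \<in> torsion_exponents V E t"
      unfolding torsion_exponents_def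
    proof (intro CollectI conjI exI[of _ m] ballI impI)
      show "s + w + single v0 r \<in> U t" using sw single by (rule power_exponentsI)
      fix b assume b: "b \<in> exponents V" "m \<le> tdeg b"
      obtain b1 b2 where b12: "b1 \<in> exponents V" "b2 \<in> exponents V" "b = b1 + b2" "tdeg b1 = m"
        using exponents_split_degree[OF finite_V b] by metis
      have "s + (w + b1) \<in> S (t - l + (l + 1))" by (intro sumset_add s w b12)
      then have "s + (w + b1) + (b2 + single v0 r) \<in> U (t + 1)"
        using assms(3) b12 single by (intro power_exponentsI) auto
      then show "s + w + single v0 r + b \<in> U (t + 1)" unfolding b12 by (simp add: ac_simps)
    qed
    assume "s + w + single v0 r \<in> U (t + 1)"
    then obtain s' c where "s' \<in> S (t + 1)" "s + w + single v0 r = s' + c"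
      unfolding power_exponents_def by blast
    then have "m * t + r \<ge> m * (t + 1)" using degf[OF s, of r] deg_S[of s' "t + 1"] by simp
    then show False using r by simp
  qed
  ultimately have "card ({..<m} \<times> S (t - l)) \<le> torsion_count V E t"
    unfolding torsion_count_def using finite_torsion by (rule card_inj_on_le)
  then show ?thesis by (simp add: card_cartesian_product)
qed

text \<open>The exponents of degree \<open>m * t + r\<close> with \<open>r < m\<close> are
  translated by \<open>w'\<close> into \<open>S (t + l')\<close> plus \<open>r\<close> copies of
  \<open>v0\<close>, which bounds each of these \<open>m\<close> layers. The uniform choice of
  \<open>w'\<close> is possible because the remainders range over a finite set.\<close>

lemma torsion_count_le:
  assumes w: "w \<in> S l" "\<And>c. c \<in> exponents V \<Longrightarrow> tdeg c = m \<Longrightarrow> w + c \<in> S (l + 1)"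
    and link: "\<And>i j. i \<in> V \<Longrightarrow> j \<in> V \<Longrightarrow> linked i j"
  obtains l' K where "\<And>t. l \<le> t \<Longrightarrow> torsion_count V E t \<le> m * card (S (t + l')) + (card (S t) - card (S (t - l))) * K"
proof -
  obtain q where q: "\<And>t a. a \<in> torsion_exponents V E t - U (t + 1) \<Longrightarrow>
      \<exists>s\<in>S t. \<exists>c\<in>exponents V. tdeg c \<le> q \<and> a = s + c"
    using torsion_bounded_remainder by blast
  define C where "C = {c \<in> exponents V. tdeg c \<le> q}"
  have C: "finite C" "C \<subseteq> exponents V" unfolding C_def using finite_exponents_degree_le[OF finite_V] by auto
  obtain v0 where v0: "v0 \<in> V" using V_ne by blast
  from linked_exponents_uniform[OF link v0 C(2,1)] obtain l' w' where
    w': "w' \<in> S l'" "\<And>c. c \<in> C \<Longrightarrow> \<exists>s\<in>S l'. w' + c = s + single v0 (tdeg c)" by blast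
  show thesis
  proof (rule that[of l' "card C"])
    fix t assume lt: "l \<le> t"
    define T where "T = torsion_exponents V E t - U (t + 1)"
    define T1 where "T1 r = {a \<in> T. tdeg a = m * t + r}" for r
    define T2 where "T2 = {a \<in> T. m * (t + 1) \<le> tdeg a}"
    have dec: "\<exists>s\<in>S t. \<exists>c\<in>C. a = s + c" if "a \<in> T" for a
      using q that unfolding T_def C_def by blast
    have "finite T" unfolding T_def by (rule finite_torsion)
    have cover: "T \<subseteq> (\<Union>r<m. T1 r) \<union> T2"
    proof
      fix a assume a: "a \<in> T"
      obtain s c where sc: "s \<in> S t" "c \<in> C" "a = s + c" using dec[OF a] by blast
      have d: "tdeg a = m * t + tdeg c" unfolding sc(3) by (simp add: deg_S[OF sc(1)])
      show "a \<in> (\<Union>r<m. T1 r) \<union> T2"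
        using a d unfolding T1_def T2_def by (cases "tdeg c < m") auto
    qed
    have T1: "card (T1 r) \<le> card (S (t + l'))" for r
    proof -
      have "(\<lambda>a. a + w') ` T1 r \<subseteq> (\<lambda>s. s + single v0 r) ` S (t + l')"
      proof safe
        fix a assume a: "a \<in> T1 r"
        obtain s c where sc: "s \<in> S t" "c \<in> C" "a = s + c" using dec a unfolding T1_def by blast
        have "tdeg c = r" using a unfolding T1_def sc(3) by (simp add: deg_S[OF sc(1)])
        then obtain s' where s': "s' \<in> S l'" "w' + c = s' + single v0 r" using w'(2)[OF sc(2)] by blast
        have "a + w' = s + (w' + c)" unfolding sc(3) by (simp add: ac_simps)
        also have "\<dots> = (s + s') + single v0 r" unfolding s' by (simp add: ac_simps)
        finally show "a + w' \<in> (\<lambda>s. s + single v0 r) ` S (t + l')"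
          using sumset_add[OF sc(1) s'(1)] by blast
      qed
      then have "card ((\<lambda>a. a + w') ` T1 r) \<le> card ((\<lambda>s. s + single v0 r) ` S (t + l'))"
        using finite_S by (intro card_mono) auto
      then show ?thesis by (simp add: card_image inj_on_def)
    qed
    \<comment> \<open>A remainder of degree at least \<open>m\<close> contains a part of degree
      \<open>m\<close>. If the edge sum had \<open>w\<close> as a summand, \<open>w\<close> would
      absorb this part and the exponent would lie in the next power; so only edge sums in
      \<open>N\<close> occur in \<open>T2\<close>.\<close>
    define N where "N = S t - (\<lambda>s. s + w) ` S (t - l)"
    have cardN: "card N = card (S t) - card (S (t - l))"
    proof -
      have "(\<lambda>s. s + w) ` S (t - l) \<subseteq> S t" using sumset_add[OF _ w(1)] lt by fastforce
      then have "card N = card (S t) - card ((\<lambda>s. s + w) ` S (t - l))"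
        unfolding N_def using finite_S by (intro card_Diff_subset) auto
      then show ?thesis by (simp add: card_image inj_on_def)
    qed
    have "T2 \<subseteq> (\<lambda>(s, c). s + c) ` (N \<times> C)"
    proof
      fix a assume a: "a \<in> T2"
      obtain s c where sc: "s \<in> S t" "c \<in> C" "a = s + c" using dec a unfolding T2_def by blast
      have "m \<le> tdeg c" using a unfolding T2_def sc(3) by (simp add: deg_S[OF sc(1)])
      then obtain c1 c2 where c: "c1 \<in> exponents V" "c2 \<in> exponents V" "c = c1 + c2" "tdeg c1 = m"
        using exponents_split_degree[OF finite_V, of c m] sc(2) C(2) by blast
      have "s \<in> N"
      proof (rule ccontr)
        assume "s \<notin> N"
        then obtain s' where s': "s' \<in> S (t - l)" "s = s' + w" using sc(1) unfolding N_def by blast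
        have "s' + (w + c1) \<in> S (t - l + (l + 1))" by (intro sumset_add s' w c)
        then have "s' + (w + c1) + c2 \<in> U (t + 1)" using lt c by (intro power_exponentsI) auto
        then have "a \<in> U (t + 1)" unfolding sc s' c by (simp add: ac_simps)
        then show False using a unfolding T2_def T_def by blast
      qed
      then show "a \<in> (\<lambda>(s, c). s + c) ` (N \<times> C)" using sc by blast
    qed
    then have "card T2 \<le> card ((\<lambda>(s, c). s + c) ` (N \<times> C))"
      using C(1) finite_S unfolding N_def by (intro card_mono) auto
    also have "\<dots> \<le> card (N \<times> C)" using C(1) finite_S unfolding N_def by (intro card_image_le) auto
    finally have T2: "card T2 \<le> card N * card C" by (simp add: card_cartesian_product)
    have "torsion_count V E t \<le> card ((\<Union>r<m. T1 r) \<union> T2)"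
      unfolding torsion_count_def T_def[symmetric] using cover \<open>finite T\<close>
      by (intro card_mono) (auto simp: T1_def T2_def)
    also have "\<dots> \<le> card (\<Union>r<m. T1 r) + card T2" by (rule card_Un_le)
    also have "card (\<Union>r<m. T1 r) \<le> (\<Sum>r<m. card (T1 r))" by (rule card_UN_le) simp
    also have "\<dots> \<le> (\<Sum>r<m. card (S (t + l')))" by (intro sum_mono T1)
    also have "\<dots> = m * card (S (t + l'))" by simp
    finally show "torsion_count V E t \<le> m * card (S (t + l')) + (card (S t) - card (S (t - l))) * card C"
      using T2 unfolding cardN by simp
  qed
qed

lemma torsion_count_tendsto:
  assumes "\<And>i j. i \<in> V \<Longrightarrow> j \<in> V \<Longrightarrow> linked i j"
  obtains h where "(\<lambda>t. real (card (S t)) / real t ^ (n - 1)) \<longlonglongrightarrow> h"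
    "(\<lambda>t. real (torsion_count V E t) / real t ^ (n - 1)) \<longlonglongrightarrow> real m * h"
proof -
  have "eventually_poly (\<lambda>t. card (S t))"
    unfolding sumset_def by (rule eventually_poly_card_nfold_sums[OF finite_E])
  then obtain h where h: "(\<lambda>t. real (card (S t)) / real t ^ (n - 1)) \<longlonglongrightarrow> h"
    using card_S_le by (rule eventually_poly_over_power_tendsto)
  obtain l w where w: "w \<in> S l" "\<And>c. c \<in> exponents V \<Longrightarrow> tdeg c = m \<Longrightarrow> w + c \<in> S (l + 1)"
    using absorbing_element[OF assms] by blast
  obtain l' K where le: "\<And>t. l \<le> t \<Longrightarrow> torsion_count V E t \<le> m * card (S (t + l')) + (card (S t) - card (S (t - l))) * K"
    using torsion_count_le[OF w assms] by blast
  note up = tendsto_shift_up[OF h, of l'] and down = tendsto_shift_down[OF h, of l]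
  have lower: "(\<lambda>t. real m * (real (card (S (t - l))) / real t ^ (n - 1))) \<longlonglongrightarrow> real m * h"
    by (intro tendsto_mult tendsto_const down)
  have "(\<lambda>t. real m * (real (card (S (t + l'))) / real t ^ (n - 1))
      + (real (card (S t)) / real t ^ (n - 1) - real (card (S (t - l))) / real t ^ (n - 1)) * real K) \<longlonglongrightarrow> real m * h + (h - h) * real K"
    by (intro tendsto_intros h up down)
  then have upper: "(\<lambda>t. real m * (real (card (S (t + l'))) / real t ^ (n - 1))
      + (real (card (S t)) / real t ^ (n - 1) - real (card (S (t - l))) / real t ^ (n - 1)) * real K) \<longlonglongrightarrow> real m * h"
    by simp
  show thesis
  proof (rule that[OF h tendsto_sandwich[OF _ _ lower upper]])
    show "\<forall>\<^sub>F t in sequentially. real m * (real (card (S (t - l))) / real t ^ (n - 1)) \<le> real (torsion_count V E t) / real t ^ (n - 1)"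
      using eventually_ge_at_top[of l]
    proof eventually_elim
      case (elim t)
      have "m * card (S (t - l)) \<le> torsion_count V E t"
        using w elim by (rule torsion_count_ge)
      then have "real (m * card (S (t - l))) / real t ^ (n - 1) \<le> real (torsion_count V E t) / real t ^ (n - 1)"
        by (intro divide_right_mono of_nat_mono zero_le_power) simp_all
      then show ?case by simp
    qed
    show "\<forall>\<^sub>F t in sequentially. real (torsion_count V E t) / real t ^ (n - 1) \<le> real m * (real (card (S (t + l'))) / real t ^ (n - 1))
      + (real (card (S t)) / real t ^ (n - 1) - real (card (S (t - l))) / real t ^ (n - 1)) * real K"
      using eventually_ge_at_top[of l]
    proof eventually_elim
      case (elim t)
      \<comment> \<open>Monotonicity turns the truncated difference of cardinalities into a real
        one.\<close>
      have "card (S (t - l)) \<le> card (S t)" using card_S_mono[of "t - l" l] elim by simp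
      then have "real (m * card (S (t + l')) + (card (S t) - card (S (t - l))) * K)
          = real m * real (card (S (t + l'))) + (real (card (S t)) - real (card (S (t - l)))) * real K"
        by (simp add: of_nat_diff)
      moreover have "real (torsion_count V E t) / real t ^ (n - 1)
          \<le> real (m * card (S (t + l')) + (card (S t) - card (S (t - l))) * K) / real t ^ (n - 1)"
        by (intro divide_right_mono of_nat_mono le[OF elim] zero_le_power) simp
      ultimately show ?case by (simp only: add_divide_distrib diff_divide_distrib times_divide_eq_left times_divide_eq_right left_diff_distrib)
    qed
  qed
qed

end

subsection \<open>Krull dimension of monoid algebras\<close>

abbreviation type_subring :: "'a::comm_ring_1 set \<Rightarrow> 'a ring" where
  "type_subring C \<equiv> ring_of_type_algebra\<lparr>carrier := C\<rparr>"

lemma type_subring_simps [simp]: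
  "carrier (type_subring C) = C" "x \<otimes>\<^bsub>type_subring C\<^esub> y = x * y" "x \<oplus>\<^bsub>type_subring C\<^esub> y = x + y"
  "\<one>\<^bsub>type_subring C\<^esub> = 1" "\<zero>\<^bsub>type_subring C\<^esub> = 0"
  "x \<otimes>\<^bsub>ring_of_type_algebra\<^esub> y = x * y" "x \<oplus>\<^bsub>ring_of_type_algebra\<^esub> y = x + y"
  "\<one>\<^bsub>ring_of_type_algebra\<^esub> = 1" "\<zero>\<^bsub>ring_of_type_algebra\<^esub> = 0"
  by (simp_all add: ring_of_type_algebra_def)

text \<open>The polynomial ring, the edge subring and the local ring are all subsets of a ring type.
  The locale expresses their ideals and primes as closure conditions in the operations of that type,
  so that its arithmetic is available.\<close>

locale closed_subring =
  fixes C :: "'a::comm_ring_1 set"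
  assumes one_closed: "1 \<in> C" and add_closed: "\<And>x y. x \<in> C \<Longrightarrow> y \<in> C \<Longrightarrow> x + y \<in> C"
    and uminus_closed: "\<And>x. x \<in> C \<Longrightarrow> - x \<in> C" and mult_closed: "\<And>x y. x \<in> C \<Longrightarrow> y \<in> C \<Longrightarrow> x * y \<in> C"
begin

lemma zero_closed: "0 \<in> C"
  using add_closed[OF one_closed uminus_closed[OF one_closed]] by simp

lemma cring: "cring (type_subring C)"
proof (rule cringI)
  show "abelian_group (type_subring C)"
    by (rule abelian_groupI) (auto simp: add_closed zero_closed ac_simps intro!: bexI[of _ "- x" for x] uminus_closed)
  show "comm_monoid (type_subring C)"
    by (rule comm_monoidI) (auto simp: mult_closed one_closed ac_simps)
qed (simp add: algebra_simps)

lemma ring: "ring (type_subring C)"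
  using cring by (simp add: cring_def)

lemma a_inv_eq: "x \<in> C \<Longrightarrow> \<ominus>\<^bsub>type_subring C\<^esub> x = - x"
  using abelian_group.minus_equality[OF ring.is_abelian_group[OF ring], of "- x" x] uminus_closed by simp

lemma ideal_iff:
  "ideal I (type_subring C) \<longleftrightarrow> I \<subseteq> C \<and> 0 \<in> I \<and> (\<forall>x\<in>I. \<forall>y\<in>I. x + y \<in> I) \<and> (\<forall>c\<in>C. \<forall>x\<in>I. c * x \<in> I)"
proof
  assume "ideal I (type_subring C)"
  then interpret ideal I "type_subring C" .
  show "I \<subseteq> C \<and> 0 \<in> I \<and> (\<forall>x\<in>I. \<forall>y\<in>I. x + y \<in> I) \<and> (\<forall>c\<in>C. \<forall>x\<in>I. c * x \<in> I)"
    using a_subset Units_closed zero_closed a_closed I_l_closed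
    by (metis additive_subgroup.a_closed additive_subgroup.zero_closed is_additive_subgroup type_subring_simps)
next
  assume I: "I \<subseteq> C \<and> 0 \<in> I \<and> (\<forall>x\<in>I. \<forall>y\<in>I. x + y \<in> I) \<and> (\<forall>c\<in>C. \<forall>x\<in>I. c * x \<in> I)"
  interpret R: ring "type_subring C" by (rule ring)
  show "ideal I (type_subring C)"
  proof (rule idealI[OF ring])
    show "subgroup I (add_monoid (type_subring C))"
    proof (rule group.subgroupI[OF R.a_group])
      fix x assume "x \<in> I"
      then have "- 1 * x \<in> I" using I uminus_closed[OF one_closed] by blast
      then show "inv\<^bsub>add_monoid (type_subring C)\<^esub> x \<in> I"
        using a_inv_eq[of x] I \<open>x \<in> I\<close> by (auto simp: a_inv_def)
    qed (use I in auto)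
  next
    fix a x assume "a \<in> I" "x \<in> carrier (type_subring C)"
    then have "x * a \<in> I" using I by simp
    then show "x \<otimes>\<^bsub>type_subring C\<^esub> a \<in> I" "a \<otimes>\<^bsub>type_subring C\<^esub> x \<in> I"
      by (simp_all add: mult.commute)
  qed
qed

lemma primeideal_iff:
  "primeideal P (type_subring C) \<longleftrightarrow> ideal P (type_subring C) \<and> 1 \<notin> P \<and> (\<forall>x\<in>C. \<forall>y\<in>C. x * y \<in> P \<longrightarrow> x \<in> P \<or> y \<in> P)"
proof
  assume "primeideal P (type_subring C)"
  then interpret primeideal P "type_subring C" .
  have "1 \<notin> P"
  proof
    assume "1 \<in> P"
    then have "carrier (type_subring C) = P" using one_imp_carrier by simp
    then show False using I_notcarr by simp
  qed
  then show "ideal P (type_subring C) \<and> 1 \<notin> P \<and> (\<forall>x\<in>C. \<forall>y\<in>C. x * y \<in> P \<longrightarrow> x \<in> P \<or> y \<in> P)"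
    using I_prime is_ideal by simp
next
  assume *: "ideal P (type_subring C) \<and> 1 \<notin> P \<and> (\<forall>x\<in>C. \<forall>y\<in>C. x * y \<in> P \<longrightarrow> x \<in> P \<or> y \<in> P)"
  then show "primeideal P (type_subring C)"
    using one_closed by (intro primeidealI cring) auto
qed

end

lemma krull_dim_eqI:
  assumes "\<forall>i\<le>n. primeideal (P i) R" "\<forall>i<n. P i \<subset> P (Suc i)"
    and "\<And>d Q. \<forall>i\<le>d. primeideal (Q i) R \<Longrightarrow> \<forall>i<d. Q i \<subset> Q (Suc i) \<Longrightarrow> d \<le> n"
  shows "krull_dim R = enat n"
  unfolding krull_dim_def
proof (rule antisym)
  show "Sup {enat d |d. \<exists>P. (\<forall>i\<le>d. primeideal (P i) R) \<and> (\<forall>i<d. P i \<subset> P (Suc i))} \<le> enat n"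
    using assms(3) by (intro Sup_least) auto
  show "enat n \<le> Sup {enat d |d. \<exists>P. (\<forall>i\<le>d. primeideal (P i) R) \<and> (\<forall>i<d. P i \<subset> P (Suc i))}"
    using assms(1,2) by (intro Sup_upper) auto
qed

lemma mpoly_eq_sum_monomials:
  fixes p :: "('v, 'k::field) mpoly"
  assumes "finite A" "keys p \<subseteq> A"
  shows "p = (\<Sum>a\<in>A. single a (lookup p a))"
proof (rule poly_mapping_eqI)
  fix a
  have "(\<Sum>b\<in>A. lookup (single b (lookup p b)) a)
      = (\<Sum>b\<in>A. if b = a then lookup p a else 0)"
    by (intro sum.cong) (auto simp: lookup_single when_def)
  also have "\<dots> = lookup p a" using assms by (auto simp: in_keys_iff)
  finally show "lookup p a
      = lookup (\<Sum>a\<in>A. single a (lookup p a)) a"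
    by (simp add: lookup_sum)
qed

lemma mconst_mult_monomial: "mconst c * single a d = single a (c * d)"
  by (simp add: mconst_def mult_single)

lemma in_mpoly_span_monomials:
  fixes p :: "('v, 'k::field) mpoly"
  assumes "keys p \<subseteq> A"
  shows "p \<in> mpoly.span ((\<lambda>a. single a 1) ` A)"
proof -
  have "p = (\<Sum>a\<in>keys p. mconst (lookup p a) * single a 1)"
    by (subst mpoly_eq_sum_monomials[OF finite_keys order_refl]) (simp add: mconst_mult_monomial)
  also have "\<dots> \<in> mpoly.span ((\<lambda>a. single a 1) ` A)"
    using assms by (intro mpoly.span_sum mpoly.span_scale mpoly.span_base) auto
  finally show ?thesis .
qed

text \<open>Polynomials supported on \<open>A\<close> lie in a span of at most \<open>card A\<close>
  monomials. Independence is assumed for the indexed family, so injectivity of \<open>b\<close>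
  comes out of it: a repetition would give a relation with coefficients 1 and -1.\<close>

lemma card_independent_family_le:
  fixes b :: "'i \<Rightarrow> ('v, 'k::field) mpoly"
  assumes "finite L" and ind: "\<And>u x. (\<Sum>x\<in>L. mconst (u x) * b x) = 0 \<Longrightarrow> x \<in> L \<Longrightarrow> u x = 0"
    and "finite A" "\<And>x. x \<in> L \<Longrightarrow> keys (b x) \<subseteq> A"
  shows "card L \<le> card A"
proof -
  have inj: "inj_on b L"
  proof (rule inj_onI, rule ccontr)
    fix x y assume xy: "x \<in> L" "y \<in> L" "b x = b y" "x \<noteq> y"
    define u :: "'i \<Rightarrow> 'k" where "u z = (if z = x then 1 else if z = y then - 1 else 0)" for z
    have "(\<Sum>z\<in>L. mconst (u z) * b z) = (\<Sum>z\<in>{x, y}. mconst (u z) * b z)"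
      using assms(1) xy by (intro sum.mono_neutral_right) (auto simp: u_def mconst_def)
    also have "\<dots> = 0" using xy by (simp add: u_def mconst_def single_uminus)
    finally have "u x = 0" using ind xy(1) by blast
    then show False by (simp add: u_def)
  qed
  have "mpoly.independent (b ` L)"
  proof (subst mpoly.dependent_finite)
    show "\<not> (\<exists>u. (\<exists>v\<in>b ` L. u v \<noteq> 0) \<and> (\<Sum>v\<in>b ` L. mconst (u v) * v) = 0)"
    proof
      assume "\<exists>u. (\<exists>v\<in>b ` L. u v \<noteq> 0) \<and> (\<Sum>v\<in>b ` L. mconst (u v) * v) = 0"
      then obtain u x where u: "x \<in> L" "u (b x) \<noteq> 0" "(\<Sum>v\<in>b ` L. mconst (u v) * v) = 0" by blast
      have "(\<Sum>x\<in>L. mconst (u (b x)) * b x) = 0" using u(3) inj by (simp add: sum.reindex)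
      from ind[OF this u(1)] u(2) show False by simp
    qed
  qed (use assms in auto)
  moreover have "b ` L \<subseteq> mpoly.span ((\<lambda>a. single a 1) ` A)"
    using assms(4) in_mpoly_span_monomials by blast
  ultimately have "card (b ` L) \<le> card ((\<lambda>a. single a 1 :: ('v, 'k) mpoly) ` A)"
    using mpoly.independent_span_bound[of "(\<lambda>a. single a 1) ` A" "b ` L"] assms(3) by simp
  also have "\<dots> \<le> card A" using assms(3) by (rule card_image_le)
  finally show ?thesis using inj by (simp add: card_image)
qed

definition monoid_algebra :: "('v \<Rightarrow>\<^sub>0 nat) set \<Rightarrow> ('v, 'k::field) mpoly set" where
  "monoid_algebra M = {p. keys p \<subseteq> M}"

locale exponent_monoid =
  fixes V :: "'v::linorder set" and M :: "('v \<Rightarrow>\<^sub>0 nat) set"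
  assumes finite_V: "finite V" and M_sub: "M \<subseteq> exponents V"
    and zero_M: "0 \<in> M" and add_M: "\<And>a b. a \<in> M \<Longrightarrow> b \<in> M \<Longrightarrow> a + b \<in> M"

sublocale exponent_monoid \<subseteq> closed_subring "monoid_algebra M :: ('v, 'k::field) mpoly set"
proof
  fix x y :: "('v, 'k) mpoly"
  show "1 \<in> (monoid_algebra M :: ('v, 'k) mpoly set)" using zero_M by (simp add: monoid_algebra_def)
  assume x: "x \<in> monoid_algebra M"
  then show "- x \<in> monoid_algebra M" by (simp add: monoid_algebra_def in_keys_iff subset_iff)
  assume y: "y \<in> monoid_algebra M"
  show "x + y \<in> monoid_algebra M"
    using x y keys_add[of x y] unfolding monoid_algebra_def by blast
  show "x * y \<in> monoid_algebra M"
    using x y keys_mult[of x y] add_M unfolding monoid_algebra_def by blast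
qed

text \<open>A list of length \<open>r\<close> holds the exponents of the last \<open>r\<close>
  elements \<open>f (d - r), ..., f (d - 1)\<close>, lowest index first. Prepending an exponent
  therefore goes one prime down the chain, which is the direction of the induction.\<close>

fun chain_monomial :: "(nat \<Rightarrow> 'a::comm_ring_1) \<Rightarrow> nat \<Rightarrow> nat list \<Rightarrow> 'a" where
  "chain_monomial f d [] = 1"
| "chain_monomial f d (k # ks) = f (d - Suc (length ks)) ^ k * chain_monomial f d ks"

definition bounded_lists :: "nat \<Rightarrow> nat \<Rightarrow> nat list set" where
  "bounded_lists t r = {xs. set xs \<subseteq> {..t} \<and> length xs = r}"

lemma finite_bounded_lists: "finite (bounded_lists t r)"
  unfolding bounded_lists_def by (rule finite_lists_length_eq) simp

lemma bounded_lists_0 [simp]: "bounded_lists t 0 = {[]}"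
  unfolding bounded_lists_def by auto

lemma card_bounded_lists: "card (bounded_lists t r) = (t + 1) ^ r"
  unfolding bounded_lists_def using card_lists_length_eq[of "{..t}" r] by simp

lemma sum_bounded_lists_Suc:
  "(\<Sum>xs\<in>bounded_lists t (Suc r). g xs) = (\<Sum>k\<le>t. \<Sum>ks\<in>bounded_lists t r. g (k # ks))"
proof -
  have "bounded_lists t (Suc r) = (\<lambda>(k, ks). k # ks) ` ({..t} \<times> bounded_lists t r)"
    unfolding bounded_lists_def by (auto simp: length_Suc_conv image_iff)
  then have "(\<Sum>xs\<in>bounded_lists t (Suc r). g xs) = (\<Sum>(k, ks)\<in>{..t} \<times> bounded_lists t r. g (k # ks))"
    by (simp add: sum.reindex inj_on_def case_prod_beta)
  then show ?thesis by (simp add: sum.cartesian_product)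
qed

lemma lookup_mult_degree_le:
  fixes p q :: "('v, 'k::field) mpoly"
  assumes "\<forall>a\<in>keys p. total_degree V a \<le> x" "\<forall>a\<in>keys q. total_degree V a \<le> y"
  shows "\<forall>a\<in>keys (p * q). total_degree V a \<le> x + y"
proof
  fix a assume "a \<in> keys (p * q)"
  then obtain b c where "a = b + c" "b \<in> keys p" "c \<in> keys q" using keys_mult[of p q] by blast
  then show "total_degree V a \<le> x + y" using assms by (simp add: add_mono)
qed

lemma keys_power_degree_le:
  fixes p :: "('v, 'k::field) mpoly"
  assumes "\<forall>a\<in>keys p. total_degree V a \<le> x"
  shows "\<forall>a\<in>keys (p ^ k). total_degree V a \<le> k * x"
proof (induction k)
  case (Suc k)
  show ?case using lookup_mult_degree_le[OF assms Suc] by simp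
qed simp

context exponent_monoid begin

text \<open>Elements separating successive primes of a chain are algebraically independent, and there
  are too few polynomials of bounded degree to accommodate more than \<open>card V\<close> of them.\<close>

lemma chain_monomials_independent:
  fixes P :: "nat \<Rightarrow> ('v, 'k::field) mpoly set"
  assumes prime: "\<And>i. i \<le> d \<Longrightarrow> primeideal (P i) (type_subring (monoid_algebra M))"
    and sub: "\<And>i. i < d \<Longrightarrow> P i \<subseteq> P (Suc i)"
    and f: "\<And>i. i < d \<Longrightarrow> f i \<in> P (Suc i)" "\<And>i. i < d \<Longrightarrow> f i \<notin> P i"
  shows "r \<le> d \<Longrightarrow> (\<Sum>xs\<in>bounded_lists t r. mconst (u xs) * chain_monomial f d xs) \<in> P (d - r)
     \<Longrightarrow> xs \<in> bounded_lists t r \<Longrightarrow> u xs = 0"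
proof (induction r arbitrary: u xs)
  note P = primeideal_iff[THEN iffD1, OF prime]
  have const: "mconst c \<in> (monoid_algebra M :: ('v, 'k) mpoly set)" for c
    using zero_M by (simp add: monoid_algebra_def mconst_def)
  have fM: "f i \<in> monoid_algebra M" if "i < d" for i
    using P[of "Suc i"] f(1)[OF that] that by (auto simp: ideal_iff)
  have pow_closed: "x \<in> monoid_algebra M \<Longrightarrow> x ^ k \<in> monoid_algebra M" for x :: "('v, 'k) mpoly" and k
    by (induction k) (simp_all add: one_closed mult_closed)
  have sum_closed: "(\<And>x. x \<in> B \<Longrightarrow> g x \<in> monoid_algebra M) \<Longrightarrow> sum g B \<in> monoid_algebra M"
    for g :: "'b \<Rightarrow> ('v, 'k) mpoly" and B
    by (induction B rule: infinite_finite_induct) (auto simp: zero_closed add_closed)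
  have monM: "length xs \<le> d \<Longrightarrow> chain_monomial f d xs \<in> monoid_algebra M" for xs
    by (induction xs) (auto simp: one_closed intro!: mult_closed pow_closed fM)
  {
    case 0
    have xs: "xs = []" using 0 by simp
    have *: "mconst (u []) \<in> P d" using 0 by simp
    show ?case
    proof (rule ccontr)
      assume "u xs \<noteq> 0"
      have "mconst (inverse (u [])) * mconst (u []) \<in> P d"
        using P[of d] * const by (auto simp: ideal_iff)
      moreover have "mconst (inverse (u [])) * mconst (u []) = (1 :: ('v, 'k) mpoly)"
        using \<open>u xs \<noteq> 0\<close> xs by (simp add: mconst_def mult_single)
      ultimately show False using P[of d] by simp
    qed
  next
    case (Suc r)
    define j where "j = d - Suc r"
    have j: "j < d" "Suc j = d - r" using Suc.prems(1) unfolding j_def by auto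
    define F where "F = f j"
    define g where "g k = (\<Sum>ks\<in>bounded_lists t r. mconst (u (k # ks)) * chain_monomial f d ks)" for k
    have FM: "F \<in> monoid_algebra M" unfolding F_def by (rule fM[OF j(1)])
    have gM: "g k \<in> monoid_algebra M" for k
      unfolding g_def using Suc.prems(1)
      by (intro sum_closed mult_closed const monM) (auto simp: bounded_lists_def)
    have "(\<Sum>xs\<in>bounded_lists t (Suc r). mconst (u xs) * chain_monomial f d xs)
        = (\<Sum>k\<le>t. \<Sum>ks\<in>bounded_lists t r. F ^ k * (mconst (u (k # ks)) * chain_monomial f d ks))"
      unfolding sum_bounded_lists_Suc F_def j_def by (intro sum.cong) (auto simp: bounded_lists_def)
    also have "\<dots> = (\<Sum>k\<le>t. F ^ k * g k)" unfolding g_def sum_distrib_left ..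
    finally have sum: "(\<Sum>k\<le>t. F ^ k * g k) \<in> P j" using Suc.prems(2) unfolding j_def by simp
    \<comment> \<open>With the coefficients below \<open>k\<close> gone, the relation becomes
      \<open>F ^ k * (g k + F * h)\<close> in \<open>P j\<close>. As \<open>F\<close> is outside the
      prime \<open>P j\<close>, the second factor lies in \<open>P j\<close> and so in
      \<open>P (Suc j)\<close>, which contains \<open>F\<close>. Hence \<open>g k\<close> lies in
      \<open>P (Suc j)\<close>, and the induction hypothesis for shorter lists kills its
      coefficients.\<close>
    have zero: "k \<le> t \<Longrightarrow> ks \<in> bounded_lists t r \<Longrightarrow> u (k # ks) = 0" for k ks
    proof (induction k arbitrary: ks rule: less_induct)
      case (less k)
      define h where "h = (\<Sum>i\<in>{Suc k..t}. F ^ (i - Suc k) * g i)"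
      have hM: "h \<in> monoid_algebra M" unfolding h_def by (intro sum_closed mult_closed pow_closed FM gM)
      have "g i = 0" if "i < k" for i
        unfolding g_def using less that by (intro sum.neutral) (auto simp: mconst_def)
      then have "(\<Sum>i<k. F ^ i * g i) = 0" by (intro sum.neutral) auto
      moreover have "(\<Sum>i\<le>t. F ^ i * g i) = (\<Sum>i<k. F ^ i * g i) + (\<Sum>i\<in>{k..t}. F ^ i * g i)"
        using less.prems(1) by (subst sum.union_disjoint[symmetric]) (auto intro!: sum.cong)
      ultimately have "(\<Sum>i\<le>t. F ^ i * g i) = (\<Sum>i\<in>{k..t}. F ^ i * g i)" by simp
      also have "\<dots> = F ^ k * g k + (\<Sum>i\<in>{Suc k..t}. F ^ i * g i)"
        using less.prems(1) by (simp add: sum.atLeast_Suc_atMost)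
      also have "(\<Sum>i\<in>{Suc k..t}. F ^ i * g i) = F ^ k * (F * h)"
        unfolding h_def sum_distrib_left
      proof (intro sum.cong refl)
        fix i assume "i \<in> {Suc k..t}"
        then have "F ^ i = F ^ k * (F * F ^ (i - Suc k))" by (simp flip: power_add power_Suc)
        then show "F ^ i * g i = F ^ k * (F * (F ^ (i - Suc k) * g i))" by (simp add: mult.assoc)
      qed
      also have "F ^ k * g k + F ^ k * (F * h) = F ^ k * (g k + F * h)" by (simp add: distrib_left)
      finally have in_P: "F ^ k * (g k + F * h) \<in> P j" using sum by simp
      have "F ^ i \<notin> P j" for i
        by (induction i) (use P[of j] j f(2)[OF j(1)] FM pow_closed in \<open>auto simp: F_def\<close>)
      moreover have "\<And>x y. x \<in> monoid_algebra M \<Longrightarrow> y \<in> monoid_algebra M \<Longrightarrow> x * y \<in> P j \<Longrightarrow> x \<in> P j \<or> y \<in> P j"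
        using P[of j] j(1) by simp
      ultimately have "g k + F * h \<in> P j"
        using in_P pow_closed[OF FM] add_closed[OF gM mult_closed[OF FM hM]] by blast
      then have 1: "g k + F * h \<in> P (Suc j)" using sub[OF j(1)] by blast
      have Pj: "ideal (P (Suc j)) (type_subring (monoid_algebra M))" using P[of "Suc j"] j(1) by simp
      have "h * F \<in> P (Suc j)" using f(1)[OF j(1)] hM Pj unfolding F_def by (auto simp: ideal_iff)
      then have "- 1 * (h * F) \<in> P (Suc j)"
        using Pj uminus_closed[OF one_closed] by (auto simp: ideal_iff simp del: mult_minus1)
      with 1 have "g k + F * h + - 1 * (h * F) \<in> P (Suc j)" using Pj by (simp only: ideal_iff)
      then have "g k \<in> P (d - r)" unfolding j(2) by (simp add: mult.commute)
      then show "u (k # ks) = 0"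
        using Suc.IH[of "\<lambda>ks. u (k # ks)" ks] Suc.prems(1) less.prems(2) unfolding g_def by simp
    qed
    obtain k ks where "xs = k # ks" "k \<le> t" "ks \<in> bounded_lists t r"
      using Suc.prems(3) unfolding bounded_lists_def by (cases xs) auto
    then show ?case using zero by simp
  }
qed

lemma prime_chain_length_le:
  fixes P :: "nat \<Rightarrow> ('v, 'k::field) mpoly set"
  assumes "\<forall>i\<le>d. primeideal (P i) (type_subring (monoid_algebra M))" "\<forall>i<d. P i \<subset> P (Suc i)"
  shows "d \<le> card V"
proof (rule ccontr)
  assume "\<not> d \<le> card V"
  then have d: "card V < d" by simp
  have "\<forall>i. \<exists>x. i < d \<longrightarrow> x \<in> P (Suc i) \<and> x \<notin> P i" using assms(2) by blast
  from choice[OF this] obtain f where f: "\<And>i. i < d \<Longrightarrow> f i \<in> P (Suc i)" "\<And>i. i < d \<Longrightarrow> f i \<notin> P i"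
    by blast
  have PM: "P i \<subseteq> monoid_algebra M" if "i \<le> d" for i
    using assms(1) that by (simp add: primeideal_iff ideal_iff)
  \<comment> \<open>A common degree bound for the separating elements: products in which each of
    them occurs at most \<open>t\<close> times have degree at most \<open>s * d * t\<close>.\<close>
  define s where "s = Max (insert 0 (\<Union>i<d. total_degree V ` keys (f i)))"
  have s: "\<forall>a\<in>keys (f i). total_degree V a \<le> s" if "i < d" for i
    unfolding s_def using that by (intro ballI Max_ge) auto
  have key_deg: "length xs \<le> d \<Longrightarrow> \<forall>a\<in>keys (chain_monomial f d xs). total_degree V a \<le> s * sum_list xs" for xs
  proof (induction xs)
    case (Cons k ks)
    have "\<forall>a\<in>keys (f (d - Suc (length ks)) ^ k). total_degree V a \<le> k * s"
      using Cons.prems by (intro keys_power_degree_le s) auto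
    from lookup_mult_degree_le[OF this Cons.IH] Cons.prems show ?case by (simp add: algebra_simps)
  qed simp
  have key_exp: "length xs \<le> d \<Longrightarrow> chain_monomial f d xs \<in> monoid_algebra M" for xs
  proof (induction xs)
    case (Cons k ks)
    have fi: "f (d - Suc (length ks)) \<in> monoid_algebra M" 
    proof -
      have "d - Suc (length ks) < d" using Cons.prems by simp
      then show ?thesis using f(1) PM[of "Suc (d - Suc (length ks))"] by auto
    qed
    have "f (d - Suc (length ks)) ^ k \<in> monoid_algebra M"
      by (induction k) (simp_all add: one_closed mult_closed fi)
    then show ?case using Cons by (simp add: mult_closed)
  qed (simp add: one_closed)
  \<comment> \<open>The left side counts independent products and the right side bounds the number
    of available monomials. The right side grows like \<open>t ^ card V\<close> at most, which is
    impossible for large \<open>t\<close> when \<open>card V < d\<close>.\<close>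
  have le: "(t + 1) ^ d \<le> (s * d * t + 1) ^ card V" for t
  proof -
    let ?A = "{a \<in> exponents V. total_degree V a \<le> s * d * t}"
    have "card (bounded_lists t d) \<le> card ?A"
    proof (rule card_independent_family_le[where b = "chain_monomial f d"])
      show "finite (bounded_lists t d)" by (rule finite_bounded_lists)
      show "finite ?A" by (rule finite_exponents_degree_le[OF finite_V])
      fix xs assume xs: "xs \<in> bounded_lists t d"
      have "set ys \<subseteq> {..t} \<Longrightarrow> sum_list ys \<le> length ys * t" for ys by (induction ys) auto
      from this[of xs] have "sum_list xs \<le> d * t" "length xs \<le> d" using xs unfolding bounded_lists_def by auto
      then have le: "s * sum_list xs \<le> s * d * t" "length xs \<le> d" by (simp_all add: mult.assoc)
      show "keys (chain_monomial f d xs) \<subseteq> ?A"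
      proof
        fix a assume a: "a \<in> keys (chain_monomial f d xs)"
        then have "a \<in> exponents V" using key_exp[OF le(2)] M_sub unfolding monoid_algebra_def by blast
        moreover have "total_degree V a \<le> s * sum_list xs" using key_deg[OF le(2)] a by blast
        ultimately show "a \<in> ?A" using order_trans[OF _ le(1)] by blast
      qed
    next
      fix u xs assume "(\<Sum>xs\<in>bounded_lists t d. mconst (u xs) * chain_monomial f d xs) = 0" "xs \<in> bounded_lists t d"
      moreover have "0 \<in> P 0" using assms(1) by (simp add: primeideal_iff ideal_iff)
      ultimately show "u xs = 0"
        using chain_monomials_independent[where d = d and P = P and f = f and r = d and t = t and u = u and xs = xs] assms f by auto
    qed
    also have "\<dots> \<le> (s * d * t + 1) ^ card V" by (rule card_exponents_degree_le[OF finite_V])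
    finally show ?thesis by (simp add: card_bounded_lists)
  qed
  have "\<forall>\<^sub>F t in sequentially. real ((s * d * t + 1) ^ card V) / real t ^ d < 1"
    using linear_power_over_power_tendsto_0[OF d] by (rule order_tendstoD) simp
  then have "\<forall>\<^sub>F t in sequentially. real ((s * d * t + 1) ^ card V) / real t ^ d < 1 \<and> t > 0"
    using eventually_gt_at_top[of 0] by (rule eventually_conj)
  then obtain t where t: "real ((s * d * t + 1) ^ card V) / real t ^ d < 1" "t > 0"
    by (metis (mono_tags, lifting) eventually_happens' sequentially_bot)
  have "real ((s * d * t + 1) ^ card V) < real (t ^ d)" using t by (simp add: divide_less_eq)
  then have "(s * d * t + 1) ^ card V < t ^ d" by (simp only: of_nat_less_iff)
  also have "\<dots> \<le> (t + 1) ^ d" by (intro power_mono) auto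
  finally show False using le[of t] by simp
qed

end

section \<open>A chain of primes of full length in a monoid algebra\<close>

definition monomial_map :: "(('v \<Rightarrow>\<^sub>0 nat) \<Rightarrow> ('v \<Rightarrow>\<^sub>0 nat)) \<Rightarrow> ('v, 'k::field) mpoly \<Rightarrow> ('v, 'k) mpoly" where
  "monomial_map \<rho> p = (\<Sum>a\<in>keys p. single (\<rho> a) (lookup p a))"

lemma monomial_map_superset:
  assumes "finite A" "keys p \<subseteq> A"
  shows "monomial_map \<rho> p = (\<Sum>a\<in>A. single (\<rho> a) (lookup p a))"
  unfolding monomial_map_def using assms by (intro sum.mono_neutral_left) (auto simp: in_keys_iff)

lemma monomial_map_add: "monomial_map \<rho> (p + q) = monomial_map \<rho> p + monomial_map \<rho> q"
proof -
  let ?A = "keys p \<union> keys q"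
  have "monomial_map \<rho> (p + q) = (\<Sum>a\<in>?A. single (\<rho> a) (lookup (p + q) a))"
    using keys_add[of p q] by (intro monomial_map_superset) auto
  also have "\<dots> = (\<Sum>a\<in>?A. single (\<rho> a) (lookup p a))
      + (\<Sum>a\<in>?A. single (\<rho> a) (lookup q a))"
    by (simp add: lookup_add single_add sum.distrib)
  also have "\<dots> = monomial_map \<rho> p + monomial_map \<rho> q"
    by (intro arg_cong2[of _ _ _ _ "(+)"] monomial_map_superset[symmetric]) auto
  finally show ?thesis .
qed

lemma monomial_map_0 [simp]: "monomial_map \<rho> 0 = 0"
  by (simp add: monomial_map_def)

lemma monomial_map_sum: "monomial_map \<rho> (sum g A) = (\<Sum>x\<in>A. monomial_map \<rho> (g x))"
  by (induction A rule: infinite_finite_induct) (simp_all add: monomial_map_add)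

lemma monomial_map_single [simp]: "monomial_map \<rho> (single a c) = single (\<rho> a) c"
  by (cases "c = 0") (simp_all add: monomial_map_def)

lemma monomial_map_mult:
  assumes "\<And>a b. \<rho> (a + b) = \<rho> a + \<rho> b"
  shows "monomial_map \<rho> (p * q) = monomial_map \<rho> p * monomial_map \<rho> q"
proof -
  let ?p = "\<lambda>a. single a (lookup p a)" and ?q = "\<lambda>a. single a (lookup q a)"
  have "p * q = (\<Sum>a\<in>keys p. ?p a) * (\<Sum>b\<in>keys q. ?q b)"
    using mpoly_eq_sum_monomials[OF finite_keys order_refl, of p] mpoly_eq_sum_monomials[OF finite_keys order_refl, of q] by simp
  also have "\<dots> = (\<Sum>a\<in>keys p. \<Sum>b\<in>keys q. ?p a * ?q b)"
    by (rule sum_product)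
  finally show ?thesis
    unfolding monomial_map_def[of \<rho> p] monomial_map_def[of \<rho> q] sum_product
    by (simp add: monomial_map_sum mult_single assms)
qed

lemma monomial_map_comp: "monomial_map \<sigma> (monomial_map \<rho> p) = monomial_map (\<sigma> \<circ> \<rho>) p"
  unfolding monomial_map_def[of \<rho> p] monomial_map_def[of "\<sigma> \<circ> \<rho>" p] by (simp add: monomial_map_sum)

text \<open>On polynomials, \<open>monomial_map (forget T)\<close> is the substitution of 1 for the
  variables in \<open>T\<close>.\<close>

definition forget :: "'v set \<Rightarrow> ('v \<Rightarrow>\<^sub>0 nat) \<Rightarrow> ('v \<Rightarrow>\<^sub>0 nat)" where
  "forget T a = Poly_Mapping.mapp (\<lambda>v c. if v \<in> T then 0 else c) a"

lemma lookup_forget: "lookup (forget T a) v = (if v \<in> T then 0 else lookup a v)"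
  unfolding forget_def by (auto simp: lookup_mapp when_def in_keys_iff)

lemma forget_add: "forget T (a + b) = forget T a + forget T b"
  by (intro poly_mapping_eqI) (simp add: lookup_forget lookup_add)

context exponent_monoid begin

text \<open>The kernels of substituting 1 for more and more variables are primes, since the target
  is a domain. The step at \<open>v\<close> is strict because the binomial with exponents
  \<open>s2 = s1 + single v m\<close> and \<open>s1\<close> vanishes as soon as the variable
  \<open>v\<close> becomes 1, and not before. Substituting 1 works even if \<open>M\<close> contains
  no power of a single variable.\<close>

lemma krull_dim_monoid_algebra:
  assumes "m \<ge> 1" and lattice: "\<And>v. v \<in> V \<Longrightarrow> \<exists>s1\<in>M. \<exists>s2\<in>M. s2 = s1 + single v m"
  shows "krull_dim (type_subring (monoid_algebra M :: ('v, 'k::field) mpoly set)) = enat (card V)"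
proof -
  define K where "K T = {p \<in> (monoid_algebra M :: ('v, 'k) mpoly set). monomial_map (forget T) p = 0}" for T
  obtain vs where vs: "set vs = V" "distinct vs" using finite_distinct_list[OF finite_V] by blast
  have len: "length vs = card V" using vs distinct_card by metis
  have mult: "monomial_map (forget T) (p * q) = monomial_map (forget T) p * monomial_map (forget T) q" for T and p q :: "('v, 'k) mpoly"
    by (rule monomial_map_mult) (rule forget_add)
  have forget_0: "forget T 0 = (0 :: 'v \<Rightarrow>\<^sub>0 nat)" for T by (intro poly_mapping_eqI) (simp add: lookup_forget)
  have "monomial_map (forget T) (1 :: ('v, 'k) mpoly) = 1" for T
    by (metis forget_0 monomial_map_single single_one)
  then have prime: "primeideal (K T) (type_subring (monoid_algebra M))" for T
    unfolding primeideal_iff ideal_iff K_def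
    by (auto simp: mult monomial_map_add add_closed mult_closed zero_closed)
  have mono: "K T \<subseteq> K T'" if "T \<subseteq> T'" for T T'
  proof -
    have "forget T' \<circ> forget T = (forget T' :: ('v \<Rightarrow>\<^sub>0 nat) \<Rightarrow> _)"
      using that by (intro ext poly_mapping_eqI) (auto simp: lookup_forget)
    then have *: "monomial_map (forget T') p = monomial_map (forget T') (monomial_map (forget T) p)" for p :: "('v, 'k) mpoly"
      by (simp add: monomial_map_comp)
    show ?thesis
    proof
      fix p assume "p \<in> K T"
      then have p: "p \<in> monoid_algebra M" "monomial_map (forget T) p = 0" by (simp_all add: K_def)
      have "monomial_map (forget T') p = 0" by (subst *) (simp add: p)
      with p show "p \<in> K T'" by (simp add: K_def)
    qed
  qed
  have strict: "K (set (take i vs)) \<subset> K (set (take (Suc i) vs))" if i: "i < card V" for i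
  proof -
    let ?v = "vs ! i"
    have v: "?v \<in> V" using i len vs by (metis nth_mem)
    obtain s1 s2 where s: "s1 \<in> M" "s2 \<in> M" "s2 = s1 + single ?v m" using lattice[OF v] by blast
    define p :: "('v, 'k) mpoly" where "p = single s2 1 + single s1 (- 1)"
    have "p \<in> monoid_algebra M"
      unfolding p_def using s by (intro add_closed) (auto simp: monoid_algebra_def)
    have img: "monomial_map (forget T) p = single (forget T s2) 1 + single (forget T s1) (- 1)" for T
      unfolding p_def by (simp add: monomial_map_add)
    have take: "set (take (Suc i) vs) = insert ?v (set (take i vs))"
      using i len by (simp add: take_Suc_conv_app_nth)
    have "forget (set (take (Suc i) vs)) s2 = forget (set (take (Suc i) vs)) s1"
      unfolding s(3) take by (intro poly_mapping_eqI) (auto simp: lookup_forget lookup_add lookup_single when_def)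
    then have "p \<in> K (set (take (Suc i) vs))"
      using \<open>p \<in> _\<close> by (simp add: K_def img flip: single_add)
    moreover have "?v \<notin> set (take i vs)"
      using vs(2) i len by (metis distinct_take not_distinct_conv_prefix take_Suc_conv_app_nth)
    then have "lookup (forget (set (take i vs)) s2) ?v \<noteq> lookup (forget (set (take i vs)) s1) ?v"
      unfolding s(3) using assms(1) by (simp add: lookup_forget lookup_add)
    then have ne: "forget (set (take i vs)) s2 \<noteq> forget (set (take i vs)) s1" by metis
    have "lookup (monomial_map (forget (set (take i vs))) p) (forget (set (take i vs)) s2) = 1"
      unfolding img using ne by (simp add: lookup_add lookup_single)
    then have "p \<notin> K (set (take i vs))" unfolding K_def by auto
    ultimately show ?thesis using mono[of "set (take i vs)" "set (take (Suc i) vs)"] take by blast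
  qed
  show ?thesis
  proof (rule krull_dim_eqI[of _ "\<lambda>i. K (set (take i vs))"])
    show "\<forall>i\<le>card V. primeideal (K (set (take i vs))) (type_subring (monoid_algebra M))" using prime by blast
    show "\<forall>i<card V. K (set (take i vs)) \<subset> K (set (take (Suc i) vs))" using strict by blast
  qed (rule prime_chain_length_le)
qed

end

subsection \<open>The edge subring\<close>

lemma edge_monomial_eq: "edge_monomial e = single (edge_exponent e) 1"
  unfolding edge_monomial_def edge_exponent_def mvar_def
  by (induction e rule: infinite_finite_induct) (simp_all add: mult_single)

lemma mpoly_ring_eq: "mpoly_ring V = type_subring (monoid_algebra (exponents V))"
  unfolding mpoly_ring_def monoid_algebra_def exponents_def by (auto intro!: arg_cong[where f = "\<lambda>C. ring_of_type_algebra\<lparr>carrier := C\<rparr>"])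

lemma exponent_monoid_exponents: "finite V \<Longrightarrow> exponent_monoid V (exponents V)"
  by unfold_locales auto

lemma prod_list_monomials:
  "prod_list (map (\<lambda>e. single (g e) (1 :: 'k::field)) es) = single (sum_list (map g es)) 1"
  for g :: "'e \<Rightarrow> ('v \<Rightarrow>\<^sub>0 nat)"
  by (induction es) (simp_all add: mult_single)

lemma edge_subring_component_eq:
  "edge_subring_component E t = mpoly.span ((\<lambda>a. single a 1) ` sumset E t)"
proof -
  have "{prod_list (map edge_monomial es) |es. set es \<subseteq> E \<and> length es = t}
      = (\<lambda>a. single a (1 :: 'b)) ` sumset E t" (is "?L = ?R")
  proof
    show "?L \<subseteq> ?R"
    proof safe
      fix es :: "'a set list" assume "set es \<subseteq> E" "t = length es"
      then have "sum_list (map edge_exponent es) \<in> sumset E t"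
        unfolding sumset_def by (intro nfold_sumsI[of "mset es"]) (auto simp: sum_mset_sum_list[symmetric])
      then show "prod_list (map edge_monomial es) \<in> (\<lambda>a. single a (1 :: 'b)) ` sumset E (length es)"
        using \<open>t = length es\<close> by (simp add: edge_monomial_eq[abs_def] prod_list_monomials)
    qed
    show "?R \<subseteq> ?L"
    proof safe
      fix a assume "a \<in> sumset E t"
      then obtain M where M: "set_mset M \<subseteq> E" "size M = t" "a = (\<Sum>e\<in>#M. edge_exponent e)"
        unfolding sumset_def by (rule nfold_sumsE)
      obtain es where "mset es = M" using ex_mset by blast
      with M show "\<exists>es. single a (1 :: 'b) = prod_list (map edge_monomial es) \<and> set es \<subseteq> E \<and> length es = t"
        by (intro exI[of _ es]) (auto simp: edge_monomial_eq[abs_def] prod_list_monomials sum_mset_sum_list[symmetric])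
    qed
  qed
  then show ?thesis unfolding edge_subring_component_def by simp
qed

lemma mpoly_dim_edge_subring_component:
  assumes "finite E"
  shows "mpoly_dim (edge_subring_component E t :: ('v, 'k::field) mpoly set) = card (sumset E t)"
proof -
  let ?b = "\<lambda>a. single a 1 :: ('v, 'k) mpoly"
  have inj: "inj_on ?b (sumset E t)" by (rule inj_onI) (metis keys_single singleton_inject zero_neq_one)
  have fin: "finite (sumset E t)" unfolding sumset_def by (rule finite_nfold_sums[OF assms])
  have "mpoly.independent (?b ` sumset E t)"
  proof (subst mpoly.dependent_finite)
    show "\<not> (\<exists>u. (\<exists>v\<in>?b ` sumset E t. u v \<noteq> 0) \<and> (\<Sum>v\<in>?b ` sumset E t. mconst (u v) * v) = 0)"
    proof
      assume "\<exists>u. (\<exists>v\<in>?b ` sumset E t. u v \<noteq> 0) \<and> (\<Sum>v\<in>?b ` sumset E t. mconst (u v) * v) = 0"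
      then obtain u a where u: "a \<in> sumset E t" "u (?b a) \<noteq> 0" "(\<Sum>v\<in>?b ` sumset E t. mconst (u v) * v) = 0" by blast
      have "(\<Sum>a\<in>sumset E t. single a (u (?b a))) = 0"
        using u(3) inj by (simp add: sum.reindex mconst_mult_monomial)
      then have "0 = lookup (\<Sum>c\<in>sumset E t. single c (u (?b c))) a" by simp
      also have "\<dots> = (\<Sum>c\<in>sumset E t. if c = a then u (?b c) else 0)"
        unfolding lookup_sum by (intro sum.cong) (auto simp: lookup_single when_def)
      also have "\<dots> = u (?b a)" using u(1) fin by simp
      finally show False using u(2) by simp
    qed
  qed (use fin in simp)
  then have "mpoly_dim (mpoly_span (?b ` sumset E t)) = card (?b ` sumset E t)"
    by (rule mpoly.dim_span_eq_card_independent)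
  then show ?thesis unfolding edge_subring_component_eq using inj by (simp add: card_image)
qed

lemma exponent_monoid_sumset:
  fixes V :: "'v::linorder set"
  assumes "edge_system V E m"
  shows "exponent_monoid V (\<Union>t. sumset E t)"
proof -
  interpret edge_system V E m by fact
  show ?thesis
  proof
    show "finite V" by (rule finite_V)
    show "(\<Union>t. sumset E t) \<subseteq> exponents V" using S_exponents by blast
    show "0 \<in> (\<Union>t. sumset E t)" using zero_in_sumset by blast
    show "a + b \<in> (\<Union>t. sumset E t)" if "a \<in> (\<Union>t. sumset E t)" "b \<in> (\<Union>t. sumset E t)" for a b
      using that sumset_add by blast
  qed
qed

text \<open>Brings the edge subring into the form for which the dimension has been computed.\<close>

lemma edge_subring_eq:
  fixes V :: "'v::linorder set"
  assumes "edge_system V E m"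
  shows "(edge_subring V E :: ('v, 'k::field) mpoly ring) = type_subring (monoid_algebra (\<Union>t. sumset E t))"
proof -
  interpret edge_system V E m by fact
  interpret A: exponent_monoid V "exponents V" by (rule exponent_monoid_exponents[OF finite_V])
  interpret B: exponent_monoid V "\<Union>t. sumset E t" by (rule exponent_monoid_sumset[OF assms])
  define G :: "('v, 'k) mpoly set" where
    "G = generate_ring (type_subring (monoid_algebra (exponents V))) (range mconst \<union> edge_monomial ` E)"
  let ?M = "monoid_algebra (\<Union>t. sumset E t) :: ('v, 'k) mpoly set"
  have sub: "?M \<subseteq> monoid_algebra (exponents V)"
    using B.M_sub unfolding monoid_algebra_def by blast
  have add: "x + y \<in> G" if "x \<in> G" "y \<in> G" for x y
    using generate_ring.eng_add[OF that[unfolded G_def]] unfolding G_def by simp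
  have mult: "x * y \<in> G" if "x \<in> G" "y \<in> G" for x y
    using generate_ring.eng_mult[OF that[unfolded G_def]] unfolding G_def by simp
  have const: "mconst c \<in> G" for c unfolding G_def by (intro generate_ring.incl) blast
  have mono: "single a 1 \<in> G" if "a \<in> sumset E t" for a t
    using that
  proof (induction t arbitrary: a)
    case 0
    then show ?case using const[of 1] by (simp add: sumset_0 mconst_def)
  next
    case (Suc t)
    then obtain b e where b: "b \<in> sumset E t" "e \<in> E" "a = b + edge_exponent e" by (blast elim: sumset_SucE)
    have "edge_monomial e \<in> G" unfolding G_def using b(2) by (intro generate_ring.incl) blast
    then have "single b 1 * single (edge_exponent e) 1 \<in> G"
      using Suc.IH[OF b(1)] mult unfolding edge_monomial_eq by blast
    then show ?case unfolding b(3) by (simp add: mult_single)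
  qed
  have "G = ?M"
  proof
    show "G \<subseteq> ?M"
    proof
      fix p assume "p \<in> G"
      then show "p \<in> ?M"
        unfolding G_def
      proof (induction rule: generate_ring.induct)
        case one then show ?case using B.one_closed by simp
      next
        case (incl h)
        have "edge_exponent e \<in> (\<Union>t. sumset E t)" if "e \<in> E" for e
          using edge_exponent_in_sumset[OF that] by blast
        with incl B.zero_M show ?case
          by (auto simp: monoid_algebra_def mconst_def edge_monomial_eq simp del: UN_iff split: if_splits)
      next
        case (a_inv h)
        then show ?case using A.a_inv_eq[of h] B.uminus_closed[of h] sub by auto
      next
        case (eng_add h1 h2) then show ?case using B.add_closed by simp
      next
        case (eng_mult h1 h2) then show ?case using B.mult_closed by simp
      qed
    qed
    show "?M \<subseteq> G"
    proof
      fix p assume p: "p \<in> ?M"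
      have "(\<Sum>a\<in>K. mconst (lookup p a) * single a 1) \<in> G"
        if "finite K" "K \<subseteq> keys p" for K
        using that
      proof (induction K rule: finite_induct)
        case empty
        show ?case using const[of 0] by (simp add: mconst_def)
      next
        case (insert a K)
        then obtain t where "a \<in> sumset E t" using p unfolding monoid_algebra_def by auto
        then show ?case using insert by (simp add: add mult const mono)
      qed
      from this[OF finite_keys order_refl]
      show "p \<in> G"
        using mpoly_eq_sum_monomials[OF finite_keys order_refl, of p] by (simp add: mconst_mult_monomial)
    qed
  qed
  then show ?thesis unfolding edge_subring_def mpoly_ring_eq G_def by simp
qed

text \<open>Linkage supplies the differences \<open>single v m\<close> needed for dimension
  \<open>card V\<close>. The multiplicity is therefore normalized like the
  \<open>j\<close>-multiplicity, and since \<open>V\<close> is nonempty the branch for dimension 0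
  does not arise.\<close>

lemma edge_subring_multiplicity_eq:
  fixes V :: "'v::linorder set"
  assumes "edge_system V E m" and link: "\<And>i j. i \<in> V \<Longrightarrow> j \<in> V \<Longrightarrow> edge_system.linked E i j"
    and h: "(\<lambda>t. real (card (sumset E t)) / real t ^ (card V - 1)) \<longlonglongrightarrow> h"
  shows "edge_subring_multiplicity TYPE('k::field) V E = ereal (fact (card V - 1)) * ereal h"
proof -
  interpret edge_system V E m by fact
  interpret B: exponent_monoid V "\<Union>t. sumset E t" by (rule exponent_monoid_sumset[OF assms(1)])
  have "krull_dim (edge_subring V E :: ('v, 'k) mpoly ring) = enat (card V)"
    unfolding edge_subring_eq[OF assms(1)]
  proof (rule B.krull_dim_monoid_algebra[OF m_pos])
    fix v assume "v \<in> V"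
    then show "\<exists>s1\<in>\<Union>t. sumset E t. \<exists>s2\<in>\<Union>t. sumset E t. s2 = s1 + single v m"
      using linked_multiple[OF link] by blast
  qed
  moreover have "card V \<noteq> 0" using V_ne finite_V by simp
  moreover have "lim (\<lambda>t. ereal (real (mpoly_dim (edge_subring_component E t :: ('v, 'k) mpoly set)) / real t ^ (card V - 1))) = ereal h"
    unfolding mpoly_dim_edge_subring_component[OF finite_E] using h by (intro limI) simp
  ultimately show ?thesis
    unfolding edge_subring_multiplicity_def graded_multiplicity_def by (simp add: Let_def)
qed

subsection \<open>Monomial ideals of the local ring\<close>

text \<open>Only one pair of exponents contributes to the coefficient at \<open>a0 + c0\<close>. The
  case \<open>c0 = 0\<close> serves to cancel denominators, and monomial factors are the other
  typical case.\<close>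

lemma lookup_mult_unique:
  fixes p q :: "('v, 'k::field) mpoly"
  assumes "\<And>b c. b \<in> keys p \<Longrightarrow> c \<in> keys q \<Longrightarrow> b + c = a0 + c0 \<Longrightarrow> b = a0"
  shows "lookup (p * q) (a0 + c0) = lookup p a0 * lookup q c0"
proof -
  let ?x = "lookup p a0" and ?y = "lookup q c0"
  define p' where "p' = p - single a0 ?x"
  define q' where "q' = q - single c0 ?y"
  have p': "a0 \<notin> keys p'" "keys p' \<subseteq> keys p"
    unfolding p'_def by (auto simp: in_keys_iff lookup_minus lookup_single when_def split: if_splits)
  have q': "c0 \<notin> keys q'"
    unfolding q'_def by (auto simp: in_keys_iff lookup_minus)
  have "p * q = single (a0 + c0) (?x * ?y) + single a0 ?x * q' + p' * q"
    unfolding p'_def q'_def by (simp add: algebra_simps mult_single)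
  moreover have "a0 + c0 \<notin> keys (single a0 ?x * q')"
    using keys_mult[of "single a0 ?x" q'] q' by (auto split: if_splits)
  moreover have "a0 + c0 \<notin> keys (p' * q)"
  proof
    assume "a0 + c0 \<in> keys (p' * q)"
    then obtain b c where "a0 + c0 = b + c" "b \<in> keys p'" "c \<in> keys q"
      using keys_mult[of p' q] by blast
    then show False using assms[of b c] p' by auto
  qed
  ultimately show ?thesis by (simp add: lookup_add in_keys_iff)
qed

lemma lookup_mconst_mult:
  fixes p :: "('v, 'k::field) mpoly"
  shows "lookup (mconst c * p) a = c * lookup p a"
proof -
  have "b = 0" if "b \<in> keys (mconst c :: ('v, 'k) mpoly)" for b
    using that unfolding mconst_def by (simp split: if_splits)
  then have "lookup (mconst c * p) (0 + a) = lookup (mconst c :: ('v, 'k) mpoly) 0 * lookup p a"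
    by (intro lookup_mult_unique)
  then show ?thesis by (simp add: mconst_def)
qed

text \<open>A sum of exponents vanishes only if both summands do. Hence polynomials with nonzero
  constant term are closed under multiplication.\<close>

lemma lookup_mult_0: "lookup (p * q) 0 = lookup p 0 * lookup q 0"
  for p q :: "('v, 'k::field) mpoly"
proof -
  have "b = 0" if "b + c = 0" for b c :: "'v \<Rightarrow>\<^sub>0 nat"
  proof -
    have "keys b = {}" using that keys_plus_nat[of b c] by simp
    then show ?thesis by (intro poly_mapping_eqI) (auto simp: in_keys_iff)
  qed
  then show ?thesis using lookup_mult_unique[of p q 0 0] by simp
qed

text \<open>Such sets are the exponent sets of monomial ideals.\<close>

definition absorbing :: "'v set \<Rightarrow> ('v \<Rightarrow>\<^sub>0 nat) set \<Rightarrow> bool" where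
  "absorbing V B \<longleftrightarrow> B \<subseteq> exponents V \<and> (\<forall>b\<in>B. \<forall>c\<in>exponents V. b + c \<in> B)"

lemma absorbingD: "absorbing V B \<Longrightarrow> b \<in> B \<Longrightarrow> c \<in> exponents V \<Longrightarrow> b + c \<in> B"
  unfolding absorbing_def by blast

text \<open>By \<open>genideal_variables\<close> this is the complement of the prime at which
  \<open>local_poly_ring\<close> localizes.\<close>

definition denominators :: "'v set \<Rightarrow> ('v, 'k::field) mpoly set" where
  "denominators V = {g \<in> monoid_algebra (exponents V). lookup g 0 \<noteq> 0}"

text \<open>For absorbing \<open>B\<close>, the ideal of the local ring generated by the monomials with exponent
  in \<open>B\<close>.\<close>

definition local_ideal :: "'v::linorder set \<Rightarrow> ('v \<Rightarrow>\<^sub>0 nat) set \<Rightarrow> ('v, 'k::field) mpoly fract set" where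
  "local_ideal V B = {Fract f g | f g. f \<in> monoid_algebra B \<and> g \<in> denominators V}"

locale local_ring =
  fixes V :: "'v::linorder set"
  assumes finite_V: "finite V"
begin

sublocale A: exponent_monoid V "exponents V"
  by (rule exponent_monoid_exponents[OF finite_V])

abbreviation "Pol \<equiv> monoid_algebra (exponents V)"
abbreviation "xpow a \<equiv> Fract (single a 1) 1"

lemma denominator_ne_0: "g \<in> denominators V \<Longrightarrow> g \<noteq> 0"
  unfolding denominators_def by auto

lemma one_denominator: "1 \<in> denominators V"
  unfolding denominators_def by (simp add: A.one_closed)

lemma mult_denominator: "g \<in> denominators V \<Longrightarrow> h \<in> denominators V \<Longrightarrow> g * h \<in> denominators V"
  unfolding denominators_def by (simp add: lookup_mult_0 A.mult_closed)

lemma denominators_sub: "g \<in> denominators V \<Longrightarrow> g \<in> Pol"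
  unfolding denominators_def by simp

lemma local_idealI: "f \<in> monoid_algebra B \<Longrightarrow> g \<in> denominators V \<Longrightarrow> Fract f g \<in> local_ideal V B"
  unfolding local_ideal_def by blast

lemma local_idealE:
  assumes "x \<in> local_ideal V B"
  obtains f g where "x = Fract f g" "f \<in> monoid_algebra B" "g \<in> denominators V"
  using assms unfolding local_ideal_def by blast

lemma mult_monoid_algebra:
  assumes "p \<in> monoid_algebra B" "q \<in> monoid_algebra B'"
  shows "p * q \<in> monoid_algebra {b + c | b c. b \<in> B \<and> c \<in> B'}"
  using keys_mult[of p q] assms unfolding monoid_algebra_def by blast

lemma monoid_algebra_mono: "B \<subseteq> B' \<Longrightarrow> monoid_algebra B \<subseteq> monoid_algebra B'"
  unfolding monoid_algebra_def by blast

lemma absorbing_mult: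
  assumes "absorbing V B" "p \<in> monoid_algebra B" "q \<in> Pol"
  shows "p * q \<in> monoid_algebra B"
  using mult_monoid_algebra[OF assms(2,3)] monoid_algebra_mono[of "{b + c | b c. b \<in> B \<and> c \<in> exponents V}" B]
    absorbingD[OF assms(1)] by blast

lemma add_monoid_algebra: "p \<in> monoid_algebra B \<Longrightarrow> q \<in> monoid_algebra B \<Longrightarrow> p + q \<in> monoid_algebra B"
  using keys_add[of p q] unfolding monoid_algebra_def by blast

lemma uminus_monoid_algebra: "p \<in> monoid_algebra B \<Longrightarrow> - p \<in> monoid_algebra B"
  unfolding monoid_algebra_def by (simp add: in_keys_iff subset_iff)

text \<open>Multiplication by a denominator does not change an exponent of minimal degree outside \<open>B\<close>.\<close>

lemma monoid_algebra_cancel_denominator: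
  assumes B: "absorbing V B" and f: "f \<in> Pol" and g: "g \<in> denominators V"
    and fg: "f * g \<in> monoid_algebra B"
  shows "f \<in> monoid_algebra B"
proof (rule ccontr)
  assume "f \<notin> monoid_algebra B"
  then have "\<exists>a. a \<in> keys f - B" unfolding monoid_algebra_def by blast
  from ex_has_least_nat[of "\<lambda>a. a \<in> keys f - B" _ "total_degree V"] this
  obtain a where a: "a \<in> keys f - B"
    and min: "\<And>b. b \<in> keys f - B \<Longrightarrow> total_degree V a \<le> total_degree V b" by blast
  have "b = a" if b: "b \<in> keys f" and c: "c \<in> keys g" and eq: "b + c = a + 0" for b c
  proof -
    have cV: "c \<in> exponents V" using denominators_sub[OF g] c unfolding monoid_algebra_def by blast
    then have "b \<notin> B" using absorbingD[OF B, of b c] a eq by auto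
    then have "total_degree V a \<le> total_degree V b" using min b by blast
    moreover have "total_degree V a = total_degree V b + total_degree V c" using eq by (metis add.right_neutral total_degree_add)
    ultimately have "c = 0" using total_degree_eq_0_iff[OF finite_V cV] by simp
    then show ?thesis using eq by simp
  qed
  then have "lookup (f * g) (a + 0) = lookup f a * lookup g 0"
    by (rule lookup_mult_unique)
  also have "\<dots> \<noteq> 0" using a g unfolding denominators_def by (simp add: in_keys_iff)
  finally have "a \<in> keys (f * g)" by (simp add: in_keys_iff)
  then show False using fg a unfolding monoid_algebra_def by blast
qed

text \<open>Two representations of a fraction differ by denominators, and these can be cancelled
  modulo a monomial ideal. Membership can thus be tested on any numerator, so the localization hides
  no exponents.\<close>

lemma Fract_in_local_ideal_iff:
  assumes B: "absorbing V B" and f: "f \<in> Pol" and g: "g \<in> denominators V"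
  shows "Fract f g \<in> local_ideal V B \<longleftrightarrow> f \<in> monoid_algebra B"
proof
  assume "Fract f g \<in> local_ideal V B"
  then obtain f' g' where *: "Fract f g = Fract f' g'" "f' \<in> monoid_algebra B" "g' \<in> denominators V"
    by (rule local_idealE)
  then have "f * g' = f' * g" using g denominator_ne_0 by (metis eq_fract(1))
  also have "\<dots> \<in> monoid_algebra B" using absorbing_mult[OF B *(2) denominators_sub[OF g]] .
  finally show "f \<in> monoid_algebra B" using monoid_algebra_cancel_denominator[OF B f *(3)] by blast
qed (rule local_idealI[OF _ g])

abbreviation "R \<equiv> local_ideal V (exponents V)"

sublocale R: closed_subring "local_ideal V (exponents V) :: ('v, 'k::field) mpoly fract set"
proof
  show "1 \<in> (R :: ('v, 'k) mpoly fract set)"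
    unfolding One_fract_def by (intro local_idealI one_denominator A.one_closed)
next
  fix x :: "('v, 'k) mpoly fract" assume "x \<in> R"
  then show "- x \<in> R" by (elim local_idealE) (auto intro: local_idealI A.uminus_closed)
  fix y :: "('v, 'k) mpoly fract" assume "y \<in> R"
  with \<open>x \<in> R\<close> show "x + y \<in> R"
    by (elim local_idealE)
      (auto simp: denominator_ne_0 intro: denominators_sub intro!: local_idealI mult_denominator A.add_closed A.mult_closed)
  from \<open>x \<in> R\<close> \<open>y \<in> R\<close> show "x * y \<in> R"
    by (elim local_idealE) (auto intro!: local_idealI mult_denominator A.mult_closed)
qed

lemma single_ne_0: "single v (Suc n) \<noteq> 0"
  by (metis keys_single keys_zero insert_not_empty old.nat.distinct(2))

lemma genideal_variables:
  "genideal (mpoly_ring V) (mvar ` V) = {f \<in> Pol. lookup f 0 = (0 :: 'k::field)}"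
  (is "_ = ?P")
proof
  have ring: "ring (mpoly_ring V :: ('v, 'k) mpoly ring)" unfolding mpoly_ring_eq by (rule A.ring)
  have sub: "mvar ` V \<subseteq> carrier (mpoly_ring V :: ('v, 'k) mpoly ring)"
    unfolding mpoly_ring_eq by (auto simp: mvar_def monoid_algebra_def)
  have "ideal ?P (mpoly_ring V)"
    unfolding mpoly_ring_eq A.ideal_iff by (auto simp: A.add_closed A.zero_closed A.mult_closed lookup_add lookup_mult_0)
  moreover have "mvar ` V \<subseteq> ?P"
    using sub unfolding mpoly_ring_eq by (auto simp: mvar_def lookup_single when_def single_ne_0)
  ultimately show "genideal (mpoly_ring V) (mvar ` V) \<subseteq> ?P"
    by (rule ring.genideal_minimal[OF ring])
  define I where "I = genideal (mpoly_ring V) (mvar ` V :: ('v, 'k) mpoly set)"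
  have "ideal I (mpoly_ring V)" unfolding I_def using sub by (rule ring.genideal_ideal[OF ring])
  then have I: "0 \<in> I" "\<And>x y. x \<in> I \<Longrightarrow> y \<in> I \<Longrightarrow> x + y \<in> I" "\<And>c x. c \<in> Pol \<Longrightarrow> x \<in> I \<Longrightarrow> c * x \<in> I"
    unfolding mpoly_ring_eq A.ideal_iff by auto
  have sum: "(\<And>x. x \<in> K \<Longrightarrow> g x \<in> I) \<Longrightarrow> sum g K \<in> I" for g :: "('v \<Rightarrow>\<^sub>0 nat) \<Rightarrow> _" and K
    by (induction K rule: infinite_finite_induct) (auto simp: I)
  show "?P \<subseteq> I"
  proof
    fix f assume f: "f \<in> ?P"
    have "single a (lookup f a) \<in> I" if a: "a \<in> keys f" for a
    proof -
      have aV: "a \<in> exponents V" using a f unfolding monoid_algebra_def by blast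
      have "a \<noteq> 0" using f a by (auto simp: in_keys_iff)
      then have "total_degree V a > 0" using total_degree_eq_0_iff[OF finite_V aV] by simp
      then obtain v b where v: "v \<in> V" "b \<in> exponents V" "a = b + single v 1"
        using exponents_split_single[OF finite_V aV] by metis
      have "mvar v \<in> I" unfolding I_def using ring.genideal_self[OF ring sub] v(1) by blast
      then have "single b (lookup f a) * mvar v \<in> I"
        using v(2) by (intro I(3)) (auto simp: monoid_algebra_def)
      then show ?thesis unfolding mvar_def mult_single v(3) by simp
    qed
    then show "f \<in> I" by (subst mpoly_eq_sum_monomials[OF finite_keys order_refl]) (rule sum)
  qed
qed

lemma local_poly_ring_eq: "(local_poly_ring V :: ('v, 'k::field) mpoly fract ring) = type_subring R"
proof -
  have "{Fract f g |f g. f \<in> carrier (mpoly_ring V) \<and> g \<in> carrier (mpoly_ring V) - genideal (mpoly_ring V) (mvar ` V)}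
      = (R :: ('v, 'k) mpoly fract set)"
    unfolding genideal_variables local_ideal_def denominators_def unfolding mpoly_ring_eq by auto
  then show ?thesis unfolding local_poly_ring_def localization_def by simp
qed

lemma local_ideal_ideal:
  assumes "absorbing V B"
  shows "ideal (local_ideal V B :: ('v, 'k::field) mpoly fract set) (type_subring R)"
  unfolding R.ideal_iff
proof (intro conjI ballI)
  have "B \<subseteq> exponents V" using assms unfolding absorbing_def by blast
  then show "local_ideal V B \<subseteq> R" unfolding local_ideal_def monoid_algebra_def by blast
  show "0 \<in> local_ideal V B" unfolding Zero_fract_def
    by (intro local_idealI one_denominator) (simp add: monoid_algebra_def)
  fix x assume x: "x \<in> (local_ideal V B :: ('v, 'k) mpoly fract set)"
  {
    fix y assume "y \<in> (local_ideal V B :: ('v, 'k) mpoly fract set)"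
    with x show "x + y \<in> local_ideal V B"
      by (elim local_idealE)
        (auto simp: denominator_ne_0 intro!: local_idealI mult_denominator add_monoid_algebra absorbing_mult[OF assms] denominators_sub)
  }
  fix c assume "c \<in> (R :: ('v, 'k) mpoly fract set)"
  with x show "c * x \<in> local_ideal V B"
    by (subst mult.commute, elim local_idealE) (auto intro!: local_idealI mult_denominator absorbing_mult[OF assms])
qed

lemma xpow_in_local_ideal: "a \<in> B \<Longrightarrow> xpow a \<in> local_ideal V B"
  by (intro local_idealI one_denominator) (auto simp: monoid_algebra_def)

lemma xpow_in_local_ideal_iff:
  "absorbing V B \<Longrightarrow> a \<in> exponents V \<Longrightarrow> (xpow a :: ('v, 'k::field) mpoly fract) \<in> local_ideal V B \<longleftrightarrow> a \<in> B"
  by (subst Fract_in_local_ideal_iff) (auto simp: one_denominator monoid_algebra_def)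

lemma xpow_add: "xpow (a + b) = xpow a * (xpow b :: ('v, 'k::field) mpoly fract)"
  by (simp add: mult_single)

lemma Fract_in_local_ring: "f \<in> Pol \<Longrightarrow> Fract f 1 \<in> R"
  by (intro local_idealI one_denominator)

lemma Fract_inverse_in_local_ring: "g \<in> denominators V \<Longrightarrow> Fract 1 g \<in> R"
  by (intro local_idealI A.one_closed)

lemma local_ideal_subset:
  fixes I :: "('v, 'k::field) mpoly fract set"
  assumes I: "ideal I (type_subring R)" and "B \<subseteq> exponents V" and B: "\<And>a. a \<in> B \<Longrightarrow> xpow a \<in> I"
  shows "local_ideal V B \<subseteq> I"
proof
  fix x :: "('v, 'k) mpoly fract" assume "x \<in> local_ideal V B"
  then obtain f g where x: "x = Fract f g" "f \<in> monoid_algebra B" "g \<in> denominators V" by (rule local_idealE)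
  have I': "0 \<in> I" "\<And>x y. x \<in> I \<Longrightarrow> y \<in> I \<Longrightarrow> x + y \<in> I" "\<And>c x. c \<in> R \<Longrightarrow> x \<in> I \<Longrightarrow> c * x \<in> I"
    using I unfolding R.ideal_iff by auto
  have mono: "Fract (single a c) 1 \<in> I" if "a \<in> B" for a and c :: 'k
  proof -
    have "Fract (mconst c) 1 \<in> (R :: ('v, 'k) mpoly fract set)"
      by (intro Fract_in_local_ring) (simp add: monoid_algebra_def mconst_def)
    then have "Fract (mconst c) 1 * xpow a \<in> I" using B[OF that] by (rule I'(3))
    then show ?thesis by (simp add: mconst_mult_monomial)
  qed
  have "Fract (\<Sum>a\<in>K. single a (lookup f a)) 1 \<in> I"
    if "finite K" "K \<subseteq> keys f" for K
    using that
  proof (induction K rule: finite_induct)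
    case empty then show ?case using I'(1) by (simp add: Zero_fract_def)
  next
    case (insert a K)
    then have "Fract (single a (lookup f a)) 1 \<in> I"
      using mono x(2) unfolding monoid_algebra_def by blast
    with I'(2)[OF this] insert show ?case by fastforce
  qed
  from this[OF finite_keys order_refl] have "Fract f 1 \<in> I"
    using mpoly_eq_sum_monomials[OF finite_keys order_refl, of f] by simp
  then have "Fract 1 g * Fract f 1 \<in> I" using Fract_inverse_in_local_ring[OF x(3)] by (intro I'(3))
  then show "x \<in> I" unfolding x by simp
qed

lemma genideal_xpow:
  assumes "G \<subseteq> exponents V"
  shows "genideal (type_subring R) (xpow ` G :: ('v, 'k::field) mpoly fract set) = local_ideal V {a + c | a c. a \<in> G \<and> c \<in> exponents V}"
    (is "?I = local_ideal V ?B")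
proof
  have abs: "absorbing V ?B" unfolding absorbing_def using assms
    by (auto simp: add.assoc subset_iff) (metis add_in_exponents_iff)
  have sub: "xpow ` G \<subseteq> carrier (type_subring (R :: ('v, 'k) mpoly fract set))"
    using assms xpow_in_local_ideal by auto
  have "xpow a \<in> (local_ideal V ?B :: ('v, 'k) mpoly fract set)" if "a \<in> G" for a
  proof -
    have "a + 0 \<in> ?B" using that zero_in_exponents by blast
    then show ?thesis by (intro xpow_in_local_ideal) simp
  qed
  then show "?I \<subseteq> local_ideal V ?B"
    by (intro ring.genideal_minimal[OF R.ring] local_ideal_ideal abs) auto
  have I: "ideal ?I (type_subring R)" by (rule ring.genideal_ideal[OF R.ring sub])
  show "local_ideal V ?B \<subseteq> ?I"
  proof (rule local_ideal_subset[OF I])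
    show "?B \<subseteq> exponents V" using abs unfolding absorbing_def by blast
    fix b assume "b \<in> ?B"
    then obtain a c where b: "b = c + a" "a \<in> G" "c \<in> exponents V" by (auto simp: add.commute)
    have "xpow a \<in> ?I" using ring.genideal_self[OF R.ring sub] b(2) by blast
    then have "xpow c * xpow a \<in> ?I"
      using I xpow_in_local_ideal[OF b(3)] unfolding R.ideal_iff by blast
    then show "xpow b \<in> ?I" unfolding b(1) xpow_add .
  qed
qed

text \<open>Reduces the powers of the edge ideal and of the maximal ideal to sums of exponent
  sets.\<close>

lemma ideal_prod_local_ideal:
  assumes "absorbing V B" "absorbing V B'"
  shows "ideal_prod (type_subring R) (local_ideal V B) (local_ideal V B' :: ('v, 'k::field) mpoly fract set)
      = local_ideal V {b + c | b c. b \<in> B \<and> c \<in> B'}" (is "?I = local_ideal V ?B")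
proof
  have abs: "absorbing V ?B" using assms unfolding absorbing_def by (auto simp: add.assoc subset_iff) blast
  have 1: "ideal (local_ideal V ?B :: ('v, 'k) mpoly fract set) (type_subring R)" by (rule local_ideal_ideal[OF abs])
  show "?I \<subseteq> local_ideal V ?B"
  proof
    fix x assume "x \<in> ?I"
    then show "x \<in> local_ideal V ?B"
    proof (induction rule: ideal_prod.induct)
      case (prod i j)
      then show ?case
        by (elim local_idealE) (auto intro!: local_idealI mult_denominator mult_monoid_algebra)
    next
      case (sum s1 s2)
      then show ?case using 1 unfolding R.ideal_iff by simp
    qed
  qed
  have I: "ideal ?I (type_subring R)"
    by (intro ring.ideal_prod_is_ideal[OF R.ring] local_ideal_ideal assms)
  show "local_ideal V ?B \<subseteq> ?I"
  proof (rule local_ideal_subset[OF I])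
    show "?B \<subseteq> exponents V" using abs unfolding absorbing_def by blast
    fix a assume "a \<in> ?B"
    then obtain b c where a: "a = b + c" "b \<in> B" "c \<in> B'" by blast
    show "xpow a \<in> ?I"
      using ideal_prod.prod[OF xpow_in_local_ideal[OF a(2)] xpow_in_local_ideal[OF a(3)], of "type_subring R"]
      unfolding a(1) xpow_add by simp
  qed
qed

lemma ideal_power_Suc: "ideal_power Q I (Suc t) = ideal_prod Q (ideal_power Q I t) I"
  by (simp add: nat_pow_def ideals_set_def)

lemma ideal_power_0: "ideal_power Q I 0 = carrier Q"
  by (simp add: nat_pow_def ideals_set_def)

lemma absorbing_power_exponents:
  assumes "E \<subseteq> Pow V"
  shows "absorbing V (power_exponents V E t)"
  unfolding absorbing_def
proof (intro conjI ballI power_exponents_add_exponent)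
  have "edge_exponent e \<in> exponents V" if "e \<in> E" for e
    using that assms by (intro edge_exponent_in_exponents finite_V) blast
  then have "s \<in> sumset E t \<Longrightarrow> s \<in> exponents V" for s
    by (induction t arbitrary: s) (auto simp: sumset_0 elim!: sumset_SucE)
  then show "power_exponents V E t \<subseteq> exponents V" unfolding power_exponents_def by auto
qed

lemma power_exponents_0: "power_exponents V E 0 = exponents V"
  unfolding power_exponents_def sumset_0 by auto

lemma power_exponents_Suc:
  "power_exponents V E (Suc t) = {b + c | b c. b \<in> power_exponents V E t \<and> c \<in> power_exponents V E 1}"
proof
  show "power_exponents V E (Suc t) \<subseteq> {b + c | b c. b \<in> power_exponents V E t \<and> c \<in> power_exponents V E 1}"
  proof
    fix a assume "a \<in> power_exponents V E (Suc t)"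
    then obtain s d where "s \<in> sumset E (Suc t)" "d \<in> exponents V" "a = s + d" unfolding power_exponents_def by blast
    moreover from this obtain b e where "b \<in> sumset E t" "e \<in> E" "s = b + edge_exponent e" by (blast elim: sumset_SucE)
    ultimately have "a = b + 0 + (edge_exponent e + d)" "b + 0 \<in> power_exponents V E t" "edge_exponent e + d \<in> power_exponents V E 1"
      by (simp_all only: power_exponentsI edge_exponent_in_sumset zero_in_exponents add.assoc add_0)
    then show "a \<in> {b + c | b c. b \<in> power_exponents V E t \<and> c \<in> power_exponents V E 1}" by blast
  qed
  show "{b + c | b c. b \<in> power_exponents V E t \<and> c \<in> power_exponents V E 1} \<subseteq> power_exponents V E (Suc t)"
  proof safe
    fix b c assume b: "b \<in> power_exponents V E t" and "c \<in> power_exponents V E 1"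
    then obtain s d where c: "s \<in> sumset E 1" "d \<in> exponents V" "c = s + d" unfolding power_exponents_def by blast
    have "b + s + d \<in> power_exponents V E (t + 1)"
      by (intro power_exponents_add_exponent power_exponents_add_sumset b c)
    then show "b + c \<in> power_exponents V E (Suc t)" unfolding c by (simp add: add.assoc)
  qed
qed

lemma edge_ideal_power:
  assumes "E \<subseteq> Pow V"
  shows "ideal_power (type_subring R) (edge_ideal V E) t = (local_ideal V (power_exponents V E t) :: ('v, 'k::field) mpoly fract set)"
proof -
  have exp: "edge_exponent ` E \<subseteq> exponents V"
    using assms by (intro image_subsetI edge_exponent_in_exponents finite_V) blast
  have 1: "sumset E 1 = edge_exponent ` E"
  proof
    show "edge_exponent ` E \<subseteq> sumset E 1" using edge_exponent_in_sumset by blast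
    show "sumset E 1 \<subseteq> edge_exponent ` E"
    proof
      fix a assume "a \<in> sumset E 1"
      then have "a \<in> sumset E (Suc 0)" by simp
      then obtain b e where "b \<in> sumset E 0" "e \<in> E" "a = b + edge_exponent e" by (rule sumset_SucE)
      then show "a \<in> edge_exponent ` E" by (simp add: sumset_0)
    qed
  qed
  have 2: "(\<lambda>e. Fract (edge_monomial e) 1) ` E = (xpow ` edge_exponent ` E :: ('v, 'k) mpoly fract set)"
    by (simp add: image_image edge_monomial_eq)
  have one: "edge_ideal V E = (local_ideal V (power_exponents V E 1) :: ('v, 'k) mpoly fract set)"
    unfolding edge_ideal_def local_poly_ring_eq power_exponents_def 1 2 by (rule genideal_xpow[OF exp])
  show ?thesis
  proof (induction t)
    case 0
    show ?case unfolding ideal_power_0 power_exponents_0 by simp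
  next
    case (Suc t)
    show ?case
      unfolding ideal_power_Suc Suc unfolding one power_exponents_Suc[of E t]
      by (intro ideal_prod_local_ideal absorbing_power_exponents assms)
  qed
qed

lemma absorbing_degree_ge: "absorbing V {a \<in> exponents V. k \<le> total_degree V a}"
  unfolding absorbing_def by auto

lemma max_ideal_power:
  "ideal_power (type_subring R) (local_max_ideal V) k
     = (local_ideal V {a \<in> exponents V. k \<le> total_degree V a} :: ('v, 'k::field) mpoly fract set)"
proof -
  let ?G = "(\<lambda>v. single v (1 :: nat)) ` V"
  have G: "{a + c | a c. a \<in> ?G \<and> c \<in> exponents V} = {a \<in> exponents V. 1 \<le> total_degree V a}" (is "?L = ?D")
  proof
    show "?L \<subseteq> ?D" using finite_V by (auto simp: total_degree_single)
    show "?D \<subseteq> ?L"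
    proof
      fix a assume "a \<in> ?D"
      then obtain v b where "v \<in> V" "b \<in> exponents V" "a = b + single v 1"
        using exponents_split_single[OF finite_V, of a] by (metis (no_types, lifting) less_eq_Suc_le One_nat_def mem_Collect_eq)
      then show "a \<in> ?L"
        by (intro CollectI exI[of _ "single v 1"] exI[of _ b]) (simp add: add.commute)
    qed
  qed
  have "?G \<subseteq> exponents V" by auto
  from genideal_xpow[OF this]
  have one: "local_max_ideal V = (local_ideal V {a \<in> exponents V. 1 \<le> total_degree V a} :: ('v, 'k) mpoly fract set)"
    unfolding local_max_ideal_def local_poly_ring_eq mvar_def G by (simp add: image_image)
  show ?thesis
  proof (induction k)
    case 0
    show ?case unfolding ideal_power_0 by simp
  next
    case (Suc k)
    have "{b + c | b c. b \<in> {a \<in> exponents V. k \<le> total_degree V a} \<and> c \<in> {a \<in> exponents V. 1 \<le> total_degree V a}}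
       = {a \<in> exponents V. Suc k \<le> total_degree V a}" (is "?L = ?D")
    proof
      show "?L \<subseteq> ?D" by auto
      show "?D \<subseteq> ?L"
      proof
        fix a assume a: "a \<in> ?D"
        then obtain b c where "b \<in> exponents V" "c \<in> exponents V" "a = b + c" "total_degree V b = k"
          using exponents_split_degree[OF finite_V, of a k] by (metis (no_types, lifting) Suc_leD mem_Collect_eq)
        moreover from this a have "1 \<le> total_degree V c" by auto
        ultimately show "a \<in> ?L" by blast
      qed
    qed
    then show ?case
      unfolding ideal_power_Suc Suc unfolding one ideal_prod_local_ideal[OF absorbing_degree_ge absorbing_degree_ge] by simp
  qed
qed

text \<open>The lower bound comes from the ideals generated by more and more variables, the upper
  bound from contracting a chain of primes to the polynomial ring.\<close>

lemma krull_dim_local_poly_ring: "krull_dim (local_poly_ring V :: ('v, 'k::field) mpoly fract ring) = enat (card V)"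
proof -
  define B where "B T = {a \<in> exponents V. keys a \<inter> T \<noteq> {}}" for T
  have absB: "absorbing V (B T)" for T unfolding B_def absorbing_def by (auto simp: keys_plus_nat)
  have prime: "primeideal (local_ideal V (B T) :: ('v, 'k) mpoly fract set) (type_subring R)" for T
    unfolding R.primeideal_iff
  proof (intro conjI ballI impI local_ideal_ideal absB)
    show "1 \<notin> (local_ideal V (B T) :: ('v, 'k) mpoly fract set)"
      unfolding One_fract_def by (subst Fract_in_local_ideal_iff[OF absB A.one_closed one_denominator]) (simp add: monoid_algebra_def B_def)
    fix x y :: "('v, 'k) mpoly fract" assume x: "x \<in> R" and y: "y \<in> R" and xy: "x * y \<in> local_ideal V (B T)"
    obtain f g where f: "x = Fract f g" "f \<in> Pol" "g \<in> denominators V" using x by (rule local_idealE)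
    obtain f' g' where f': "y = Fract f' g'" "f' \<in> Pol" "g' \<in> denominators V" using y by (rule local_idealE)
    have ff': "f * f' \<in> monoid_algebra (B T)"
      using xy Fract_in_local_ideal_iff[OF absB A.mult_closed[OF f(2) f'(2)] mult_denominator[OF f(3) f'(3)]] unfolding f f' by simp
    \<comment> \<open>\<open>pr\<close> keeps the terms divisible by a variable of \<open>T\<close>.
      What is left of the two factors avoids these variables, and so does the product of the
      leftovers; as this product also lies in the ideal, it is 0, and one factor had no
      leftover.\<close>
    define pr where "pr p = Poly_Mapping.mapp (\<lambda>a c. if a \<in> B T then c else 0) p" for p :: "('v, 'k) mpoly"
    have lookup_pr: "lookup (pr p) a = (if a \<in> B T then lookup p a else 0)" for p a
      unfolding pr_def by (auto simp: lookup_mapp when_def in_keys_iff)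
    have prB: "pr p \<in> monoid_algebra (B T)" for p unfolding monoid_algebra_def by (auto simp: in_keys_iff lookup_pr split: if_splits)
    have prA: "pr p \<in> Pol" for p
      using prB[of p] absB monoid_algebra_mono[of "B T" "exponents V"] unfolding absorbing_def by blast
    have rest: "p - pr p \<in> monoid_algebra (exponents V - B T)" if "p \<in> Pol" for p
    proof -
      have "a \<in> exponents V - B T" if "a \<in> keys (p - pr p)" for a
        using that \<open>p \<in> _\<close> unfolding monoid_algebra_def by (cases "a \<in> B T") (auto simp: in_keys_iff lookup_pr lookup_minus)
      then show ?thesis unfolding monoid_algebra_def by blast
    qed
    have sub: "monoid_algebra (exponents V - B T) \<subseteq> (Pol :: ('v, 'k) mpoly set)" by (rule monoid_algebra_mono) blast
    have "(f - pr f) * (f' - pr f') = f * f' + - (pr f * f') + - (pr f' * (f - pr f))" by (simp add: algebra_simps)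
    also have "\<dots> \<in> monoid_algebra (B T)"
    proof (intro add_monoid_algebra ff' uminus_monoid_algebra)
      show "pr f * f' \<in> monoid_algebra (B T)" by (rule absorbing_mult[OF absB prB f'(2)])
      have "f - pr f \<in> Pol" using rest[OF f(2)] sub by blast
      then show "pr f' * (f - pr f) \<in> monoid_algebra (B T)" by (rule absorbing_mult[OF absB prB])
    qed
    finally have 1: "(f - pr f) * (f' - pr f') \<in> monoid_algebra (B T)" .
    have "(f - pr f) * (f' - pr f') \<in> monoid_algebra {b + c |b c. b \<in> exponents V - B T \<and> c \<in> exponents V - B T}"
      by (intro mult_monoid_algebra rest f f')
    moreover have "{b + c |b c. b \<in> exponents V - B T \<and> c \<in> exponents V - B T} \<inter> B T = {}"
      unfolding B_def by (auto simp: keys_plus_nat)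
    ultimately have "keys ((f - pr f) * (f' - pr f')) = {}" using 1 unfolding monoid_algebra_def by blast
    then have "(f - pr f) * (f' - pr f') = 0" by (intro poly_mapping_eqI) (auto simp: in_keys_iff)
    then have "f = pr f \<or> f' = pr f'" by simp
    then show "x \<in> local_ideal V (B T) \<or> y \<in> local_ideal V (B T)"
      unfolding f(1) f'(1) using prB f(3) f'(3) local_idealI by metis
  qed
  obtain vs where vs: "set vs = V" "distinct vs" using finite_distinct_list[OF finite_V] by blast
  have len: "length vs = card V" using vs distinct_card by metis
  have strict: "local_ideal V (B (set (take i vs))) \<subset> (local_ideal V (B (set (take (Suc i) vs))) :: ('v, 'k) mpoly fract set)"
    if i: "i < card V" for i
  proof -
    let ?v = "vs ! i"
    have v: "?v \<in> V" using i len vs by (metis nth_mem)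
    have take: "set (take (Suc i) vs) = insert ?v (set (take i vs))"
      using i len by (simp add: take_Suc_conv_app_nth)
    have "?v \<notin> set (take i vs)"
      using vs(2) i len by (metis distinct_take not_distinct_conv_prefix take_Suc_conv_app_nth)
    then have "single ?v 1 \<notin> B (set (take i vs))" "single ?v 1 \<in> B (set (take (Suc i) vs))"
      unfolding B_def take using v by auto
    then have "xpow (single ?v 1) \<notin> (local_ideal V (B (set (take i vs))) :: ('v, 'k) mpoly fract set)"
      "xpow (single ?v 1) \<in> (local_ideal V (B (set (take (Suc i) vs))) :: ('v, 'k) mpoly fract set)"
      using v by (simp_all add: xpow_in_local_ideal_iff[OF absB] del: One_nat_def)
    moreover have "B (set (take i vs)) \<subseteq> B (set (take (Suc i) vs))" unfolding B_def take by auto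
    then have "local_ideal V (B (set (take i vs))) \<subseteq> (local_ideal V (B (set (take (Suc i) vs))) :: ('v, 'k) mpoly fract set)"
      unfolding local_ideal_def monoid_algebra_def by blast
    ultimately show ?thesis by blast
  qed
  show ?thesis
    unfolding local_poly_ring_eq
  proof (rule krull_dim_eqI[of _ "\<lambda>i. local_ideal V (B (set (take i vs)))"])
    show "\<forall>i\<le>card V. primeideal (local_ideal V (B (set (take i vs)))) (type_subring (R :: ('v, 'k) mpoly fract set))" using prime by blast
    show "\<forall>i<card V. local_ideal V (B (set (take i vs))) \<subset> (local_ideal V (B (set (take (Suc i) vs))) :: ('v, 'k) mpoly fract set)" using strict by blast
  next
    fix d and Q :: "nat \<Rightarrow> ('v, 'k) mpoly fract set"
    assume Q: "\<forall>i\<le>d. primeideal (Q i) (type_subring R)" "\<forall>i<d. Q i \<subset> Q (Suc i)"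
    \<comment> \<open>An element of the local ring differs from its numerator by a unit, so
      contraction keeps the inclusions strict.\<close>
    define P where "P i = {f \<in> Pol. Fract f 1 \<in> Q i}" for i
    have Qi: "Q i \<subseteq> R" "0 \<in> Q i" "\<And>x y. x \<in> Q i \<Longrightarrow> y \<in> Q i \<Longrightarrow> x + y \<in> Q i" "\<And>c x. c \<in> R \<Longrightarrow> x \<in> Q i \<Longrightarrow> c * x \<in> Q i"
      "1 \<notin> Q i" "\<And>x y. x \<in> R \<Longrightarrow> y \<in> R \<Longrightarrow> x * y \<in> Q i \<Longrightarrow> x \<in> Q i \<or> y \<in> Q i" if "i \<le> d" for i
      using Q(1)[rule_format, OF that] unfolding R.primeideal_iff R.ideal_iff by auto
    have "primeideal (P i) (type_subring Pol)" if i: "i \<le> d" for i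
      unfolding A.primeideal_iff A.ideal_iff
    proof (intro conjI ballI impI)
      show "P i \<subseteq> Pol" unfolding P_def by blast
      show "0 \<in> P i" unfolding P_def using Qi(2)[OF i] by (simp add: Zero_fract_def A.zero_closed)
      show "1 \<notin> P i" unfolding P_def using Qi(5)[OF i] by (simp add: One_fract_def)
      show "x + y \<in> P i" if "x \<in> P i" "y \<in> P i" for x y
        using Qi(3)[OF i, of "Fract x 1" "Fract y 1"] that unfolding P_def by (simp add: A.add_closed)
      show "c * x \<in> P i" if "c \<in> Pol" "x \<in> P i" for c x
        using Qi(4)[OF i, of "Fract c 1" "Fract x 1"] that unfolding P_def by (simp add: A.mult_closed Fract_in_local_ring)
      show "x \<in> P i \<or> y \<in> P i" if "x \<in> Pol" "y \<in> Pol" "x * y \<in> P i" for x y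
        using Qi(6)[OF i, of "Fract x 1" "Fract y 1"] that unfolding P_def by (simp add: Fract_in_local_ring)
    qed
    moreover have "P i \<subset> P (Suc i)" if i: "i < d" for i
    proof -
      obtain x where x: "x \<in> Q (Suc i)" "x \<notin> Q i" using Q(2) i by blast
      have "x \<in> R" using Qi(1)[of "Suc i"] i x(1) by auto
      then obtain f g where f: "x = Fract f g" "f \<in> Pol" "g \<in> denominators V" by (rule local_idealE)
      have g0: "g \<noteq> 0" using denominator_ne_0[OF f(3)] .
      have "Fract g 1 * x \<in> Q (Suc i)"
        using Qi(4)[of "Suc i"] i x(1) Fract_in_local_ring[OF denominators_sub[OF f(3)]] by simp
      moreover have "Fract g 1 * x = Fract f 1" unfolding f(1) using g0 by (simp add: eq_fract)
      ultimately have 1: "f \<in> P (Suc i)" using f(2) unfolding P_def by simp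
      have "f \<notin> P i"
      proof
        assume "f \<in> P i"
        then have "Fract 1 g * Fract f 1 \<in> Q i"
          using Qi(4)[of i "Fract 1 g" "Fract f 1"] i Fract_inverse_in_local_ring[OF f(3)] unfolding P_def by simp
        then show False using x(2) f(1) by simp
      qed
      moreover have "P i \<subseteq> P (Suc i)" using Q(2) i unfolding P_def by blast
      ultimately show ?thesis using 1 by blast
    qed
    ultimately show "d \<le> card V" by (intro A.prime_chain_length_le[of d P]) auto
  qed
qed

end

subsection \<open>Lengths of subquotients\<close>

context closed_subring begin

text \<open>The additive right coset of \<open>type_subring C\<close>, written with the operations
  of the type.\<close>

definition coset :: "'a set \<Rightarrow> 'a \<Rightarrow> 'a set" where
  "coset K x = (\<lambda>k. k + x) ` K"

lemma coset_eq_iff: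
  assumes "ideal K (type_subring C)"
  shows "coset K x = coset K y \<longleftrightarrow> x - y \<in> K"
proof -
  have Kp: "0 \<in> K" "\<And>x y. x \<in> K \<Longrightarrow> y \<in> K \<Longrightarrow> x + y \<in> K" "\<And>c x. c \<in> C \<Longrightarrow> x \<in> K \<Longrightarrow> c * x \<in> K"
    using assms unfolding ideal_iff by auto
  have Km: "- x \<in> K" if "x \<in> K" for x
    using Kp(3)[OF uminus_closed[OF one_closed] that] by simp
  have sub: "coset K x \<subseteq> coset K y" if *: "x - y \<in> K" for x y
  proof
    fix z assume "z \<in> coset K x"
    then obtain k where "k \<in> K" "z = k + x" unfolding coset_def by blast
    then have "z = (k + (x - y)) + y" "k + (x - y) \<in> K" using Kp(2) * by auto
    then show "z \<in> coset K y" unfolding coset_def by blast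
  qed
  show ?thesis
  proof
    assume "coset K x = coset K y"
    moreover have "x \<in> coset K x" unfolding coset_def using Kp(1) by force
    ultimately show "x - y \<in> K" unfolding coset_def by auto
  next
    assume *: "x - y \<in> K"
    then have "y - x \<in> K" using Km[OF *] by simp
    with * show "coset K x = coset K y" using sub by blast
  qed
qed

lemma coset_0 [simp]: "coset K 0 = K"
  unfolding coset_def by simp

text \<open>The action is defined as a union over all representatives of the coset; since
  \<open>K\<close> is an ideal, they all contribute the same coset.\<close>

lemma quotient_module_smult:
  assumes K: "ideal K (type_subring C)" and c: "c \<in> C"
  shows "c \<odot>\<^bsub>quotient_module (ideal_module (type_subring C) J) K\<^esub> coset K x = coset K (c * x)"
proof -
  have Kp: "0 \<in> K" "\<And>c x. c \<in> C \<Longrightarrow> x \<in> K \<Longrightarrow> c * x \<in> K" using K unfolding ideal_iff by auto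
  have "c \<odot>\<^bsub>quotient_module (ideal_module (type_subring C) J) K\<^esub> coset K x = (\<Union>y\<in>coset K x. coset K (c * y))"
    unfolding quotient_module_def ideal_module_def a_r_coset_def r_coset_def coset_def by auto
  also have "\<dots> = (\<Union>y\<in>coset K x. coset K (c * x))"
  proof (intro SUP_cong refl)
    fix y assume "y \<in> coset K x"
    then obtain k where "k \<in> K" "y = k + x" unfolding coset_def by blast
    then show "coset K (c * y) = coset K (c * x)"
      unfolding coset_eq_iff[OF K] using Kp(2)[OF c, of k] by (simp add: algebra_simps)
  qed
  also have "\<dots> = coset K (c * x)" using Kp(1) unfolding coset_def[of K x] by auto
  finally show ?thesis .
qed

text \<open>Submodules of \<open>T / K\<close> correspond to ideals between \<open>K\<close> and \<open>T\<close>.\<close>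

lemma subquotient_chain_iff:
  fixes K T J :: "'a set"
  assumes K: "ideal K (type_subring C)" and KT: "K \<subseteq> T" and TJ: "T \<subseteq> J" and T: "ideal T (type_subring C)"
  defines "\<Gamma> \<equiv> (quotient_module (ideal_module (type_subring C) J) K)\<lparr>carrier := coset K ` T\<rparr>"
  shows "(\<exists>N. (\<forall>i\<le>n. submodule (N i) (type_subring C) \<Gamma>) \<and> (\<forall>i<n. N i \<subset> N (Suc i))) \<longleftrightarrow>
     (\<exists>I. (\<forall>i\<le>n. ideal (I i) (type_subring C) \<and> K \<subseteq> I i \<and> I i \<subseteq> T) \<and> (\<forall>i<n. I i \<subset> I (Suc i)))"
proof -
  define q where "q = coset K"
  have Kp: "K \<subseteq> C" "0 \<in> K" "\<And>x y. x \<in> K \<Longrightarrow> y \<in> K \<Longrightarrow> x + y \<in> K" "\<And>c x. c \<in> C \<Longrightarrow> x \<in> K \<Longrightarrow> c * x \<in> K"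
    using K unfolding ideal_iff by auto
  have q_eq: "q x = q y \<longleftrightarrow> x - y \<in> K" for x y
    unfolding q_def by (rule coset_eq_iff[OF K])
  have q0: "q 0 = K" unfolding q_def by simp
  have carr: "carrier \<Gamma> = q ` T" unfolding \<Gamma>_def q_def by simp
  have zero: "\<zero>\<^bsub>\<Gamma>\<^esub> = q 0" unfolding q0 \<Gamma>_def quotient_module_def by simp
  have add: "q x \<oplus>\<^bsub>\<Gamma>\<^esub> q y = q (x + y)" for x y
  proof -
    have "q x \<oplus>\<^bsub>\<Gamma>\<^esub> q y = {a + b | a b. a \<in> q x \<and> b \<in> q y}"
      unfolding \<Gamma>_def quotient_module_def ideal_module_def set_add_def set_mult_def by auto
    also have "\<dots> = q (x + y)"
    proof (intro equalityI subsetI)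
      fix z assume "z \<in> {a + b | a b. a \<in> q x \<and> b \<in> q y}"
      then obtain k l where "k \<in> K" "l \<in> K" "z = (k + x) + (l + y)" unfolding q_def coset_def by blast
      then have "z = (k + l) + (x + y)" "k + l \<in> K" using Kp(3) by (auto simp: ac_simps)
      then show "z \<in> q (x + y)" unfolding q_def coset_def by blast
    next
      fix z assume "z \<in> q (x + y)"
      then obtain k where k: "k \<in> K" "z = k + (x + y)" unfolding q_def coset_def by blast
      then have "z = (k + x) + (0 + y)" by (simp add: ac_simps)
      then show "z \<in> {a + b | a b. a \<in> q x \<and> b \<in> q y}" unfolding q_def coset_def using k(1) Kp(2) by blast
    qed
    finally show ?thesis .
  qed
  have smult: "c \<odot>\<^bsub>\<Gamma>\<^esub> q x = q (c * x)" if "c \<in> C" for c x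
    using quotient_module_smult[OF K that] unfolding \<Gamma>_def q_def by simp
  have Tp: "T \<subseteq> C" "0 \<in> T" "\<And>x y. x \<in> T \<Longrightarrow> y \<in> T \<Longrightarrow> x + y \<in> T" "\<And>c x. c \<in> C \<Longrightarrow> x \<in> T \<Longrightarrow> c * x \<in> T"
    using T unfolding ideal_iff by auto
  have ideal_of: "ideal {x \<in> C. q x \<in> N} (type_subring C) \<and> K \<subseteq> {x \<in> C. q x \<in> N} \<and> {x \<in> C. q x \<in> N} \<subseteq> T"
    and ideal_of': "q ` {x \<in> C. q x \<in> N} = N"
    if N: "submodule N (type_subring C) \<Gamma>" for N
  proof -
    interpret submodule N "type_subring C" \<Gamma> by (rule N)
    have Nsub: "N \<subseteq> q ` T" using subset carr by simp
    have N0: "q 0 \<in> N" using one_closed zero by simp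
    have Nadd: "q (x + y) \<in> N" if "q x \<in> N" "q y \<in> N" for x y
      using m_closed[OF that] add by simp
    have Nsm: "q (c * x) \<in> N" if "c \<in> C" "q x \<in> N" for c x
      using smult_closed[of c "q x"] that smult by simp
    have sub: "{x \<in> C. q x \<in> N} \<subseteq> T"
    proof clarify
      fix x assume "x \<in> C" "q x \<in> N"
      then obtain y where y: "y \<in> T" "q x = q y" using Nsub by blast
      then have "x - y \<in> T" using q_eq KT by blast
      then have "(x - y) + y \<in> T" using y(1) Tp(3) by blast
      then show "x \<in> T" by simp
    qed
    have "q k \<in> N" if "k \<in> K" for k using N0 q_eq[of k 0] that by simp
    then show "ideal {x \<in> C. q x \<in> N} (type_subring C) \<and> K \<subseteq> {x \<in> C. q x \<in> N} \<and> {x \<in> C. q x \<in> N} \<subseteq> T"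
      using sub Kp(1) N0 Nadd Nsm unfolding ideal_iff
      by (auto simp: zero_closed add_closed mult_closed)
    show "q ` {x \<in> C. q x \<in> N} = N" using Nsub Tp(1) by blast
  qed
  have submodule_of: "submodule (q ` I) (type_subring C) \<Gamma>"
    if I: "ideal I (type_subring C)" and IT: "I \<subseteq> T" for I
  proof (intro submodule.intro subgroup.intro submodule_axioms.intro)
    have Ip: "I \<subseteq> C" "0 \<in> I" "\<And>x y. x \<in> I \<Longrightarrow> y \<in> I \<Longrightarrow> x + y \<in> I" "\<And>c x. c \<in> C \<Longrightarrow> x \<in> I \<Longrightarrow> c * x \<in> I"
      using I unfolding ideal_iff by auto
    have Im: "- x \<in> I" if "x \<in> I" for x
      using Ip(4)[OF uminus_closed[OF one_closed] that] by simp
    show "q ` I \<subseteq> carrier (add_monoid \<Gamma>)" using IT carr by auto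
    show "x \<otimes>\<^bsub>add_monoid \<Gamma>\<^esub> y \<in> q ` I" if "x \<in> q ` I" "y \<in> q ` I" for x y
      using that Ip(3) add by auto
    show "\<one>\<^bsub>add_monoid \<Gamma>\<^esub> \<in> q ` I" using Ip(2) zero by simp
    show "inv\<^bsub>add_monoid \<Gamma>\<^esub> x \<in> q ` I" if x: "x \<in> q ` I" for x
    proof -
      obtain a where a: "a \<in> I" "x = q a" using x by blast
      have "inv\<^bsub>add_monoid \<Gamma>\<^esub> x = q (- a)"
        \<comment> \<open>The module record is not known to be a group at this point, so the inverse
          is found from its defining description, with uniqueness checked by hand.\<close>
        unfolding m_inv_def
      proof (rule the_equality)
        show "q (- a) \<in> carrier (add_monoid \<Gamma>) \<and> x \<otimes>\<^bsub>add_monoid \<Gamma>\<^esub> q (- a) = \<one>\<^bsub>add_monoid \<Gamma>\<^esub> \<and> q (- a) \<otimes>\<^bsub>add_monoid \<Gamma>\<^esub> x = \<one>\<^bsub>add_monoid \<Gamma>\<^esub>"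
          using Im[OF a(1)] IT carr a(2) add zero by auto
        fix y assume y: "y \<in> carrier (add_monoid \<Gamma>) \<and> x \<otimes>\<^bsub>add_monoid \<Gamma>\<^esub> y = \<one>\<^bsub>add_monoid \<Gamma>\<^esub> \<and> y \<otimes>\<^bsub>add_monoid \<Gamma>\<^esub> x = \<one>\<^bsub>add_monoid \<Gamma>\<^esub>"
        then obtain b where b: "y = q b" using carr by auto
        have "q (b + a) = q 0" using y a(2) b add zero by auto
        then have "b + a \<in> K" using q_eq[of "b + a" 0] by simp
        then show "y = q (- a)" using b q_eq[of b "- a"] by simp
      qed
      then show ?thesis using Im[OF a(1)] by blast
    qed
    show "c \<odot>\<^bsub>\<Gamma>\<^esub> x \<in> q ` I" if "c \<in> carrier (type_subring C)" "x \<in> q ` I" for c x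
      using that Ip(4) smult by auto
  qed
  show ?thesis
  proof
    assume "\<exists>N. (\<forall>i\<le>n. submodule (N i) (type_subring C) \<Gamma>) \<and> (\<forall>i<n. N i \<subset> N (Suc i))"
    then obtain N where N: "\<And>i. i \<le> n \<Longrightarrow> submodule (N i) (type_subring C) \<Gamma>" "\<And>i. i < n \<Longrightarrow> N i \<subset> N (Suc i)" by blast
    have "{x \<in> C. q x \<in> N i} \<subset> {x \<in> C. q x \<in> N (Suc i)}" if "i < n" for i
    proof -
      have "q ` {x \<in> C. q x \<in> N i} = N i" "q ` {x \<in> C. q x \<in> N (Suc i)} = N (Suc i)"
        using ideal_of' N(1) that by simp_all
      then have "{x \<in> C. q x \<in> N i} \<noteq> {x \<in> C. q x \<in> N (Suc i)}" using N(2)[OF that] by (metis psubsetE subset_refl)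
      moreover have "{x \<in> C. q x \<in> N i} \<subseteq> {x \<in> C. q x \<in> N (Suc i)}" using N(2)[OF that] by blast
      ultimately show ?thesis by (rule psubsetI[rotated])
    qed
    then show "\<exists>I. (\<forall>i\<le>n. ideal (I i) (type_subring C) \<and> K \<subseteq> I i \<and> I i \<subseteq> T) \<and> (\<forall>i<n. I i \<subset> I (Suc i))"
      using ideal_of N(1) by (intro exI[of _ "\<lambda>i. {x \<in> C. q x \<in> N i}"]) blast
  next
    assume "\<exists>I. (\<forall>i\<le>n. ideal (I i) (type_subring C) \<and> K \<subseteq> I i \<and> I i \<subseteq> T) \<and> (\<forall>i<n. I i \<subset> I (Suc i))"
    then obtain I where I: "\<And>i. i \<le> n \<Longrightarrow> ideal (I i) (type_subring C)" "\<And>i. i \<le> n \<Longrightarrow> K \<subseteq> I i" "\<And>i. i \<le> n \<Longrightarrow> I i \<subseteq> T"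
      "\<And>i. i < n \<Longrightarrow> I i \<subset> I (Suc i)" by blast
    have "q ` I i \<subset> q ` I (Suc i)" if i: "i < n" for i
    proof -
      obtain x where x: "x \<in> I (Suc i)" "x \<notin> I i" using I(4)[OF i] by blast
      have "q x \<notin> q ` I i"
      proof
        assume "q x \<in> q ` I i"
        then obtain y where y: "y \<in> I i" "x - y \<in> K" using q_eq by blast
        then have "x - y \<in> I i" using I(2)[of i] i by auto
        moreover have "\<forall>x\<in>I i. \<forall>y\<in>I i. x + y \<in> I i" using I(1)[of i] i unfolding ideal_iff by simp
        ultimately have "(x - y) + y \<in> I i" using y(1) by blast
        then show False using x(2) by simp
      qed
      then show ?thesis using x(1) I(4)[OF i] by blast
    qed
    then show "\<exists>N. (\<forall>i\<le>n. submodule (N i) (type_subring C) \<Gamma>) \<and> (\<forall>i<n. N i \<subset> N (Suc i))"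
      using submodule_of[OF I(1,3)] by (intro exI[of _ "\<lambda>i. q ` I i"] conjI allI impI)
  qed
qed

end

text \<open>An exponent of maximal degree in \<open>D - U\<close> can be added to \<open>U\<close>:
  its proper multiples stay in \<open>D\<close> but have larger degree, so they already lie in
  \<open>U\<close>. Repeating this fills the gap one exponent at a time.\<close>

lemma absorbing_chain:
  assumes "finite (D - U)" "absorbing V U" "absorbing V D" "U \<subseteq> D" "finite V"
  shows "\<exists>B. (\<forall>i\<le>card (D - U). absorbing V (B i) \<and> U \<subseteq> B i \<and> B i \<subseteq> D) \<and> (\<forall>i<card (D - U). B i \<subset> B (Suc i))"
  using assms
proof (induction "card (D - U)" arbitrary: U)
  case 0
  then show ?case by (intro exI[of _ "\<lambda>_. U"]) auto
next
  case (Suc k)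
  then have ne: "D - U \<noteq> {}" by (metis card.empty nat.distinct(1))
  define M where "M = Max (total_degree V ` (D - U))"
  have "M \<in> total_degree V ` (D - U)" unfolding M_def using Suc.prems(1) ne by (intro Max_in) auto
  then obtain a where a: "a \<in> D - U" "total_degree V a = M" by blast
  have max: "total_degree V b \<le> M" if "b \<in> D - U" for b
    unfolding M_def using Suc.prems(1) that by (intro Max_ge) auto
  have abs: "absorbing V (insert a U)"
    unfolding absorbing_def
  proof (intro conjI ballI)
    show "insert a U \<subseteq> exponents V" using a Suc.prems(2,3) unfolding absorbing_def by blast
    fix b c assume b: "b \<in> insert a U" and c: "c \<in> exponents V"
    show "b + c \<in> insert a U"
    proof (cases "b \<in> U")
      case True
      then show ?thesis using absorbingD[OF Suc.prems(2) _ c] by blast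
    next
      case False
      then have "b = a" using b by blast
      have "a + c \<in> D" using absorbingD[OF Suc.prems(3) _ c] a by blast
      then have "a + c \<in> U \<or> total_degree V (a + c) \<le> M" using max by blast
      then show ?thesis using a(2) total_degree_eq_0_iff[OF Suc.prems(5) c] \<open>b = a\<close> by auto
    qed
  qed
  have Dm: "D - insert a U = (D - U) - {a}" by blast
  have k: "k = card (D - insert a U)" unfolding Dm using Suc.hyps(2) Suc.prems(1) a by simp
  have "finite (D - insert a U)" "insert a U \<subseteq> D" using Suc.prems a by auto
  from Suc.hyps(1)[OF k this(1) abs Suc.prems(3) this(2) Suc.prems(5)]
  obtain B where B: "\<And>i. i \<le> k \<Longrightarrow> absorbing V (B i) \<and> insert a U \<subseteq> B i \<and> B i \<subseteq> D" "\<And>i. i < k \<Longrightarrow> B i \<subset> B (Suc i)"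
    unfolding k[symmetric] by blast
  define B' where "B' = case_nat U B"
  have "absorbing V (B' i) \<and> U \<subseteq> B' i \<and> B' i \<subseteq> D" if "i \<le> Suc k" for i
    using B(1)[of "i - 1"] that Suc.prems unfolding B'_def by (cases i) auto
  moreover have "B' i \<subset> B' (Suc i)" if "i < Suc k" for i
  proof (cases i)
    case 0
    then show ?thesis using B(1)[of 0] a unfolding B'_def by auto
  next
    case (Suc j)
    then show ?thesis using B(2)[of j] that unfolding B'_def by simp
  qed
  ultimately show ?case unfolding Suc.hyps(2)[symmetric] by blast
qed

context local_ring begin

text \<open>Numerators separating successive ideals are independent modulo the monomials with
  exponent in \<open>U\<close>. As they are supported on \<open>D\<close>, only
  \<open>card (D - U)\<close> monomials remain for them.\<close>

lemma ideal_chain_length_le: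
  fixes I :: "nat \<Rightarrow> ('v, 'k::field) mpoly fract set"
  assumes "finite (D - U)" "absorbing V U" "absorbing V D"
    and I: "\<And>i. i \<le> l \<Longrightarrow> ideal (I i) (type_subring R)" "\<And>i. i \<le> l \<Longrightarrow> local_ideal V U \<subseteq> I i"
      "\<And>i. i \<le> l \<Longrightarrow> I i \<subseteq> local_ideal V D" "\<And>i. i < l \<Longrightarrow> I i \<subset> I (Suc i)"
  shows "l \<le> card (D - U)"
proof -
  have Ip: "0 \<in> I i" "\<And>x y. x \<in> I i \<Longrightarrow> y \<in> I i \<Longrightarrow> x + y \<in> I i" "\<And>c x. c \<in> R \<Longrightarrow> x \<in> I i \<Longrightarrow> c * x \<in> I i" if "i \<le> l" for i
    using I(1)[OF that] unfolding R.ideal_iff by auto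
  have "\<exists>f. f \<in> monoid_algebra D \<and> Fract f 1 \<in> I (Suc i) \<and> Fract f 1 \<notin> I i" if i: "i < l" for i
  proof -
    obtain x where x: "x \<in> I (Suc i)" "x \<notin> I i" using I(4)[OF i] by blast
    then have "x \<in> local_ideal V D" using I(3)[of "Suc i"] i by auto
    then obtain f g where f: "x = Fract f g" "f \<in> monoid_algebra D" "g \<in> denominators V" by (rule local_idealE)
    have "Fract g 1 * x \<in> I (Suc i)"
      using Ip(3)[of "Suc i" "Fract g 1" x] i x(1) Fract_in_local_ring[OF denominators_sub[OF f(3)]] by simp
    moreover have "Fract g 1 * x = Fract f 1" unfolding f(1) using denominator_ne_0[OF f(3)] by (simp add: eq_fract)
    moreover have "Fract f 1 \<notin> I i"
    proof
      assume "Fract f 1 \<in> I i"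
      then have "Fract 1 g * Fract f 1 \<in> I i"
        using i by (intro Ip(3) Fract_inverse_in_local_ring[OF f(3)]) simp_all
      then show False using x(2) f(1) by simp
    qed
    ultimately show ?thesis using f(2) by auto
  qed
  then have "\<forall>i. \<exists>f. i < l \<longrightarrow> f \<in> monoid_algebra D \<and> Fract f 1 \<in> I (Suc i) \<and> Fract f 1 \<notin> I i" by blast
  from choice[OF this] obtain f where
    f: "\<And>i. i < l \<Longrightarrow> f i \<in> monoid_algebra D" "\<And>i. i < l \<Longrightarrow> Fract (f i) 1 \<in> I (Suc i)" "\<And>i. i < l \<Longrightarrow> Fract (f i) 1 \<notin> I i" by blast
  have mono: "I i \<subseteq> I j" if "i \<le> j" "j \<le> l" for i j
    using that
  proof (induction j rule: dec_induct)
    case (step k)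
    then show ?case using I(4)[of k] by auto
  qed simp
  define b where "b i = Poly_Mapping.mapp (\<lambda>a c. if a \<in> D - U then c else 0) (f i)" for i
  have lookup_b: "lookup (b i) a = (if a \<in> D - U then lookup (f i) a else 0)" for i a
    unfolding b_def by (auto simp: lookup_mapp when_def in_keys_iff)
  have const: "Fract (mconst c) 1 \<in> (R :: ('v, 'k) mpoly fract set)" for c
    by (intro Fract_in_local_ring) (simp add: monoid_algebra_def mconst_def)
  have "card {..<l} \<le> card (D - U)"
  proof (rule card_independent_family_le[where b = b])
    show "keys (b i) \<subseteq> D - U" for i by (auto simp: in_keys_iff lookup_b split: if_splits)
    fix u i assume sum: "(\<Sum>i<l. mconst (u i) * b i) = 0" and i: "i \<in> {..<l}"
    show "u i = 0"
    proof (rule ccontr)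
      assume "u i \<noteq> 0"
      \<comment> \<open>In a relation among the truncations, the same combination of the
        \<open>f k\<close> lies in the ideal of \<open>U\<close>, hence in \<open>I j\<close>. The
        terms with \<open>k < j\<close> lie in \<open>I j\<close> too, because \<open>f k\<close> is
        in \<open>I (Suc k)\<close>. With \<open>j\<close> the last index of a nonzero coefficient,
        \<open>f j\<close> is forced into \<open>I j\<close>, against its choice.\<close>
      define j where "j = Max {i. i < l \<and> u i \<noteq> 0}"
      have fin: "finite {i. i < l \<and> u i \<noteq> 0}" by simp
      have "j \<in> {i. i < l \<and> u i \<noteq> 0}" unfolding j_def using \<open>u i \<noteq> 0\<close> i fin by (intro Max_in) auto
      then have j: "j < l" "u j \<noteq> 0" by auto
      then have jl: "j \<le> l" by simp
      have jmax: "u k = 0" if "j < k" "k < l" for k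
        using Max_ge[OF fin, of k] that unfolding j_def by (metis (mono_tags, lifting) leD mem_Collect_eq)
      define p where "p = (\<Sum>k<l. mconst (u k) * f k)"
      have pD: "keys p \<subseteq> D"
      proof
        fix a assume "a \<in> keys p"
        then have "(\<Sum>k<l. u k * lookup (f k) a) \<noteq> 0" by (simp add: p_def in_keys_iff lookup_sum lookup_mconst_mult)
        then obtain k where "k < l" "lookup (f k) a \<noteq> 0"
          by (elim sum.not_neutral_contains_not_neutral) auto
        then show "a \<in> D" using f(1)[of k] unfolding monoid_algebra_def by (auto simp: in_keys_iff)
      qed
      have "a \<notin> keys p" if "a \<in> D - U" for a
      proof -
        have "lookup p a = lookup (\<Sum>i<l. mconst (u i) * b i) a"
          unfolding p_def lookup_sum lookup_mconst_mult lookup_b using that by simp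
        then show ?thesis using sum by (simp add: in_keys_iff)
      qed
      then have "p \<in> monoid_algebra U" using pD unfolding monoid_algebra_def by blast
      then have "Fract p 1 \<in> local_ideal V U" by (intro local_idealI one_denominator)
      then have p_in: "Fract p 1 \<in> I j" using I(2)[of j] j by auto
      have "{..<l} = insert j ({..<j} \<union> {j<..<l})" using j by auto
      then have "p = mconst (u j) * f j + (\<Sum>k\<in>{..<j} \<union> {j<..<l}. mconst (u k) * f k)"
        unfolding p_def by simp
      also have "(\<Sum>k\<in>{..<j} \<union> {j<..<l}. mconst (u k) * f k) = (\<Sum>k<j. mconst (u k) * f k)"
        using jmax by (intro sum.mono_neutral_right) (auto simp: mconst_def)
      finally have p_eq: "p = mconst (u j) * f j + (\<Sum>k<j. mconst (u k) * f k)" .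
      have "Fract (\<Sum>k<i. mconst (u k) * f k) 1 \<in> I j" if "i \<le> j" for i
        using that
      proof (induction i)
        case 0
        then show ?case using Ip(1)[of j] j by (simp add: Zero_fract_def)
      next
        case (Suc i)
        have "Fract (f i) 1 \<in> I j" using f(2)[of i] mono[of "Suc i" j] Suc.prems j by auto
        then have "Fract (mconst (u i)) 1 * Fract (f i) 1 \<in> I j" by (rule Ip(3)[OF jl const])
        with Ip(2)[of j "Fract (\<Sum>k<i. mconst (u k) * f k) 1", OF _ _ this] Suc j show ?case by simp
      qed
      from this[OF order_refl] have "Fract (mconst (- 1)) 1 * Fract (\<Sum>k<j. mconst (u k) * f k) 1 \<in> I j"
        by (rule Ip(3)[OF jl const])
      from Ip(2)[of j, OF _ p_in this] j have "Fract p 1 + Fract (mconst (- 1)) 1 * Fract (\<Sum>k<j. mconst (u k) * f k) 1 \<in> I j" by simp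
      moreover have "mconst (- 1) = (- 1 :: ('v, 'k) mpoly)" by (simp add: mconst_def single_uminus)
      ultimately have "Fract (mconst (u j) * f j) 1 \<in> I j" unfolding p_eq by simp
      then have "Fract (mconst (inverse (u j))) 1 * Fract (mconst (u j) * f j) 1 \<in> I j" by (rule Ip(3)[OF jl const])
      moreover have "mconst (inverse (u j)) * (mconst (u j) * f j) = f j"
        using j(2) by (simp add: mconst_def mult_single flip: mult.assoc)
      ultimately show False using f(3)[OF j(1)] by (simp only: mult_fract mult_1)
    qed
  qed (use assms(1) in auto)
  then show ?thesis by simp
qed

lemma ideal_chain_ex:
  assumes "finite (D - U)" "absorbing V U" "absorbing V D" "U \<subseteq> D"
  shows "\<exists>I :: nat \<Rightarrow> ('v, 'k::field) mpoly fract set. (\<forall>i\<le>card (D - U). ideal (I i) (type_subring R) \<and>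
     local_ideal V U \<subseteq> I i \<and> I i \<subseteq> local_ideal V D) \<and> (\<forall>i<card (D - U). I i \<subset> I (Suc i))"
proof -
  obtain B where B: "\<And>i. i \<le> card (D - U) \<Longrightarrow> absorbing V (B i) \<and> U \<subseteq> B i \<and> B i \<subseteq> D" "\<And>i. i < card (D - U) \<Longrightarrow> B i \<subset> B (Suc i)"
    using absorbing_chain[OF assms finite_V] by blast
  have mono: "local_ideal V C \<subseteq> (local_ideal V C' :: ('v, 'k) mpoly fract set)" if "C \<subseteq> C'" for C C'
    using monoid_algebra_mono[OF that] unfolding local_ideal_def by blast
  have "local_ideal V (B i) \<subset> (local_ideal V (B (Suc i)) :: ('v, 'k) mpoly fract set)" if i: "i < card (D - U)" for i
  proof -
    obtain a where a: "a \<in> B (Suc i)" "a \<notin> B i" using B(2)[OF i] by blast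
    have "absorbing V (B i)" "absorbing V (B (Suc i))" using B(1) i by simp_all
    moreover from this have "a \<in> exponents V" using a(1) unfolding absorbing_def by blast
    ultimately have "xpow a \<notin> (local_ideal V (B i) :: ('v, 'k) mpoly fract set)" "xpow a \<in> (local_ideal V (B (Suc i)) :: ('v, 'k) mpoly fract set)"
      using a by (simp_all add: xpow_in_local_ideal_iff)
    moreover have "local_ideal V (B i) \<subseteq> (local_ideal V (B (Suc i)) :: ('v, 'k) mpoly fract set)" using B(2)[OF i] by (intro mono) blast
    ultimately show ?thesis by blast
  qed
  moreover have "ideal (local_ideal V (B i)) (type_subring (R :: ('v, 'k) mpoly fract set)) \<and>
      local_ideal V U \<subseteq> (local_ideal V (B i) :: ('v, 'k) mpoly fract set) \<and>
      local_ideal V (B i) \<subseteq> (local_ideal V D :: ('v, 'k) mpoly fract set)" if "i \<le> card (D - U)" for i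
    using B(1)[OF that] by (intro conjI mono local_ideal_ideal) simp_all
  ultimately show ?thesis
    by (intro exI[of _ "\<lambda>i. local_ideal V (B i)"] conjI allI impI) simp_all
qed

text \<open>The torsion is again monomial. Multiplication by one monomial merges no terms, so if it
  sends a numerator into the monomial ideal, every term goes there separately. Conversely, a
  numerator has finitely many terms, and the largest of their annihilating powers kills all of
  them.\<close>

lemma torsion_carrier:
  assumes "E \<subseteq> Pow V"
  shows "local_cohomology0 (type_subring R) (local_max_ideal V)
       (quotient_module (ideal_module (type_subring R) (local_ideal V (power_exponents V E t)))
          (local_ideal V (power_exponents V E (t + 1)) :: ('v, 'k::field) mpoly fract set))
     = (quotient_module (ideal_module (type_subring R) (local_ideal V (power_exponents V E t)))
          (local_ideal V (power_exponents V E (t + 1))))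
        \<lparr>carrier := R.coset (local_ideal V (power_exponents V E (t + 1))) ` local_ideal V (torsion_exponents V E t)\<rparr>"
proof -
  define J where "J = (local_ideal V (power_exponents V E t) :: ('v, 'k) mpoly fract set)"
  define K where "K = (local_ideal V (power_exponents V E (t + 1)) :: ('v, 'k) mpoly fract set)"
  define q where "q = R.coset K"
  define Q where "Q = quotient_module (ideal_module (type_subring R) J) K"
  have absU: "absorbing V (power_exponents V E s)" for s by (rule absorbing_power_exponents[OF assms])
  have K: "ideal K (type_subring R)" unfolding K_def by (rule local_ideal_ideal[OF absU])
  have carrQ: "carrier Q = q ` J"
    unfolding Q_def quotient_module_def ideal_module_def A_RCOSETS_def RCOSETS_def r_coset_def q_def R.coset_def by auto
  have zeroQ: "\<zero>\<^bsub>Q\<^esub> = K" unfolding Q_def quotient_module_def by simp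
  have smult: "c \<odot>\<^bsub>Q\<^esub> q x = K \<longleftrightarrow> c * x \<in> K" if c: "c \<in> R" for c x
    unfolding Q_def q_def R.quotient_module_smult[OF K c]
    using R.coset_eq_iff[OF K, of "c * x" 0] by simp
  have pow: "ideal_power (type_subring R) (local_max_ideal V) k
      = (local_ideal V {a \<in> exponents V. k \<le> total_degree V a} :: ('v, 'k) mpoly fract set)" for k
    by (rule max_ideal_power)
  have "{x \<in> carrier Q. \<exists>k. \<forall>a\<in>ideal_power (type_subring R) (local_max_ideal V) k. a \<odot>\<^bsub>Q\<^esub> x = \<zero>\<^bsub>Q\<^esub>}
      = q ` local_ideal V (torsion_exponents V E t)" (is "?L = ?T")
  proof (intro equalityI subsetI)
    fix Y assume "Y \<in> ?L"
    then obtain x k where x: "x \<in> J" "Y = q x" and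
      kill: "\<And>a. a \<in> local_ideal V {a \<in> exponents V. k \<le> total_degree V a} \<Longrightarrow> a \<odot>\<^bsub>Q\<^esub> q x = K"
      unfolding carrQ zeroQ pow by blast
    obtain f g where f: "x = Fract f g" "f \<in> monoid_algebra (power_exponents V E t)" "g \<in> denominators V"
      using x(1) unfolding J_def by (rule local_idealE)
    have "c \<in> torsion_exponents V E t" if c: "c \<in> keys f" for c
      unfolding torsion_exponents_def
    proof (intro CollectI conjI exI[of _ k] ballI impI)
      show "c \<in> power_exponents V E t" using c f(2) unfolding monoid_algebra_def by blast
      fix b assume b: "b \<in> exponents V" "k \<le> total_degree V b"
      have "xpow b \<odot>\<^bsub>Q\<^esub> q x = K" using b by (intro kill xpow_in_local_ideal) simp
      then have in_K: "Fract (single b 1 * f) g \<in> K"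
        using smult[OF xpow_in_local_ideal[OF b(1)], of x] f(1) by simp
      have bf: "single b 1 * f \<in> monoid_algebra (exponents V)"
        using b(1) f(2) absU[of t] unfolding absorbing_def
        by (intro A.mult_closed) (auto simp: monoid_algebra_def)
      have 1: "single b 1 * f \<in> monoid_algebra (power_exponents V E (t + 1))"
        using in_K Fract_in_local_ideal_iff[OF absU bf f(3)] unfolding K_def by blast
      have "lookup (single b 1 * f) (b + c) = lookup (single b 1) b * lookup f c"
        by (rule lookup_mult_unique) simp
      then have "b + c \<in> keys (single b 1 * f)" using c by (simp add: in_keys_iff)
      then show "c + b \<in> power_exponents V E (t + 1)" using 1 unfolding monoid_algebra_def by (auto simp: add.commute)
    qed
    then have "f \<in> monoid_algebra (torsion_exponents V E t)" unfolding monoid_algebra_def by blast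
    then have "x \<in> local_ideal V (torsion_exponents V E t)" unfolding f(1) using f(3) by (rule local_idealI)
    then show "Y \<in> ?T" unfolding x(2) by blast
  next
    fix Y assume "Y \<in> ?T"
    then obtain x where x: "x \<in> local_ideal V (torsion_exponents V E t)" "Y = q x" by blast
    obtain f g where f: "x = Fract f g" "f \<in> monoid_algebra (torsion_exponents V E t)" "g \<in> denominators V"
      using x(1) by (rule local_idealE)
    have "f \<in> monoid_algebra (power_exponents V E t)" using f(2) unfolding monoid_algebra_def torsion_exponents_def by blast
    then have xJ: "x \<in> J" unfolding J_def f(1) using f(3) by (rule local_idealI)
    have "\<forall>c. \<exists>k. c \<in> keys f \<longrightarrow> (\<forall>b\<in>exponents V. k \<le> total_degree V b \<longrightarrow> c + b \<in> power_exponents V E (t + 1))"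
      using f(2) unfolding monoid_algebra_def torsion_exponents_def by blast
    from choice[OF this] obtain k where
      k: "\<And>c b. c \<in> keys f \<Longrightarrow> b \<in> exponents V \<Longrightarrow> k c \<le> total_degree V b \<Longrightarrow> c + b \<in> power_exponents V E (t + 1)" by blast
    define k0 where "k0 = Max (insert 0 (k ` keys f))"
    have k0: "k c \<le> k0" if "c \<in> keys f" for c unfolding k0_def using that by (intro Max_ge) auto
    have "a \<odot>\<^bsub>Q\<^esub> q x = K" if a: "a \<in> local_ideal V {a \<in> exponents V. k0 \<le> total_degree V a}" for a
    proof -
      obtain f' g' where f': "a = Fract f' g'" "f' \<in> monoid_algebra {a \<in> exponents V. k0 \<le> total_degree V a}" "g' \<in> denominators V"
        using a by (rule local_idealE)
      have aR: "a \<in> R" using f' unfolding f'(1) monoid_algebra_def by (intro local_idealI) (auto simp: monoid_algebra_def)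
      have "f' * f \<in> monoid_algebra (power_exponents V E (t + 1))"
        unfolding monoid_algebra_def
      proof (intro CollectI subsetI)
        fix d assume "d \<in> keys (f' * f)"
        then obtain b c where bc: "b \<in> keys f'" "c \<in> keys f" "d = c + b"
          using keys_mult[of f' f] by (auto simp: add.commute)
        have "b \<in> exponents V" "k c \<le> total_degree V b"
          using bc(1) f'(2) k0[OF bc(2)] unfolding monoid_algebra_def by auto
        then show "d \<in> power_exponents V E (t + 1)" unfolding bc(3) by (rule k[OF bc(2)])
      qed
      then have "a * x \<in> K" unfolding f(1) f'(1) K_def using f(3) f'(3) by (simp add: local_idealI mult_denominator)
      then show ?thesis using smult[OF aR] by blast
    qed
    then show "Y \<in> ?L" unfolding carrQ zeroQ pow x(2) using xJ by blast
  qed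
  then show ?thesis unfolding local_cohomology0_def Q_def[symmetric] J_def[symmetric] K_def[symmetric] q_def by simp
qed

text \<open>A subquotient of monomial ideals has as its length the number of exponents in the gap: a
  chain of monomial ideals attains it, and independence of separating numerators shows that no chain
  is longer.\<close>

lemma module_length_torsion:
  assumes "E \<subseteq> Pow V" and fin: "finite (torsion_exponents V E t - power_exponents V E (t + 1))"
  shows "module_length (type_subring (R :: ('v, 'k::field) mpoly fract set)) (local_cohomology0 (type_subring R) (local_max_ideal V)
       (quotient_module (ideal_module (type_subring R) (ideal_power (type_subring R) (edge_ideal V E) t))
          (ideal_power (type_subring R) (edge_ideal V E) (t + 1)))) = enat (torsion_count V E t)"
proof -
  let ?U = "power_exponents V E (t + 1)" and ?D = "torsion_exponents V E t"
  let ?K = "local_ideal V ?U :: ('v, 'k) mpoly fract set" and ?T = "local_ideal V ?D :: ('v, 'k) mpoly fract set"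
  have absU: "absorbing V (power_exponents V E s)" for s by (rule absorbing_power_exponents[OF assms(1)])
  have UU: "?U \<subseteq> power_exponents V E t"
  proof
    fix a assume "a \<in> ?U"
    then obtain b c where "b \<in> power_exponents V E t" "c \<in> power_exponents V E 1" "a = b + c"
      using power_exponents_Suc[of E t] by auto
    then show "a \<in> power_exponents V E t" using absU[of 1] absorbingD[OF absU] unfolding absorbing_def by blast
  qed
  have UD: "?U \<subseteq> ?D"
    unfolding torsion_exponents_def using UU absorbingD[OF absU] by blast
  have absD: "absorbing V ?D"
    unfolding absorbing_def
  proof (intro conjI ballI)
    show "?D \<subseteq> exponents V" using absU[of t] unfolding torsion_exponents_def absorbing_def by blast
    fix b c assume b: "b \<in> ?D" and c: "c \<in> exponents V"
    then obtain k where k: "\<And>d. d \<in> exponents V \<Longrightarrow> k \<le> total_degree V d \<Longrightarrow> b + d \<in> ?U" unfolding torsion_exponents_def by blast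
    have "b + c + d \<in> ?U" if "d \<in> exponents V" "k \<le> total_degree V d" for d
      using absorbingD[OF absU k[OF that] c] by (simp add: ac_simps)
    moreover have "b + c \<in> power_exponents V E t" using absorbingD[OF absU _ c] b unfolding torsion_exponents_def by blast
    ultimately show "b + c \<in> ?D" unfolding torsion_exponents_def by blast
  qed
  have KT: "?K \<subseteq> ?T" and TJ: "?T \<subseteq> local_ideal V (power_exponents V E t)"
    using UD monoid_algebra_mono unfolding local_ideal_def torsion_exponents_def monoid_algebra_def by blast+
  note iff = R.subquotient_chain_iff[OF local_ideal_ideal[OF absU] KT TJ local_ideal_ideal[OF absD]]
  show ?thesis
    unfolding edge_ideal_power[OF assms(1)] torsion_carrier[OF assms(1)] module_length_def iff torsion_count_def
  proof (rule antisym)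
    show "Sup {enat l |l. \<exists>I. (\<forall>i\<le>l. ideal (I i) (type_subring R) \<and> ?K \<subseteq> I i \<and> I i \<subseteq> ?T) \<and> (\<forall>i<l. I i \<subset> I (Suc i))} \<le> enat (card (?D - ?U))"
    proof (rule Sup_least)
      fix y assume "y \<in> {enat l |l. \<exists>I. (\<forall>i\<le>l. ideal (I i) (type_subring R) \<and> ?K \<subseteq> I i \<and> I i \<subseteq> ?T) \<and> (\<forall>i<l. I i \<subset> I (Suc i))}"
      then obtain l I where y: "y = enat l" and "\<forall>i\<le>l. ideal (I i) (type_subring R) \<and> ?K \<subseteq> I i \<and> I i \<subseteq> ?T" "\<forall>i<l. I i \<subset> I (Suc i)"
        by blast
      then show "y \<le> enat (card (?D - ?U))"
        unfolding y enat_ord_simps by (intro ideal_chain_length_le[OF fin absU absD, of l I]) simp_all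
    qed
    show "enat (card (?D - ?U)) \<le> Sup {enat l |l. \<exists>I. (\<forall>i\<le>l. ideal (I i) (type_subring R) \<and> ?K \<subseteq> I i \<and> I i \<subseteq> ?T) \<and> (\<forall>i<l. I i \<subset> I (Suc i))}"
      using ideal_chain_ex[OF fin absU absD UD] by (intro Sup_upper) blast
  qed
qed

end

section \<open>From counts to multiplicities\<close>

lemma edge_ideal_j_multiplicity_eq:
  fixes V :: "'v::linorder set"
  assumes "edge_system V E m"
    and lim: "(\<lambda>t. real (torsion_count V E t) / real t ^ (card V - 1)) \<longlonglongrightarrow> h"
  shows "edge_ideal_j_multiplicity TYPE('k::field) V E = ereal (fact (card V - 1)) * ereal h"
proof -
  interpret edge_system V E m by fact
  interpret local_ring V by unfold_locales (rule finite_V)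
  have "(\<lambda>t. ereal (real (torsion_count V E t)) / ereal (real t ^ (card V - 1))) \<longlonglongrightarrow> ereal h"
  proof (rule Lim_transform_eventually)
    show "(\<lambda>t. ereal (real (torsion_count V E t) / real t ^ (card V - 1))) \<longlonglongrightarrow> ereal h" using lim by simp
    \<comment> \<open>The two quotients can differ at \<open>t = 0\<close>, because division by zero
      differs between \<open>real\<close> and \<open>ereal\<close>.\<close>
    show "\<forall>\<^sub>F t in sequentially. ereal (real (torsion_count V E t) / real t ^ (card V - 1))
        = ereal (real (torsion_count V E t)) / ereal (real t ^ (card V - 1))"
      using eventually_gt_at_top[of 0] by eventually_elim simp
  qed
  then have "lim (\<lambda>t. ereal (real (torsion_count V E t)) / ereal (real t ^ (card V - 1))) = ereal h" by (rule limI)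
  then show ?thesis
    unfolding edge_ideal_j_multiplicity_def j_multiplicity_def krull_dim_local_poly_ring
    unfolding local_poly_ring_eq module_length_torsion[OF E_sub finite_torsion] by (simp add: Let_def)
qed

theorem theorem7p2:
  fixes V :: "'v::linorder set" and E :: "'v set set" and m :: nat
  assumes "hypergraph V E"
    and "\<forall>v\<in>V. \<not> isolated_node E v"
    and "m \<ge> 1"
    and "uniform_hypergraph m E"
    and "properly_connected m E"
    and "edge_ideal_j_multiplicity TYPE('k::field) V E \<noteq> 0"
  shows "edge_ideal_j_multiplicity TYPE('k) V E
           = ereal (real m) * edge_subring_multiplicity TYPE('k) V E"
proof -
  have sys: "edge_system V E m"
    using assms(1-5) by unfold_locales (auto simp: hypergraph_def isolated_node_def uniform_hypergraph_def)
  then interpret edge_system V E m .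
  have link: "linked i j" if "i \<in> V" "j \<in> V" for i j
  proof (rule ccontr)
    assume "\<not> linked i j"
    have "edge_ideal_j_multiplicity TYPE('k) V E = ereal (fact (card V - 1)) * ereal 0"
      by (rule edge_ideal_j_multiplicity_eq[OF sys torsion_count_tendsto_0[OF that \<open>\<not> linked i j\<close>]])
    with assms(6) show False by simp
  qed
  obtain h where h: "(\<lambda>t. real (card (sumset E t)) / real t ^ (card V - 1)) \<longlonglongrightarrow> h"
    "(\<lambda>t. real (torsion_count V E t) / real t ^ (card V - 1)) \<longlonglongrightarrow> real m * h"
    using torsion_count_tendsto[OF link] by blast
  have "edge_subring_multiplicity TYPE('k) V E = ereal (fact (card V - 1)) * ereal h"
    using sys link h(1) by (rule edge_subring_multiplicity_eq)
  then show ?thesis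
    unfolding edge_ideal_j_multiplicity_eq[OF sys h(2)] by (simp add: mult.left_commute)
qed

end
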